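(* Let $\Omega\subset\mathbb R^n$ be a bounded $C^4$ domain, $0<\theta<n\pi/2$, $\underline u\in C^3(\overline\Omega)$ convex, $K\subset\mathbb R^n$ compact and convex. Let $t\in[0,1]$ and let $u\in C^4(\overline\Omega)$ be a convex solution of $$G_t(Du,D^2u)=\theta\ \text{ in }\Omega,\qquad u=\underline u\ \text{ on }\partial\Omega,$$ with $Du(\overline\Omega)\subset K$ and $u\ge\underline u$ in $\Omega$, and assume that (MRC) holds on $\partial\Omega$. Suppose in addition that $$\mathcal B(x,u_\nu(x))\ge\theta+\sigma\qquad\text{on }\partial\Omega$$ for some $0<\sigma<\pi/2$. Then $$\sup_{\partial\Omega}|D^2u|\le C_0+C_1\cot\sigma .$$ The same upper bound is uniform along the homotopy $t\in[0,1]$ if the gap inequality $\mathcal B(x,s)\ge\theta+\sigma$ is imposed for all $s$ (with $M(x,s)\ge0$) in a normal-derivative window containing every $u_\nu(x)$. The constants $C_0,C_1$ are independent of both $t$ and $\sigma$.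
   Context: Let $n\ge2$, $\mathrm{Sym}(n)$ the real symmetric $n\times n$ matrices, $X:Y=\mathrm{tr}(XY)$, $|X|$ the operator norm, $\nu$ the inward unit normal of $\partial\Omega$, and $\mathrm{II}_{\partial\Omega}$ the second fundamental form normalized to be positive for convex boundaries. For $t\in[0,1]$, $p\in\mathbb R^n$, $X\in\mathrm{Sym}(n)$: $$w_t(p)=\sqrt{1+t^2|p|^2},\quad B_t(p)=(I+t^2p\otimes p)^{-1/2},\quad A_t(p,X)=\tfrac1{w_t(p)}B_t(p)XB_t(p),$$ $F(M)=\sum_i\arctan\lambda_i(M)$, $G_t(p,X)=F(A_t(p,X))$. Convex means $D^2u\ge0$. Boundary limiting phase. Let $\varphi=u|_{\partial\Omega}=\underline u|_{\partial\Omega}$. For $x\in\partial\Omega$, $s\in\mathbb R$ put $q=D_T\varphi(x)$ (tangential gradient), $p=q+s\nu(x)$, $M(x,s)=D^2_{\partial\Omega}\varphi(x)-s\,\mathrm{II}_{\partial\Omega}(x)$ (intrinsic boundary Hessian; it equals the tangential block of $D^2u$ when $s=u_\nu(x)$), and $C_{1,T}=\sqrt{1+|p|^2}\,(I_T+q\otimes q)$ on $T_x\partial\Omega$. When $M(x,s)\ge0$, $$\mathcal B(x,s)=\frac\pi2+\sum_{\alpha=1}^{n-1}\arctan\lambda_\alpha\bigl(C_{1,T}^{-1/2}M(x,s)C_{1,T}^{-1/2}\bigr).$$ (MRC). A level jet is $(t,p,X)\in[0,1]\times K\times\mathrm{Sym}(n)$ with $X\ge0$, $G_t(p,X)=\theta$;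 a level jet $(x,t,p,X)$ also carries a base point $x$. On it let $a^{ij}=\partial G_t/\partial X_{ij}$, $b^k=\partial G_t/\partial p_k$, $a(\xi,\eta)=a^{ij}\xi_i\eta_j$. Let $d$ be the inward distance to $\partial\Omega$ in a fixed collar and $$\mathcal J=a:(D^2\underline u(x)-X)+b\cdot(D\underline u(x)-p),\quad \ell=a:D^2d(x)+b\cdot Dd(x),\quad Q=a(p-D\underline u(x),p-D\underline u(x)).$$ A doubly degenerate recession sequence based at $x_0\in\partial\Omega$ is a sequence of level jets $(x_m,t_m,p_m,X_m)$, $x_m$ in the collar, with $x_m\to x_0$, $|X_m|\to\infty$, $a^{(m)}(Dd(x_m),Dd(x_m))\to0$, $Q^{(m)}\to0$ (superscript $(m)$: evaluation at the $m$-th jet). $\mathcal R^*_{x_0}$ is the set of subsequential limits $(j,g)$ of $(\mathcal J^{(m)},-\ell^{(m)})$ along all such sequences (empty if there are none). (MRC) holds at $x_0$ if there is $\tau_{x_0}>0$ with $\inf_{(j,g)\in\mathcal R^*_{x_0}}(j+\tau_{x_0}g)>0$ (infimum over the empty set is $+\infty$), and on $\partial\Omega$ if it holds at every boundary point. Constants are understood to be independent of the particular solution, for fixed $\Omega,\theta,\underline u,K$, when the positive margins in (MRC) are uniform on $\partial\Omega$. *)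

theory Defs
  imports "HOL-Analysis.Analysis"
begin

text \<open>
  For an open set, \<open>C_k_on k S\<close> is the usual class \<open>C^k(S)\<close>.  For the closure of a \<open>C^1\<close> domain it is
  the usual class of functions all of whose derivatives up to order \<open>k\<close> extend continuously to the
  closure: at a boundary point the one-sided derivative (within the closure) exists, is unique, and
  equals the continuous extension.
\<close>

primrec C_k_on :: "nat \<Rightarrow> (real^'n) set \<Rightarrow> (real^'n \<Rightarrow> real) \<Rightarrow> bool" where
  "C_k_on 0 S f \<longleftrightarrow> continuous_on S f"
| "C_k_on (Suc k) S f \<longleftrightarrow>
     (\<exists>g. (\<forall>x\<in>S. (f has_derivative (\<lambda>h. g x \<bullet> h)) (at x within S)) \<and>
          (\<forall>i. C_k_on k S (\<lambda>x. g x $ i)))"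

definition grad_on :: "(real^'n) set \<Rightarrow> (real^'n \<Rightarrow> real) \<Rightarrow> real^'n \<Rightarrow> real^'n" where
  "grad_on S f x = (THE g. (f has_derivative (\<lambda>h. g \<bullet> h)) (at x within S))"

definition hess_on :: "(real^'n) set \<Rightarrow> (real^'n \<Rightarrow> real) \<Rightarrow> real^'n \<Rightarrow> real^'n^'n" where
  "hess_on S f x = (THE H. (grad_on S f has_derivative (\<lambda>h. H *v h)) (at x within S))"

definition bounded_C_k_domain :: "nat \<Rightarrow> (real^'n) set \<Rightarrow> bool" where
  "bounded_C_k_domain k \<Omega> \<longleftrightarrow>
     open \<Omega> \<and> connected \<Omega> \<and> \<Omega> \<noteq> {} \<and> bounded \<Omega> \<and>
     (\<forall>x0\<in>frontier \<Omega>. \<exists>U \<rho>. open U \<and> x0 \<in> U \<and> C_k_on k U \<rho> \<and>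
        (\<forall>x\<in>U. grad_on U \<rho> x \<noteq> 0) \<and> \<Omega> \<inter> U = {x\<in>U. \<rho> x > 0})"

definition Sym :: "(real^'n^'n) set" where
  "Sym = {X. transpose X = X}"

definition psd :: "real^'n^'n \<Rightarrow> bool" where
  "psd X \<longleftrightarrow> (\<forall>v. 0 \<le> v \<bullet> (X *v v))"

definition mat_inner :: "real^'n^'n \<Rightarrow> real^'n^'n \<Rightarrow> real" where
  "mat_inner X Y = trace (X ** Y)"

definition op_norm :: "real^'n^'n \<Rightarrow> real" where
  "op_norm X = onorm (\<lambda>v. X *v v)"

definition outer :: "real^'n \<Rightarrow> real^'n \<Rightarrow> real^'n^'n" where
  "outer p q = (\<chi> i j. p $ i * q $ j)"

text \<open>
  Symmetric endomorphisms of a subspace \<open>T\<close> are given by their bilinear forms, \<open>N v w\<close> being the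
  inner product of the image of \<open>v\<close> with \<open>w\<close>.
\<close>

definition eigenspace_on ::
    "(real^'n) set \<Rightarrow> (real^'n \<Rightarrow> real^'n \<Rightarrow> real) \<Rightarrow> real \<Rightarrow> (real^'n) set" where
  "eigenspace_on T N l = {v\<in>T. \<forall>w\<in>T. N v w = l * (v \<bullet> w)}"

text \<open>The sum of \<open>arctan\<close> over all eigenvalues, repeated according to multiplicity.\<close>

definition arctan_sum_on ::
    "(real^'n) set \<Rightarrow> (real^'n \<Rightarrow> real^'n \<Rightarrow> real) \<Rightarrow> real" where
  "arctan_sum_on T N =
     (\<Sum>l | eigenspace_on T N l \<noteq> {0}. real (dim (eigenspace_on T N l)) * arctan l)"

text \<open>
  The inverse square root of a positive definite endomorphism \<open>f\<close> of a subspace \<open>T\<close>, extended by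
  \<open>0\<close> on the orthogonal complement of \<open>T\<close> to make it unique.
\<close>

definition inv_sqrt_on ::
    "(real^'n) set \<Rightarrow> (real^'n \<Rightarrow> real^'n) \<Rightarrow> real^'n \<Rightarrow> real^'n" where
  "inv_sqrt_on T f =
     (THE g. linear g \<and> g ` T \<subseteq> T \<and>
        (\<forall>v. (\<forall>w\<in>T. v \<bullet> w = 0) \<longrightarrow> g v = 0) \<and>
        (\<forall>v\<in>T. \<forall>w\<in>T. g v \<bullet> w = v \<bullet> g w) \<and>
        (\<forall>v\<in>T. v \<noteq> 0 \<longrightarrow> 0 < g v \<bullet> v) \<and>
        (\<forall>v\<in>T. g (g (f v)) = v))"

definition w_fun :: "real \<Rightarrow> real^'n \<Rightarrow> real" where
  "w_fun t p = sqrt (1 + t\<^sup>2 * (norm p)\<^sup>2)"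

definition B_mat :: "real \<Rightarrow> real^'n \<Rightarrow> real^'n^'n" where
  "B_mat t p = matrix (inv_sqrt_on UNIV (\<lambda>v. (mat 1 + t\<^sup>2 *\<^sub>R outer p p) *v v))"

definition A_mat :: "real \<Rightarrow> real^'n \<Rightarrow> real^'n^'n \<Rightarrow> real^'n^'n" where
  "A_mat t p X = (1 / w_fun t p) *\<^sub>R (B_mat t p ** X ** B_mat t p)"

definition F_fun :: "real^'n^'n \<Rightarrow> real" where
  "F_fun M = arctan_sum_on UNIV (\<lambda>v w. (M *v v) \<bullet> w)"

definition G_fun :: "real \<Rightarrow> real^'n \<Rightarrow> real^'n^'n \<Rightarrow> real" where
  "G_fun t p X = F_fun (A_mat t p X)"

text \<open>
  The function of \<open>X\<close> lives on the symmetric matrices only, so its gradient is the symmetric matrix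
  representing the differential along that subspace with respect to the trace pairing.
\<close>

definition G_X :: "real \<Rightarrow> real^'n \<Rightarrow> real^'n^'n \<Rightarrow> real^'n^'n" where
  "G_X t p X =
     (THE a. a \<in> Sym \<and> (G_fun t p has_derivative (\<lambda>Y. mat_inner a Y)) (at X within Sym))"

definition G_p :: "real \<Rightarrow> real^'n \<Rightarrow> real^'n^'n \<Rightarrow> real^'n" where
  "G_p t p X = grad_on UNIV (\<lambda>p'. G_fun t p' X) p"

definition solution ::
    "(real^'n) set \<Rightarrow> real \<Rightarrow> (real^'n \<Rightarrow> real) \<Rightarrow> (real^'n) set \<Rightarrow> real \<Rightarrow> (real^'n \<Rightarrow> real) \<Rightarrow> bool"
  where
  "solution \<Omega> \<theta> ub K t u \<longleftrightarrow>
     C_k_on 4 (closure \<Omega>) u \<and>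
     (\<forall>x\<in>\<Omega>. psd (hess_on (closure \<Omega>) u x)) \<and>
     (\<forall>x\<in>\<Omega>. G_fun t (grad_on (closure \<Omega>) u x) (hess_on (closure \<Omega>) u x) = \<theta>) \<and>
     (\<forall>x\<in>frontier \<Omega>. u x = ub x) \<and>
     grad_on (closure \<Omega>) u ` closure \<Omega> \<subseteq> K \<and>
     (\<forall>x\<in>\<Omega>. ub x \<le> u x)"

definition tangent_space :: "(real^'n) set \<Rightarrow> real^'n \<Rightarrow> (real^'n) set" where
  "tangent_space S x =
     {v. \<exists>c. c 0 = x \<and> range c \<subseteq> S \<and> (c has_vector_derivative v) (at (0::real))}"

definition inward_normal :: "(real^'n) set \<Rightarrow> real^'n \<Rightarrow> real^'n" where
  "inward_normal \<Omega> x =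
     (THE \<nu>. norm \<nu> = 1 \<and> (\<forall>v\<in>tangent_space (frontier \<Omega>) x. \<nu> \<bullet> v = 0) \<and>
        (\<exists>\<epsilon>>0. \<forall>s\<in>{0<..<\<epsilon>}. x + s *\<^sub>R \<nu> \<in> \<Omega>))"

text \<open>
  Derivatives within a hypersurface \<open>S\<close> are determined on the tangent space only; all derivatives
  below are applied to tangent vectors.
\<close>

definition tangential_grad :: "(real^'n) set \<Rightarrow> (real^'n \<Rightarrow> real) \<Rightarrow> real^'n \<Rightarrow> real^'n" where
  "tangential_grad S f x =
     (THE q. q \<in> tangent_space S x \<and> (f has_derivative (\<lambda>h. q \<bullet> h)) (at x within S))"

text \<open>
  The Levi-Civita connection of a hypersurface is the tangential part of the ambient derivative, so
  pairing the ambient derivative of the tangential gradient with a tangent vector gives the intrinsic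
  Hessian.
\<close>

definition boundary_hess ::
    "(real^'n) set \<Rightarrow> (real^'n \<Rightarrow> real) \<Rightarrow> real^'n \<Rightarrow> real^'n \<Rightarrow> real^'n \<Rightarrow> real" where
  "boundary_hess S f x v w = frechet_derivative (tangential_grad S f) (at x within S) v \<bullet> w"

text \<open>With the inward normal, the minus sign makes the form positive for convex domains.\<close>

definition second_ff :: "(real^'n) set \<Rightarrow> real^'n \<Rightarrow> real^'n \<Rightarrow> real^'n \<Rightarrow> real" where
  "second_ff \<Omega> x v w =
     - (frechet_derivative (inward_normal \<Omega>) (at x within frontier \<Omega>) v \<bullet> w)"

definition M_form ::
    "(real^'n) set \<Rightarrow> (real^'n \<Rightarrow> real) \<Rightarrow> real^'n \<Rightarrow> real \<Rightarrow> real^'n \<Rightarrow> real^'n \<Rightarrow> real" where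
  "M_form \<Omega> \<phi> x s v w = boundary_hess (frontier \<Omega>) \<phi> x v w - s * second_ff \<Omega> x v w"

definition M_nonneg :: "(real^'n) set \<Rightarrow> (real^'n \<Rightarrow> real) \<Rightarrow> real^'n \<Rightarrow> real \<Rightarrow> bool" where
  "M_nonneg \<Omega> \<phi> x s \<longleftrightarrow> (\<forall>v\<in>tangent_space (frontier \<Omega>) x. 0 \<le> M_form \<Omega> \<phi> x s v v)"

definition C1T :: "(real^'n) set \<Rightarrow> (real^'n \<Rightarrow> real) \<Rightarrow> real^'n \<Rightarrow> real \<Rightarrow> real^'n \<Rightarrow> real^'n" where
  "C1T \<Omega> \<phi> x s v =
     (let q = tangential_grad (frontier \<Omega>) \<phi> x; p = q + s *\<^sub>R inward_normal \<Omega> x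
      in sqrt (1 + (norm p)\<^sup>2) *\<^sub>R (v + (q \<bullet> v) *\<^sub>R q))"

text \<open>Meaningful when \<open>M_nonneg \<Omega> \<phi> x s\<close>.\<close>

definition limiting_phase :: "(real^'n) set \<Rightarrow> (real^'n \<Rightarrow> real) \<Rightarrow> real^'n \<Rightarrow> real \<Rightarrow> real" where
  "limiting_phase \<Omega> \<phi> x s =
     (let T = tangent_space (frontier \<Omega>) x; R = inv_sqrt_on T (C1T \<Omega> \<phi> x s)
      in pi / 2 + arctan_sum_on T (\<lambda>v w. M_form \<Omega> \<phi> x s (R v) (R w)))"

definition normal_deriv :: "(real^'n) set \<Rightarrow> (real^'n \<Rightarrow> real) \<Rightarrow> real^'n \<Rightarrow> real" where
  "normal_deriv \<Omega> u x = grad_on (closure \<Omega>) u x \<bullet> inward_normal \<Omega> x"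

definition bdist :: "(real^'n) set \<Rightarrow> real^'n \<Rightarrow> real" where
  "bdist \<Omega> x = infdist x (frontier \<Omega>)"

definition collar :: "(real^'n) set \<Rightarrow> real \<Rightarrow> (real^'n) set" where
  "collar \<Omega> r = {x \<in> closure \<Omega>. bdist \<Omega> x < r}"

text \<open>Such an \<open>r\<close> exists for every bounded \<open>C^4\<close> domain.\<close>

definition regular_collar :: "(real^'n) set \<Rightarrow> real \<Rightarrow> bool" where
  "regular_collar \<Omega> r \<longleftrightarrow> 0 < r \<and> C_k_on 4 (collar \<Omega> r) (bdist \<Omega>)"

definition level_jet ::
    "real \<Rightarrow> (real^'n) set \<Rightarrow> real \<Rightarrow> real^'n \<Rightarrow> real^'n^'n \<Rightarrow> bool" where
  "level_jet \<theta> K t p X \<longleftrightarrow> t \<in> {0..1} \<and> p \<in> K \<and> X \<in> Sym \<and> psd X \<and> G_fun t p X = \<theta>"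

definition jet_J ::
    "(real^'n) set \<Rightarrow> (real^'n \<Rightarrow> real) \<Rightarrow> real^'n \<Rightarrow> real \<Rightarrow> real^'n \<Rightarrow> real^'n^'n \<Rightarrow> real" where
  "jet_J \<Omega> ub x t p X =
     mat_inner (G_X t p X) (hess_on (closure \<Omega>) ub x - X) +
     G_p t p X \<bullet> (grad_on (closure \<Omega>) ub x - p)"

definition jet_l ::
    "(real^'n) set \<Rightarrow> real^'n \<Rightarrow> real \<Rightarrow> real^'n \<Rightarrow> real^'n^'n \<Rightarrow> real" where
  "jet_l \<Omega> x t p X =
     mat_inner (G_X t p X) (hess_on (closure \<Omega>) (bdist \<Omega>) x) +
     G_p t p X \<bullet> grad_on (closure \<Omega>) (bdist \<Omega>) x"

definition jet_Q ::
    "(real^'n) set \<Rightarrow> (real^'n \<Rightarrow> real) \<Rightarrow> real^'n \<Rightarrow> real \<Rightarrow> real^'n \<Rightarrow> real^'n^'n \<Rightarrow> real" where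
  "jet_Q \<Omega> ub x t p X =
     (let \<xi> = p - grad_on (closure \<Omega>) ub x in \<xi> \<bullet> (G_X t p X *v \<xi>))"

definition jet_normal ::
    "(real^'n) set \<Rightarrow> real^'n \<Rightarrow> real \<Rightarrow> real^'n \<Rightarrow> real^'n^'n \<Rightarrow> real" where
  "jet_normal \<Omega> x t p X =
     (let \<xi> = grad_on (closure \<Omega>) (bdist \<Omega>) x in \<xi> \<bullet> (G_X t p X *v \<xi>))"

definition recession_sequence ::
    "(real^'n) set \<Rightarrow> real \<Rightarrow> (real^'n \<Rightarrow> real) \<Rightarrow> (real^'n) set \<Rightarrow> real \<Rightarrow> real^'n \<Rightarrow>
     (nat \<Rightarrow> real^'n) \<Rightarrow> (nat \<Rightarrow> real) \<Rightarrow> (nat \<Rightarrow> real^'n) \<Rightarrow> (nat \<Rightarrow> real^'n^'n) \<Rightarrow> bool" where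
  "recession_sequence \<Omega> \<theta> ub K r x0 x t p X \<longleftrightarrow>
     (\<forall>m. x m \<in> collar \<Omega> r \<and> level_jet \<theta> K (t m) (p m) (X m)) \<and>
     x \<longlonglongrightarrow> x0 \<and>
     filterlim (\<lambda>m. op_norm (X m)) at_top sequentially \<and>
     (\<lambda>m. jet_normal \<Omega> (x m) (t m) (p m) (X m)) \<longlonglongrightarrow> 0 \<and>
     (\<lambda>m. jet_Q \<Omega> ub (x m) (t m) (p m) (X m)) \<longlonglongrightarrow> 0"

definition recession_limits ::
    "(real^'n) set \<Rightarrow> real \<Rightarrow> (real^'n \<Rightarrow> real) \<Rightarrow> (real^'n) set \<Rightarrow> real \<Rightarrow> real^'n \<Rightarrow>
     (real \<times> real) set" where
  "recession_limits \<Omega> \<theta> ub K r x0 =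
     {(j, g). \<exists>x t p X k. recession_sequence \<Omega> \<theta> ub K r x0 x t p X \<and> strict_mono (k :: nat \<Rightarrow> nat) \<and>
        (\<lambda>m. jet_J \<Omega> ub (x (k m)) (t (k m)) (p (k m)) (X (k m))) \<longlonglongrightarrow> j \<and>
        (\<lambda>m. - jet_l \<Omega> (x (k m)) (t (k m)) (p (k m)) (X (k m))) \<longlonglongrightarrow> g}"

text \<open>In \<open>ereal\<close> the infimum over the empty set is \<open>\<infinity>\<close>.\<close>

definition MRC_at ::
    "(real^'n) set \<Rightarrow> real \<Rightarrow> (real^'n \<Rightarrow> real) \<Rightarrow> (real^'n) set \<Rightarrow> real \<Rightarrow> real^'n \<Rightarrow> bool" where
  "MRC_at \<Omega> \<theta> ub K r x0 \<longleftrightarrow>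
     (\<exists>\<tau>>0. (INF (j, g) \<in> recession_limits \<Omega> \<theta> ub K r x0. ereal (j + \<tau> * g)) > 0)"

end

theory Submission
  imports Defs
begin

text \<open>
  The tangential block of \<open>D\<^sup>2u\<close> on the boundary is determined by the data and the normal derivative.
  For the mixed derivatives the recession condition says that \<open>h + \<tau> d\<close>, with \<open>h = u - ub\<close> and \<open>d\<close> the
  distance to the boundary, is a strict supersolution of the linearized equation wherever both
  \<open>a(Dd, Dd)\<close> and \<open>a(Dh, Dh)\<close> are small; elsewhere \<open>- N d\<^sup>2 - N h\<^sup>2\<close> makes it one.  This gives a barrier for
  the derivatives of \<open>h\<close> along fields tangential to the boundary, whose image under the linearized
  operator is bounded because \<open>a X\<close> is.  Finally, with bounded tangential and mixed blocks and double
  normal derivative \<open>m\<close>, the phase at \<open>t\<close> is at least the one at \<open>t = 1\<close>, which exceeds the limiting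
  phase minus \<open>C / m\<close>; hence the gap \<open>\<sigma>\<close> forces \<open>m \<le> C / \<sigma> \<le> C (1 + cot \<sigma>)\<close>.
\<close>

section \<open>Orthonormal eigenbases\<close>

text \<open>The obstacle is degenerate ellipticity: in an eigendirection of eigenvalue \<lambda> the
  coefficient matrix a behaves like 1/(1 + \<lambda>^2), so a(Dd,Dd) can be arbitrarily small where
  D^2u is large, and -d^2 alone gives no barrier. What survives is that a, aX and b are bounded by
  the dimension and a bound for p, since 1/(1 + \<lambda>^2) and \<lambda>/(1 + \<lambda>^2) are
  bounded. Writing A_t(p,X) = S X S with S a function of the product tp makes these bounds uniform
  in t, and the p-derivative reduces to that of the explicit matrix S^{-2}. Convexity enters the
  comparison in t: for X >= 0 the phase decreases along rays in p. The double normal bound compares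
  S X S with a block-diagonal matrix; its off-diagonal part is absorbed by completing the square,
  which costs a term of order C^2/m. Normals, tangential gradients and inverse square roots are
  given by definite descriptions, hence the long identification of each with a closed formula. All
  constants are fixed before t and u, and \<sigma> enters through 1/\<sigma> only.\<close>

definition onb :: "(real^'n) set \<Rightarrow> (real^'n) set \<Rightarrow> bool" where
  "onb T B \<longleftrightarrow> finite B \<and> pairwise orthogonal B \<and> (\<forall>b\<in>B. norm b = 1) \<and> span B = T"

lemma onb_expand: "onb T B \<Longrightarrow> v \<in> T \<Longrightarrow> (\<Sum>b\<in>B. (v \<bullet> b) *\<^sub>R b) = v"
  unfolding onb_def using orthonormal_basis_expand[of B v] by auto

lemma onb_inner:
  assumes "onb T B" "b \<in> B" "c \<in> B" shows "b \<bullet> c = (if b = c then 1 else 0)"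
  using assms unfolding onb_def pairwise_def orthogonal_def
  by (auto simp: norm_eq_1)

lemma onb_parseval:
  assumes "onb T B" "v \<in> T" shows "v \<bullet> w = (\<Sum>b\<in>B. (v \<bullet> b) * (w \<bullet> b))"
proof -
  have "v \<bullet> w = (\<Sum>b\<in>B. (v \<bullet> b) *\<^sub>R b) \<bullet> w" using onb_expand[OF assms] by simp
  then show ?thesis by (simp add: inner_sum_left inner_commute[of w])
qed

lemma onb_subset: "onb T B \<Longrightarrow> b \<in> B \<Longrightarrow> b \<in> T"
  unfolding onb_def using span_base by auto

lemma onb_independent: "onb T B \<Longrightarrow> independent B"
  unfolding onb_def by (metis norm_zero pairwise_orthogonal_independent zero_neq_one)

lemma onb_card: "onb T B \<Longrightarrow> card B = dim T"
  using onb_independent[of T B] unfolding onb_def by (metis dim_eq_card_independent dim_span)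

text \<open>Reads a first-order condition off an inequality that is quadratic in the size of the
  perturbation. The test value \<open>s = a / d\<close> with \<open>d > c\<close> satisfies
  \<open>a * s = d * s\<^sup>2\<close>.\<close>

lemma quadratic_le_imp_zero:
  fixes a c :: real
  assumes "\<And>s. a * s \<le> c * s\<^sup>2" shows "a = 0"
proof (rule ccontr)
  assume "a \<noteq> 0"
  define d where "d = \<bar>c\<bar> + 1"
  have d: "d > 0" "c < d" by (auto simp: d_def)
  have "a * (a / d) \<le> c * (a / d)\<^sup>2" by (rule assms)
  also have "\<dots> < d * (a / d)\<^sup>2" using d \<open>a \<noteq> 0\<close> by (intro mult_strict_right_mono) auto
  also have "\<dots> = a * (a / d)" using d by (simp add: power2_eq_square)
  finally show False by simp
qed

text \<open>The spectral theorem on a subspace, by induction on its dimension: a maximizer of the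
  quadratic form on the unit sphere of \<open>T\<close> is an eigenvector, and its orthogonal
  complement in \<open>T\<close> inherits the hypotheses. The eigenvalue equation is tested against
  \<open>T\<close> only, because \<open>f\<close> may lead out of \<open>T\<close>.\<close>

lemma exists_orthonormal_eigenbasis:
  fixes f :: "real^'n \<Rightarrow> real^'n"
  assumes "linear f" "subspace T" "\<And>v w. v \<in> T \<Longrightarrow> w \<in> T \<Longrightarrow> f v \<bullet> w = v \<bullet> f w"
  shows "\<exists>B. onb T B \<and> (\<forall>b\<in>B. \<forall>w\<in>T. f b \<bullet> w = (f b \<bullet> b) * (b \<bullet> w))"
  using assms(2,3)
proof (induction "dim T" arbitrary: T rule: less_induct)
  case less
  interpret linear f by fact
  show ?case
  proof (cases "T = {0}")
    case True
    then show ?thesis by (intro exI[of _ "{}"]) (auto simp: onb_def)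
  next
    case False
    then obtain z where z: "z \<in> T" "z \<noteq> 0" using less.prems(1) subspace_0 by blast
    let ?S = "T \<inter> sphere 0 1"
    have "compact ?S" using closed_subspace[OF less.prems(1)] by (simp add: closed_Int_compact)
    moreover have "(1 / norm z) *\<^sub>R z \<in> ?S"
      using z less.prems(1) by (auto simp: subspace_scale)
    moreover have "continuous_on ?S (\<lambda>v. f v \<bullet> v)"
      using \<open>linear f\<close> by (intro continuous_intros linear_continuous_on) (simp add: linear_linear)
    ultimately obtain b where b: "b \<in> ?S" and mx: "\<And>v. v \<in> ?S \<Longrightarrow> f v \<bullet> v \<le> f b \<bullet> b"
      using continuous_attains_sup[of ?S "\<lambda>v. f v \<bullet> v"] by blast
    define l where "l = f b \<bullet> b"
    have bT: "b \<in> T" and nb: "norm b = 1" "b \<bullet> b = 1" using b by (auto simp: norm_eq_1)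
    have mx': "f v \<bullet> v \<le> l * (v \<bullet> v)" if "v \<in> T" for v
    proof (cases "v = 0")
      case False
      let ?u = "(1 / norm v) *\<^sub>R v"
      have "?u \<in> ?S" using that False less.prems(1) by (auto simp: subspace_scale)
      from mx[OF this] have "(f v \<bullet> v) / (v \<bullet> v) \<le> l"
        by (simp add: scale l_def dot_square_norm power2_eq_square)
      then show ?thesis using False by (simp add: divide_le_eq)
    qed (simp add: zero)
    \<comment> \<open>Stationarity of the maximizer \<open>b\<close>, perturbed to
      \<open>b + s *\<^sub>R w\<close>.\<close>
    have orth: "f b \<bullet> w = 0" if "w \<in> T" "b \<bullet> w = 0" for w
    proof -
      have "(2 * (f b \<bullet> w)) * s \<le> (l * (w \<bullet> w) - f w \<bullet> w) * s\<^sup>2" for s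
      proof -
        have "b + s *\<^sub>R w \<in> T" using bT that less.prems(1) by (simp add: subspace_add subspace_scale)
        from mx'[OF this]
        show ?thesis using nb that less.prems(2)[of w b] bT
          by (simp add: add scale inner_add_left inner_add_right l_def inner_commute
              algebra_simps power2_eq_square)
      qed
      from quadratic_le_imp_zero[OF this] show ?thesis by simp
    qed
    let ?T = "{w\<in>T. b \<bullet> w = 0}"
    have sub: "subspace ?T" using less.prems(1) by (auto simp: subspace_def inner_add_right)
    have "b \<notin> ?T" using nb by simp
    then have "?T \<subset> T" using bT by blast
    then have "dim ?T < dim T"
      using dim_psubset[of ?T T] sub less.prems(1) by (metis span_eq_iff)
    from less.hyps[OF this sub] less.prems(2) obtain B where
      B: "onb ?T B" "\<forall>c\<in>B. \<forall>w\<in>?T. f c \<bullet> w = (f c \<bullet> c) * (c \<bullet> w)" by blast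
    have BT: "c \<in> T" "b \<bullet> c = 0" if "c \<in> B" for c using onb_subset[OF B(1) that] by auto
    have eq: "f b \<bullet> w = l * (b \<bullet> w)" if "w \<in> T" for w
    proof -
      have "w - (b \<bullet> w) *\<^sub>R b \<in> T" using that bT less.prems(1) by (simp add: subspace_diff subspace_scale)
      from orth[OF this] show ?thesis using nb by (simp add: inner_diff_right l_def mult.commute)
    qed
    have eq2: "f c \<bullet> w = (f c \<bullet> c) * (c \<bullet> w)" if "c \<in> B" "w \<in> T" for c w
    proof -
      have w: "w - (b \<bullet> w) *\<^sub>R b \<in> ?T"
        using that bT nb less.prems(1) by (simp add: subspace_diff subspace_scale inner_diff_right)
      have "f c \<bullet> b = 0" using orth[of c] BT[OF that(1)] less.prems(2)[of c b] bT by (simp add: inner_commute)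
      with B(2)[rule_format, OF that(1) w] BT[OF that(1)]
      show ?thesis by (simp add: inner_diff_right inner_commute)
    qed
    have "span (insert b B) = T"
    proof
      show "span (insert b B) \<subseteq> T" using BT bT less.prems(1) by (intro span_minimal) auto
      show "T \<subseteq> span (insert b B)"
      proof
        fix w assume w: "w \<in> T"
        have "w - (b \<bullet> w) *\<^sub>R b \<in> ?T"
          using w bT nb less.prems(1) by (simp add: subspace_diff subspace_scale inner_diff_right)
        then have "w - (b \<bullet> w) *\<^sub>R b \<in> span B" using B(1) by (simp add: onb_def)
        then show "w \<in> span (insert b B)" by (auto simp: span_insert)
      qed
    qed
    then have "onb T (insert b B)" using B(1) BT nb
      by (auto simp: onb_def pairwise_insert orthogonal_def inner_commute)
    moreover have "\<forall>c\<in>insert b B. \<forall>w\<in>T. f c \<bullet> w = (f c \<bullet> c) * (c \<bullet> w)"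
      using eq eq2 by (auto simp: l_def)
    ultimately show ?thesis by blast
  qed
qed

text \<open>The eigenspace for \<open>l\<close> is the span of the basis vectors with
  \<open>\<mu> b = l\<close>, so the sum over eigenvalues weighted by dimension regroups into a sum
  over the basis.\<close>

lemma arctan_sum_on_eq:
  fixes N :: "real^'n \<Rightarrow> real^'n \<Rightarrow> real"
  assumes B: "onb T B" and N: "\<And>v w. v \<in> T \<Longrightarrow> w \<in> T \<Longrightarrow> N v w = f v \<bullet> w" and f: "linear f"
    and diag: "\<And>b w. b \<in> B \<Longrightarrow> w \<in> T \<Longrightarrow> N b w = \<mu> b * (b \<bullet> w)"
  shows "arctan_sum_on T N = (\<Sum>b\<in>B. arctan (\<mu> b))"
proof -
  interpret linear f by fact
  have fin: "finite B" and sp: "span B = T" using B by (auto simp: onb_def)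
  have sub: "subspace T" using sp subspace_span by metis
  have BT: "b \<in> T" if "b \<in> B" for b using onb_subset[OF B that] .
  have Nv: "N v w = (\<Sum>b\<in>B. (v \<bullet> b) * \<mu> b * (b \<bullet> w))" if "v \<in> T" "w \<in> T" for v w
  proof -
    have "N v w = f (\<Sum>b\<in>B. (v \<bullet> b) *\<^sub>R b) \<bullet> w" using onb_expand[OF B that(1)] N that by simp
    also have "\<dots> = (\<Sum>b\<in>B. (v \<bullet> b) * (f b \<bullet> w))" by (simp add: sum scale inner_sum_left)
    also have "\<dots> = (\<Sum>b\<in>B. (v \<bullet> b) * \<mu> b * (b \<bullet> w))"
      using N diag BT that by (intro sum.cong) (auto simp flip: N)
    finally show ?thesis .
  qed
  have sumd: "(\<Sum>c\<in>B. (v \<bullet> c) * \<mu> c * (c \<bullet> b)) = (v \<bullet> b) * \<mu> b" if "b \<in> B" for v b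
  proof -
    have "(\<Sum>c\<in>B. (v \<bullet> c) * \<mu> c * (c \<bullet> b)) = (\<Sum>c\<in>B. if c = b then (v \<bullet> c) * \<mu> c else 0)"
      using onb_inner[OF B] that by (intro sum.cong) auto
    then show ?thesis using fin that by simp
  qed
  have E: "eigenspace_on T N l = span {b\<in>B. \<mu> b = l}" (is "_ = span ?B") for l
  proof
    show "span ?B \<subseteq> eigenspace_on T N l"
    proof (rule span_minimal)
      show "?B \<subseteq> eigenspace_on T N l" using BT diag by (auto simp: eigenspace_on_def)
      show "subspace (eigenspace_on T N l)" using sub
        by (auto simp: eigenspace_on_def subspace_def N add scale inner_add_left algebra_simps zero)
    qed
    show "eigenspace_on T N l \<subseteq> span ?B"
    proof
      fix v assume v: "v \<in> eigenspace_on T N l"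
      then have vT: "v \<in> T" by (simp add: eigenspace_on_def)
      have z: "(v \<bullet> b) *\<^sub>R b \<in> span ?B" if "b \<in> B" for b
      proof (cases "\<mu> b = l")
        case True then show ?thesis using that by (simp add: span_base span_scale)
      next
        case False
        \<comment> \<open>Two evaluations of \<open>N v b\<close> force the coefficient of
          \<open>v\<close> at a basis vector with another eigenvalue to vanish.\<close>
        have "N v b = l * (v \<bullet> b)" using v BT[OF that] by (simp add: eigenspace_on_def)
        moreover have "N v b = (v \<bullet> b) * \<mu> b"
          unfolding Nv[OF vT BT[OF that]] by (rule sumd[OF that])
        ultimately have "(v \<bullet> b) * (\<mu> b - l) = 0" by (simp only: right_diff_distrib mult.commute)
        then have "v \<bullet> b = 0" using False by simp
        then show ?thesis by (simp add: span_zero)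
      qed
      have "(\<Sum>b\<in>B. (v \<bullet> b) *\<^sub>R b) \<in> span ?B" by (intro span_sum z)
      then show "v \<in> span ?B" using onb_expand[OF B vT] by simp
    qed
  qed
  have ind: "independent {b\<in>B. \<mu> b = l}" for l
    using onb_independent[OF B] by (rule independent_mono) auto
  have dimE: "dim (eigenspace_on T N l) = card {b\<in>B. \<mu> b = l}" for l
    unfolding E using ind[of l] by (simp add: dim_eq_card_independent)
  have set: "{l. eigenspace_on T N l \<noteq> {0}} = \<mu> ` B"
  proof -
    have "b \<noteq> 0" if "b \<in> B" for b using B that by (auto simp: onb_def)
    then have "span {b\<in>B. \<mu> b = l} \<noteq> {0} \<longleftrightarrow> {b\<in>B. \<mu> b = l} \<noteq> {}" for l
      by (metis (no_types, lifting) empty_iff mem_Collect_eq singletonD span_base span_empty ex_in_conv)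
    then show ?thesis unfolding E by auto
  qed
  have "arctan_sum_on T N = (\<Sum>l\<in>\<mu> ` B. \<Sum>b\<in>{b\<in>B. \<mu> b = l}. arctan (\<mu> b))"
    unfolding arctan_sum_on_def set dimE by (intro sum.cong) auto
  also have "\<dots> = (\<Sum>b\<in>B. arctan (\<mu> b))"
    using sum.image_gen[OF fin, of "\<lambda>b. arctan (\<mu> b)" \<mu>] by simp
  finally show ?thesis .
qed

text \<open>With D = g - h one has g D + D h = g^2 - h^2 = 0 on \<open>T\<close>, the last equality
  because \<open>f\<close> is onto \<open>T\<close>. Tested on an eigenvector of the symmetric map D
  with eigenvalue l, this gives l (g b . b + h b . b) = 0, and positivity forces l = 0. The argument
  does not need g and h to commute.\<close>

lemma inv_sqrt_on_unique:
  fixes f g h :: "real^'n \<Rightarrow> real^'n"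
  assumes T: "subspace T"
    and f: "f ` T = T"
    and g: "linear g" "g ` T \<subseteq> T" "\<And>v. (\<forall>w\<in>T. v \<bullet> w = 0) \<Longrightarrow> g v = 0"
        "\<And>v w. v\<in>T \<Longrightarrow> w\<in>T \<Longrightarrow> g v \<bullet> w = v \<bullet> g w" "\<And>v. v\<in>T \<Longrightarrow> v \<noteq> 0 \<Longrightarrow> 0 < g v \<bullet> v"
        "\<And>v. v\<in>T \<Longrightarrow> g (g (f v)) = v"
    and h: "linear h" "h ` T \<subseteq> T" "\<And>v. (\<forall>w\<in>T. v \<bullet> w = 0) \<Longrightarrow> h v = 0"
        "\<And>v w. v\<in>T \<Longrightarrow> w\<in>T \<Longrightarrow> h v \<bullet> w = v \<bullet> h w" "\<And>v. v\<in>T \<Longrightarrow> v \<noteq> 0 \<Longrightarrow> 0 < h v \<bullet> v"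
        "\<And>v. v\<in>T \<Longrightarrow> h (h (f v)) = v"
  shows "g = h"
proof -
  have eq2: "g (g v) = h (h v)" if vT: "v \<in> T" for v
  proof -
    have "v \<in> f ` T" using vT by (simp only: f)
    then obtain u where "u \<in> T" "v = f u" by (rule imageE)
    then show ?thesis using g(6)[of u] h(6)[of u] by simp
  qed
  define D where "D = (\<lambda>v. g v - h v)"
  have linD: "linear D" unfolding D_def using g(1) h(1) by (rule linear_compose_sub)
  have DT: "D v \<in> T" if "v \<in> T" for v
  proof -
    have "g v \<in> T" "h v \<in> T" using that g(2) h(2) by blast+
    then show ?thesis using T by (simp add: D_def subspace_diff)
  qed
  have symD: "D v \<bullet> w = v \<bullet> D w" if "v \<in> T" "w \<in> T" for v w
    using g(4)[OF that] h(4)[OF that] by (simp add: D_def inner_diff_left inner_diff_right)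
  obtain B where B: "onb T B" and eig: "\<forall>b\<in>B. \<forall>w\<in>T. D b \<bullet> w = (D b \<bullet> b) * (b \<bullet> w)"
    using exists_orthonormal_eigenbasis[OF linD T symD] by blast
  have DB: "D b = 0" if b: "b \<in> B" for b
  proof -
    have bT: "b \<in> T" and nz: "b \<noteq> 0" using onb_subset[OF B b] B b by (auto simp: onb_def)
    define l where "l = D b \<bullet> b"
    have "D b - l *\<^sub>R b \<in> T" using T DT[OF bT] bT by (simp add: subspace_diff subspace_scale)
    then have "D b \<bullet> (D b - l *\<^sub>R b) = l * (b \<bullet> (D b - l *\<^sub>R b))"
      using eig b unfolding l_def by blast
    then have "(D b - l *\<^sub>R b) \<bullet> (D b - l *\<^sub>R b) = 0"
      by (simp only: inner_diff_left inner_scaleR_left)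
    then have Db: "D b = l *\<^sub>R b" by simp
    have "h b \<in> T" using h(2) bT by blast
    have "g (D b) + D (h b) = g (g b) - h (h b)"
      by (simp add: D_def linear_diff[OF g(1)])
    then have "(g (D b) + D (h b)) \<bullet> b = 0" using eq2[OF bT] by simp
    then have "g (D b) \<bullet> b + h b \<bullet> D b = 0"
      using symD[OF \<open>h b \<in> T\<close> bT] by (simp add: inner_add_left)
    then have "l * (g b \<bullet> b + h b \<bullet> b) = 0"
      by (simp add: Db linear_scale[OF g(1)] distrib_left)
    moreover have "g b \<bullet> b + h b \<bullet> b > 0" using g(5)[OF bT nz] h(5)[OF bT nz] by simp
    ultimately show ?thesis using Db by simp
  qed
  have DT0: "D v = 0" if "v \<in> T" for v
  proof -
    have "D v = D (\<Sum>b\<in>B. (v \<bullet> b) *\<^sub>R b)" using onb_expand[OF B that] by simp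
    also have "\<dots> = 0" using DB by (simp add: linear_sum[OF linD] linear_scale[OF linD])
    finally show ?thesis .
  qed
  show ?thesis
  proof
    fix v
    obtain y z where yz: "y \<in> span T" "\<And>w. w \<in> span T \<Longrightarrow> orthogonal z w" "v = y + z"
      using orthogonal_subspace_decomp_exists[of T v] by blast
    have "y \<in> T" using yz(1) T by (metis span_eq_iff)
    moreover have "\<forall>w\<in>T. z \<bullet> w = 0" using yz(2) by (auto simp: orthogonal_def span_base)
    ultimately show "g v = h v" using DT0[of y] g(3)[of z] h(3)[of z] yz(3)
      by (simp add: linear_add[OF g(1)] linear_add[OF h(1)] D_def)
  qed
qed

section \<open>The phase operator on symmetric matrices\<close>

lemma inner_matrix_transpose:
  fixes A :: "real^'n^'m" shows "(A *v x) \<bullet> y = x \<bullet> (transpose A *v y)"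
  by (metis dot_lmul_matrix inner_commute vector_transpose_matrix transpose_transpose transpose_matrix_vector)

lemma Sym_inner:
  assumes "X \<in> Sym" shows "(X *v v) \<bullet> w = v \<bullet> (X *v w)"
  using assms inner_matrix_transpose[of X v w] by (simp add: Sym_def)

lemma SymI:
  assumes "\<And>v w. (X *v v) \<bullet> w = v \<bullet> (X *v w)" shows "X \<in> Sym"
proof -
  have "v \<bullet> (transpose X *v w) = v \<bullet> (X *v w)" for v w
    using assms[of v w] inner_matrix_transpose[of X v w] by simp
  then have "transpose X *v w = X *v w" for w using vector_eq_ldot by blast
  then show ?thesis by (simp add: Sym_def matrix_eq)
qed

lemma matrix_vector_mult_scaleR_left: "(c *\<^sub>R A) *v x = c *\<^sub>R (A *v (x :: real^'n))"
  by (rule scaleR_matrix_vector_assoc[symmetric])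

lemma subspace_Sym: "subspace Sym"
  unfolding subspace_def
  by (auto intro!: SymI simp: Sym_inner matrix_vector_mult_add_rdistrib matrix_vector_mult_scaleR_left
      inner_add_left inner_add_right)

lemma norm_matrix_vector_mult_le: "norm (Y *v (v :: real^'n)) \<le> norm Y * norm v"
proof -
  have "(Y *v v) $ i = (Y $ i) \<bullet> v" for i
    by (simp add: matrix_vector_mult_def inner_vec_def)
  then have "\<bar>(Y *v v) $ i\<bar> \<le> norm (Y $ i) * norm v" for i by (simp add: Cauchy_Schwarz_ineq2)
  then have "L2_set (\<lambda>i. \<bar>(Y *v v) $ i\<bar>) UNIV \<le> L2_set (\<lambda>i. norm (Y $ i) * norm v) UNIV"
    by (intro L2_set_mono) auto
  then show ?thesis by (simp add: norm_vec_def L2_set_left_distrib)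
qed

lemma norm_transpose: "norm (transpose (M :: real^'n^'n)) = norm M"
proof -
  have "transpose M \<bullet> transpose M = M \<bullet> M"
    unfolding inner_vec_def transpose_def by (simp, subst sum.swap, rule refl)
  then show ?thesis by (simp add: norm_eq_sqrt_inner)
qed

text \<open>The projection onto \<open>Sym\<close>. Composing with it extends a function of
  symmetric matrices to all matrices, so that derivatives can be taken at a point of the full matrix
  space.\<close>

definition symm :: "real^'n^'n \<Rightarrow> real^'n^'n" where
  "symm M = (1/2) *\<^sub>R (M + transpose M)"

lemma inner_symm: "(symm M *v v) \<bullet> w = ((M *v v) \<bullet> w + v \<bullet> (M *v w)) / 2"
  using inner_matrix_transpose[of "transpose M" v w]
  by (simp add: symm_def matrix_vector_mult_scaleR_left matrix_vector_mult_add_rdistrib inner_add_left)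

lemma symm_Sym [simp]: "symm (M :: real^'n^'n) \<in> Sym"
proof (rule SymI)
  fix v w :: "real^'n"
  show "(symm M *v v) \<bullet> w = v \<bullet> (symm M *v w)"
    using inner_symm[of M v w] inner_symm[of M w v]
    by (simp add: inner_commute[of v "symm M *v w"] inner_commute[of "M *v w" v] inner_commute[of w])
qed

lemma symm_id: "M \<in> Sym \<Longrightarrow> symm M = M"
  by (simp add: symm_def Sym_def flip: scaleR_2)

lemma symm_add: "symm (M + N) = symm M + symm N"
  by (simp add: symm_def transpose_def vec_eq_iff algebra_simps add_divide_distrib)

lemma norm_symm: "norm (symm M) \<le> norm M"
  using norm_triangle_ineq[of M "transpose M"] by (simp add: symm_def norm_transpose)

lemma onb_UNIV_card: "onb UNIV B \<Longrightarrow> card (B :: (real^'n) set) = CARD('n)"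
  using onb_card[of UNIV B] by simp

lemma exists_eigenbasis:
  assumes "M \<in> Sym"
  shows "\<exists>B. onb UNIV B \<and> (\<forall>b\<in>B. M *v b = ((M *v b) \<bullet> b) *\<^sub>R b)"
proof -
  have lin: "linear ((*v) M)" by simp
  obtain B where B: "onb UNIV B"
      and e: "\<forall>b\<in>B. \<forall>w\<in>UNIV. (M *v b) \<bullet> w = ((M *v b) \<bullet> b) * (b \<bullet> w)"
    using exists_orthonormal_eigenbasis[OF lin subspace_UNIV Sym_inner[OF assms]] by blast
  have "M *v b = ((M *v b) \<bullet> b) *\<^sub>R b" if "b \<in> B" for b
  proof -
    have "\<forall>w. (M *v b) \<bullet> w = (((M *v b) \<bullet> b) *\<^sub>R b) \<bullet> w"
      using e that unfolding inner_scaleR_left by blast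
    then show ?thesis using vector_eq_rdot by blast
  qed
  with B show ?thesis by blast
qed

text \<open>The chosen basis need not vary continuously with the matrix. Differentiability of the
  phase is therefore obtained from a quadratic remainder bound and not by differentiating
  eigenvalues.\<close>

definition eigb :: "real^'n^'n \<Rightarrow> (real^'n) set" where
  "eigb M = (SOME B. onb UNIV B \<and> (\<forall>b\<in>B. M *v b = ((M *v b) \<bullet> b) *\<^sub>R b))"

definition eigv :: "real^'n^'n \<Rightarrow> real^'n \<Rightarrow> real" where
  "eigv M b = (M *v b) \<bullet> b"

lemma eigb:
  assumes "M \<in> Sym"
  shows "onb UNIV (eigb M)" "b \<in> eigb M \<Longrightarrow> M *v b = eigv M b *\<^sub>R b"
  using someI_ex[OF exists_eigenbasis[OF assms]] unfolding eigb_def[symmetric] eigv_def by blast+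

lemma F_fun_eq:
  assumes "onb UNIV B" "\<And>b. b \<in> B \<Longrightarrow> M *v b = \<mu> b *\<^sub>R b"
  shows "F_fun M = (\<Sum>b\<in>B. arctan (\<mu> b))"
  unfolding F_fun_def
  by (rule arctan_sum_on_eq[OF assms(1), of _ "(*v) M"]) (auto simp: assms(2))

text \<open>The derivative of arctan is 1-Lipschitz because
  \<open>\<bar>x + z\<bar> \<le> (1 + z\<^sup>2) * (1 + x\<^sup>2)\<close>; the mean value theorem
  then supplies a point \<open>z\<close> between \<open>x\<close> and \<open>y\<close>. The constant
  1 is global, which the matrix version needs.\<close>

lemma arctan_second_order:
  fixes x y :: real
  shows "\<bar>arctan y - arctan x - (y - x) / (1 + x\<^sup>2)\<bar> \<le> (y - x)\<^sup>2"
proof -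
  have key: "\<bar>1 / (1 + z\<^sup>2) - 1 / (1 + x\<^sup>2)\<bar> \<le> \<bar>z - x\<bar>" for z
  proof -
    have p: "0 < 1 + z\<^sup>2" "0 < 1 + x\<^sup>2" by (auto intro: add_pos_nonneg)
    have "1 / (1 + z\<^sup>2) - 1 / (1 + x\<^sup>2) = (x - z) * ((x + z) / ((1 + z\<^sup>2) * (1 + x\<^sup>2)))"
      using p by (simp add: field_simps power2_eq_square)
    moreover have "\<bar>(x + z) / ((1 + z\<^sup>2) * (1 + x\<^sup>2))\<bar> \<le> 1"
    proof -
      have "\<bar>x + z\<bar> \<le> (1 + z\<^sup>2) * (1 + x\<^sup>2)"
      proof -
        have "\<bar>x\<bar> \<le> (1 + x\<^sup>2) / 2" "\<bar>z\<bar> \<le> (1 + z\<^sup>2) / 2"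
          using sum_squares_bound[of 1 "\<bar>x\<bar>"] sum_squares_bound[of 1 "\<bar>z\<bar>"] by auto
        then have "\<bar>x + z\<bar> \<le> (1 + x\<^sup>2) / 2 + (1 + z\<^sup>2) / 2"
          by (intro order.trans[OF abs_triangle_ineq] add_mono)
        also have "\<dots> \<le> 1 + x\<^sup>2 + z\<^sup>2" by (simp add: field_simps)
        also have "\<dots> \<le> (1 + z\<^sup>2) * (1 + x\<^sup>2)" by (simp add: algebra_simps)
        finally show ?thesis .
      qed
      then show ?thesis using p by (simp add: abs_mult)
    qed
    ultimately have "\<bar>1 / (1 + z\<^sup>2) - 1 / (1 + x\<^sup>2)\<bar> \<le> \<bar>x - z\<bar> * 1"
      unfolding abs_mult by (metis abs_ge_zero abs_mult mult_left_mono)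
    then show ?thesis by simp
  qed
  have d: "(arctan has_real_derivative 1 / (1 + z\<^sup>2)) (at z)" for z
    using DERIV_arctan[of z] by (simp add: inverse_eq_divide)
  have "\<exists>z. \<bar>z - x\<bar> \<le> \<bar>y - x\<bar> \<and> arctan y - arctan x = (y - x) * (1 / (1 + z\<^sup>2))"
  proof (rule linorder_cases[of x y])
    assume "x = y" then show ?thesis by (auto intro: exI[of _ x])
  next
    assume "x < y"
    then obtain z where z: "z > x" "z < y" "arctan y - arctan x = (y - x) * (1 / (1 + z\<^sup>2))"
      using MVT2[OF \<open>x < y\<close>, of arctan "\<lambda>z. 1 / (1 + z\<^sup>2)"] d by blast
    then show ?thesis by (intro exI[of _ z]) auto
  next
    assume "y < x"
    then obtain z where z: "z > y" "z < x" "arctan x - arctan y = (x - y) * (1 / (1 + z\<^sup>2))"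
      using MVT2[OF \<open>y < x\<close>, of arctan "\<lambda>z. 1 / (1 + z\<^sup>2)"] d by blast
    then have "arctan y - arctan x = (y - x) * (1 / (1 + z\<^sup>2))"
      by (metis minus_diff_eq mult_minus_left)
    then show ?thesis using z by (intro exI[of _ z]) auto
  qed
  then obtain z where z: "\<bar>z - x\<bar> \<le> \<bar>y - x\<bar>" "arctan y - arctan x = (y - x) * (1 / (1 + z\<^sup>2))" by blast
  have "arctan y - arctan x - (y - x) / (1 + x\<^sup>2) = (y - x) * (1 / (1 + z\<^sup>2) - 1 / (1 + x\<^sup>2))"
    by (simp add: z(2) right_diff_distrib)
  then have "\<bar>arctan y - arctan x - (y - x) / (1 + x\<^sup>2)\<bar> \<le> \<bar>y - x\<bar> * \<bar>y - x\<bar>"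
    using order.trans[OF key[of z] z(1)] by (simp only: abs_mult) (rule mult_left_mono, simp_all)
  then show ?thesis by (simp add: power2_eq_square)
qed

text \<open>The number tr((I + M^2)^{-1} Y), written in the eigenbasis of \<open>M\<close>.\<close>

definition dF :: "real^'n^'n \<Rightarrow> real^'n^'n \<Rightarrow> real" where
  "dF M Y = (\<Sum>b\<in>eigb M. ((Y *v b) \<bullet> b) / (1 + (eigv M b)\<^sup>2))"

text \<open>
  With eigenbases \<open>b\<close> of \<open>M\<close> and \<open>c\<close> of \<open>N\<close>, the remainder is
  \<open>\<Sum>\<^sub>b\<^sub>,\<^sub>c (b \<bullet> c)\<^sup>2 (arctan \<mu>\<^sub>c - arctan \<lambda>\<^sub>b - (\<mu>\<^sub>c - \<lambda>\<^sub>b) / (1 + \<lambda>\<^sub>b\<^sup>2))\<close> (Klein's identity).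
\<close>

lemma F_fun_second_order:
  fixes M N :: "real^'n^'n"
  assumes M: "M \<in> Sym" and N: "N \<in> Sym"
  shows "\<bar>F_fun N - F_fun M - dF M (N - M)\<bar> \<le> CARD('n) * (norm (N - M))\<^sup>2"
proof -
  let ?B = "eigb M" and ?C = "eigb N" and ?l = "eigv M" and ?m = "eigv N"
  note B = eigb[OF M] and C = eigb[OF N]
  have FM: "F_fun M = (\<Sum>b\<in>?B. arctan (?l b))" and FN: "F_fun N = (\<Sum>c\<in>?C. arctan (?m c))"
    using F_fun_eq B C by blast+
  \<comment> \<open>The weights (b . c)^2 form a doubly stochastic matrix; this turns each of the
    single sums for \<open>F_fun M\<close> and \<open>F_fun N\<close> into a double sum over pairs
    of eigenvectors.\<close>
  have one: "(\<Sum>c\<in>?C. (b \<bullet> c)\<^sup>2) = 1" if "b \<in> ?B" for b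
    using onb_parseval[OF C(1), of b b] onb_inner[OF B(1) that that] by (simp add: power2_eq_square)
  have one': "(\<Sum>b\<in>?B. (b \<bullet> c)\<^sup>2) = 1" if "c \<in> ?C" for c
    using onb_parseval[OF B(1), of c c] onb_inner[OF C(1) that that] by (simp add: power2_eq_square inner_commute)
  have Nbc: "(N *v b) \<bullet> c = ?m c * (b \<bullet> c)" if "c \<in> ?C" for b c
    using Sym_inner[OF N, of b c] C(2)[OF that] by simp
  have D: "((N - M) *v b) \<bullet> c = (?m c - ?l b) * (b \<bullet> c)" if "b \<in> ?B" "c \<in> ?C" for b c
    using Nbc[OF that(2)] B(2)[OF that(1)]
    by (simp add: matrix_vector_mult_diff_rdistrib inner_diff_left left_diff_distrib)
  have Db: "((N - M) *v b) \<bullet> b = (\<Sum>c\<in>?C. (b \<bullet> c)\<^sup>2 * (?m c - ?l b))" if "b \<in> ?B" for b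
    using onb_parseval[OF C(1), of "(N - M) *v b" b] D[OF that]
    by (simp add: power2_eq_square mult_ac)
  \<comment> \<open>Parseval's identity: the squared eigenvalue gaps, with these weights, add up to
    |(N - M) b|^2. Thus the scalar remainder becomes a bound by a matrix norm.\<close>
  have Dn: "(\<Sum>c\<in>?C. (b \<bullet> c)\<^sup>2 * (?m c - ?l b)\<^sup>2) = (norm ((N - M) *v b))\<^sup>2" if "b \<in> ?B" for b
  proof -
    have "(norm ((N - M) *v b))\<^sup>2 = (\<Sum>c\<in>?C. (((N - M) *v b) \<bullet> c) * (((N - M) *v b) \<bullet> c))"
      unfolding power2_norm_eq_inner by (rule onb_parseval[OF C(1)]) simp
    also have "\<dots> = (\<Sum>c\<in>?C. (b \<bullet> c)\<^sup>2 * (?m c - ?l b)\<^sup>2)"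
      using D[OF that] by (intro sum.cong) (auto simp: power2_eq_square)
    finally show ?thesis ..
  qed
  have FN': "F_fun N = (\<Sum>b\<in>?B. \<Sum>c\<in>?C. (b \<bullet> c)\<^sup>2 * arctan (?m c))"
    unfolding FN by (subst sum.swap) (simp add: one' flip: sum_distrib_right)
  have FM': "F_fun M = (\<Sum>b\<in>?B. \<Sum>c\<in>?C. (b \<bullet> c)\<^sup>2 * arctan (?l b))"
    unfolding FM by (simp add: one flip: sum_distrib_right)
  have dM': "dF M (N - M) = (\<Sum>b\<in>?B. \<Sum>c\<in>?C. (b \<bullet> c)\<^sup>2 * ((?m c - ?l b) / (1 + (?l b)\<^sup>2)))"
    unfolding dF_def using Db by (intro sum.cong) (auto simp: sum_divide_distrib)
  have "F_fun N - F_fun M - dF M (N - M) =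
    (\<Sum>b\<in>?B. \<Sum>c\<in>?C. (b \<bullet> c)\<^sup>2 * (arctan (?m c) - arctan (?l b) - (?m c - ?l b) / (1 + (?l b)\<^sup>2)))"
    unfolding FN' FM' dM' by (simp add: sum_subtractf right_diff_distrib)
  also have "\<bar>\<dots>\<bar> \<le> (\<Sum>b\<in>?B. \<Sum>c\<in>?C. \<bar>(b \<bullet> c)\<^sup>2 * (arctan (?m c) - arctan (?l b) - (?m c - ?l b) / (1 + (?l b)\<^sup>2))\<bar>)"
    by (intro order.trans[OF sum_abs] sum_mono sum_abs)
  also have "\<dots> \<le> (\<Sum>b\<in>?B. \<Sum>c\<in>?C. (b \<bullet> c)\<^sup>2 * (?m c - ?l b)\<^sup>2)"
    unfolding abs_mult by (intro sum_mono mult_mono) (auto simp: arctan_second_order)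
  also have "\<dots> = (\<Sum>b\<in>?B. (norm ((N - M) *v b))\<^sup>2)" by (simp add: Dn)
  also have "\<dots> \<le> (\<Sum>b\<in>?B. (norm (N - M))\<^sup>2)"
  proof (intro sum_mono power_mono)
    fix b assume "b \<in> ?B"
    then show "norm ((N - M) *v b) \<le> norm (N - M)"
      using norm_matrix_vector_mult_le[of "N - M" b] B(1) by (simp add: onb_def)
  qed auto
  also have "\<dots> = CARD('n) * (norm (N - M))\<^sup>2" using onb_UNIV_card[OF B(1)] by simp
  finally show ?thesis .
qed

lemma has_derivative_second_order:
  fixes f :: "'a::real_normed_vector \<Rightarrow> real"
  assumes "bounded_linear L" "\<And>y. \<bar>f y - f x - L (y - x)\<bar> \<le> C * (norm (y - x))\<^sup>2"
  shows "(f has_derivative L) (at x)"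
  unfolding has_derivative_iff_norm
proof
  have "((\<lambda>y. C * norm (y - x)) \<longlongrightarrow> C * norm (x - x)) (at x)" by (intro tendsto_intros)
  then have t: "((\<lambda>y. C * norm (y - x)) \<longlongrightarrow> 0) (at x)" by simp
  show "((\<lambda>y. norm (f y - f x - L (y - x)) / norm (y - x)) \<longlongrightarrow> 0) (at x)"
  proof (rule Lim_null_comparison[OF _ t])
    show "\<forall>\<^sub>F y in at x. norm (norm (f y - f x - L (y - x)) / norm (y - x)) \<le> C * norm (y - x)"
      unfolding eventually_at_filter
    proof (intro always_eventually allI impI)
      fix y assume "y \<noteq> x"
      then have "norm (y - x) > 0" by simp
      then show "norm (norm (f y - f x - L (y - x)) / norm (y - x)) \<le> C * norm (y - x)"
        using assms(2)[of y] by (simp add: divide_le_eq power2_eq_square mult.assoc)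
    qed
  qed
qed (rule assms(1))

definition Fs :: "real^'n^'n \<Rightarrow> real" where "Fs M = F_fun (symm M)"

lemma linear_dF: "linear (dF M)"
  unfolding dF_def
  by (intro linearI)
    (simp_all add: matrix_vector_mult_add_rdistrib matrix_vector_mult_scaleR_left inner_add_left
      add_divide_distrib sum.distrib sum_distrib_left)

lemma dF_symm: "dF M (symm Y) = dF M Y"
proof -
  have "(symm Y *v b) \<bullet> b = (Y *v b) \<bullet> b" for b
    using inner_symm[of Y b b] inner_commute[of b "Y *v b"] by simp
  then show ?thesis by (simp add: dF_def)
qed

lemma Fs_has_derivative:
  fixes M :: "real^'n^'n" shows "(Fs has_derivative dF (symm M)) (at M)"
proof (rule has_derivative_second_order)
  show "bounded_linear (dF (symm M))" using linear_dF linear_conv_bounded_linear by blast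
  show "\<bar>Fs N - Fs M - dF (symm M) (N - M)\<bar> \<le> CARD('n) * (norm (N - M))\<^sup>2" for N :: "real^'n^'n"
  proof -
    have eq: "symm N - symm M = symm (N - M)"
      using symm_add[of "N - M" M] by simp
    have "\<bar>Fs N - Fs M - dF (symm M) (N - M)\<bar> \<le> CARD('n) * (norm (symm (N - M)))\<^sup>2"
      using F_fun_second_order[OF symm_Sym symm_Sym, of N M] by (simp add: Fs_def eq dF_symm)
    also have "\<dots> \<le> CARD('n) * (norm (N - M))\<^sup>2"
      by (intro mult_left_mono power_mono norm_symm) auto
    finally show ?thesis .
  qed
qed

lemma dF_nonneg: "psd Y \<Longrightarrow> 0 \<le> dF M Y"
  unfolding dF_def psd_def
  by (intro sum_nonneg divide_nonneg_nonneg) (auto simp: inner_commute add_nonneg_nonneg)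

text \<open>Along the segment from \<open>M\<close> to \<open>N\<close> the derivative is
  \<open>dF\<close> applied to \<open>N - M\<close>, a combination with positive weights of values
  of a nonnegative form.\<close>

lemma F_fun_mono:
  assumes M: "M \<in> Sym" and N: "N \<in> Sym" and le: "psd (N - M)"
  shows "F_fun M \<le> F_fun N"
proof -
  let ?h = "\<lambda>s. Fs (M + s *\<^sub>R (N - M))"
  have d: "(?h has_real_derivative dF (symm (M + s *\<^sub>R (N - M))) (N - M)) (at s)" for s
  proof -
    have "(?h has_derivative (\<lambda>x. dF (symm (M + s *\<^sub>R (N - M))) (x *\<^sub>R (N - M)))) (at s)"
      by (rule has_derivative_compose[OF _ Fs_has_derivative]) (auto intro!: derivative_eq_intros)
    moreover have "dF K (x *\<^sub>R (N - M)) = dF K (N - M) * x" for x K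
      using linear_scale[OF linear_dF] by (simp add: mult.commute)
    ultimately show ?thesis by (simp add: has_field_derivative_def)
  qed
  have "?h 0 \<le> ?h 1"
    by (rule DERIV_nonneg_imp_nondecreasing) (use d dF_nonneg[OF le] in auto)
  then show ?thesis using M N by (simp add: Fs_def symm_id)
qed

section \<open>The operator in the variables (p, X)\<close>

lemma outer_mult: "outer p q *v v = (q \<bullet> v) *\<^sub>R p"
  by (simp add: outer_def matrix_vector_mult_def vec_eq_iff inner_vec_def sum_distrib_left sum_distrib_right mult_ac)

lemma mat_inner_outer: "mat_inner (outer x y) Y = y \<bullet> (Y *v x)"
proof -
  have "mat_inner (outer x y) Y = (\<Sum>i\<in>UNIV. \<Sum>j\<in>UNIV. x $ i * y $ j * Y $ j $ i)"
    by (simp add: mat_inner_def trace_def matrix_matrix_mult_def outer_def)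
  also have "\<dots> = (\<Sum>j\<in>UNIV. \<Sum>i\<in>UNIV. x $ i * y $ j * Y $ j $ i)" by (rule sum.swap)
  also have "\<dots> = y \<bullet> (Y *v x)"
    by (simp add: inner_vec_def matrix_vector_mult_def sum_distrib_left mult_ac)
  finally show ?thesis .
qed

lemma mat_inner_linear_right: "linear (mat_inner a)"
proof (rule linearI)
  show "mat_inner a (X + Y) = mat_inner a X + mat_inner a Y" for X Y
    by (simp add: mat_inner_def matrix_add_ldistrib trace_add)
  show "mat_inner a (c *\<^sub>R X) = c *\<^sub>R mat_inner a X" for X c
    by (simp add: mat_inner_def trace_def matrix_matrix_mult_def sum_distrib_left mult_ac)
qed

lemma mat_inner_commute: "mat_inner a X = mat_inner X a"
  unfolding mat_inner_def by (rule trace_mul_sym)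

lemma mat_inner_linear_left: "linear (\<lambda>a. mat_inner a X)"
proof -
  have "(\<lambda>a. mat_inner a X) = mat_inner X" using mat_inner_commute by blast
  then show ?thesis by (simp only: mat_inner_linear_right)
qed

lemma matrix_sum_vec: "(\<Sum>b\<in>B. f b) *v (v :: real^'n) = (\<Sum>b\<in>B. f b *v v)"
  by (induction B rule: infinite_finite_induct) (auto simp: matrix_vector_mult_add_rdistrib)

text \<open>
  \<open>Sm p\<close> is the inverse square root of \<open>Pm p\<close> and \<open>Rm p\<close> its square root; the matrix \<open>A\<^sub>t(p, X)\<close> is
  \<open>Sm (t p) X Sm (t p)\<close>.
\<close>
definition wt :: "real^'n \<Rightarrow> real" where "wt p = sqrt (1 + p \<bullet> p)"

definition Sm :: "real^'n \<Rightarrow> real^'n^'n" where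
  "Sm p = (1 / sqrt (wt p)) *\<^sub>R (mat 1 - (1 / (wt p * (wt p + 1))) *\<^sub>R outer p p)"

definition Pm :: "real^'n \<Rightarrow> real^'n^'n" where
  "Pm p = wt p *\<^sub>R (mat 1 + outer p p)"

definition Rm :: "real^'n \<Rightarrow> real^'n^'n" where
  "Rm p = sqrt (wt p) *\<^sub>R (mat 1 + (1 / (wt p + 1)) *\<^sub>R outer p p)"

lemma wt_ge1: "1 \<le> wt p" by (simp add: wt_def)
lemma wt_pos: "0 < wt p" using wt_ge1[of p] by linarith
lemma wt_sq: "p \<bullet> p = (wt p - 1) * (wt p + 1)"
proof -
  have "(wt p)\<^sup>2 = 1 + p \<bullet> p" by (simp add: wt_def add_nonneg_nonneg)
  then show ?thesis by (simp add: algebra_simps power2_eq_square)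
qed
lemma wt_le: "wt p \<le> 1 + norm p"
  unfolding wt_def using sqrt_add_le_add_sqrt[of 1 "p \<bullet> p"] by (simp add: norm_eq_sqrt_inner)

lemma Sm_mult: "Sm p *v v = (1 / sqrt (wt p)) *\<^sub>R (v - ((p \<bullet> v) / (wt p * (wt p + 1))) *\<^sub>R p)"
  by (simp add: Sm_def matrix_vector_mult_scaleR_left matrix_vector_mult_diff_rdistrib outer_mult)
lemma Pm_mult: "Pm p *v v = wt p *\<^sub>R (v + (p \<bullet> v) *\<^sub>R p)"
  by (simp add: Pm_def matrix_vector_mult_scaleR_left matrix_vector_mult_add_rdistrib outer_mult)
lemma Rm_mult: "Rm p *v v = sqrt (wt p) *\<^sub>R (v + ((p \<bullet> v) / (wt p + 1)) *\<^sub>R p)"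
  by (simp add: Rm_def matrix_vector_mult_scaleR_left matrix_vector_mult_add_rdistrib outer_mult)

lemma Sm_Sym [simp]: "Sm p \<in> Sym"
  by (rule SymI) (simp add: Sm_mult inner_diff_left inner_diff_right inner_commute)
lemma Pm_Sym [simp]: "Pm p \<in> Sym"
  by (rule SymI) (simp add: Pm_mult inner_add_left inner_add_right inner_commute)
lemma Rm_Sym [simp]: "Rm p \<in> Sym"
  by (rule SymI) (simp add: Rm_mult inner_add_left inner_add_right inner_commute)

text \<open>With w = \<open>wt p\<close>, on the complement of \<open>p\<close> the two matrices act
  as 1/sqrt(w) and sqrt(w); on \<open>p\<close> itself they act as 1/(w sqrt(w)) and w sqrt(w),
  because |p|^2 = (w - 1)(w + 1).\<close>

lemma Sm_Rm: "Sm p *v (Rm p *v v) = v"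
proof -
  let ?w = "wt p"
  have w: "?w > 0" "?w + 1 \<noteq> 0" using wt_pos[of p] by auto
  let ?u = "v + ((p \<bullet> v) / (?w + 1)) *\<^sub>R p"
  have "p \<bullet> ?u = (p \<bullet> v) * ?w"
    using w by (simp add: inner_add_right wt_sq) (simp add: field_simps)
  then have "?u - ((p \<bullet> ?u) / (?w * (?w + 1))) *\<^sub>R p = v" using w by simp
  moreover have "Sm p *v (Rm p *v v) = Sm p *v (sqrt ?w *\<^sub>R ?u)" by (simp only: Rm_mult)
  moreover have "\<dots> = ?u - ((p \<bullet> ?u) / (?w * (?w + 1))) *\<^sub>R p"
    using w by (simp only: matrix_vector_mult_scaleR Sm_mult) simp
  ultimately show ?thesis by simp
qed

lemma Rm_Sm: "Rm p *v (Sm p *v v) = v"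
proof -
  have "Sm p ** Rm p = mat 1" using Sm_Rm[of p] by (simp add: matrix_eq matrix_vector_mul_assoc)
  then have "Rm p ** Sm p = mat 1" using matrix_left_right_inverse by blast
  then show ?thesis by (simp add: matrix_vector_mul_assoc)
qed

lemma Pm_Sm: "Pm p *v (Sm p *v v) = Rm p *v v"
proof -
  let ?w = "wt p"
  have w: "?w > 0" "?w + 1 > 0" using wt_pos[of p] by auto
  let ?k = "(p \<bullet> v) / (?w * (?w + 1))"
  have "p \<bullet> (v - ?k *\<^sub>R p) = (p \<bullet> v) / ?w"
  proof -
    have "?k * (p \<bullet> p) = (p \<bullet> v) * ((?w - 1) / ?w)" using w by (simp add: wt_sq)
    then have "p \<bullet> (v - ?k *\<^sub>R p) = (p \<bullet> v) - (p \<bullet> v) * ((?w - 1) / ?w)"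
      by (simp only: inner_diff_right inner_scaleR_right)
    then show ?thesis using w by (simp add: field_simps)
  qed
  then have "Pm p *v (v - ?k *\<^sub>R p) = ?w *\<^sub>R (v + ((p \<bullet> v) / ?w - ?k) *\<^sub>R p)"
    by (simp only: Pm_mult) (simp add: scaleR_left_diff_distrib)
  also have "(p \<bullet> v) / ?w - ?k = (p \<bullet> v) / (?w + 1)"
  proof -
    have "?w \<noteq> 0" "?w + 1 \<noteq> 0" using w by auto
    then show ?thesis by (simp add: divide_simps) (simp add: algebra_simps)?
  qed
  finally have "Pm p *v (Sm p *v v) = (1 / sqrt ?w) *\<^sub>R ?w *\<^sub>R (v + ((p \<bullet> v) / (?w + 1)) *\<^sub>R p)"
    by (simp only: Sm_mult matrix_vector_mult_scaleR)
  also have "\<dots> = Rm p *v v"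
    using w real_div_sqrt[of ?w] by (simp add: Rm_mult)
  finally show ?thesis .
qed

lemma norm_Sm_le: "norm (Sm p *v v) \<le> norm v"
proof -
  let ?w = "wt p"
  have w: "?w > 0" "?w \<ge> 1" using wt_pos wt_ge1 by auto
  define k where "k = 1 / (?w * (?w + 1))"
  have k: "k \<ge> 0" using w by (simp add: k_def)
  have "k * (p \<bullet> p) = (?w - 1) / ?w" using w by (simp add: k_def wt_sq)
  then have kp: "k * (p \<bullet> p) \<le> 1" using w by (simp add: divide_le_eq)
  have "(norm (v - (k * (p \<bullet> v)) *\<^sub>R p))\<^sup>2 = (norm v)\<^sup>2 - k * (p \<bullet> v)\<^sup>2 * (2 - k * (p \<bullet> p))"
    unfolding power2_norm_eq_inner
    by (simp add: inner_diff_left inner_diff_right inner_commute power2_eq_square algebra_simps)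
  also have "\<dots> \<le> (norm v)\<^sup>2" using k kp by simp
  finally have *: "norm (v - (k * (p \<bullet> v)) *\<^sub>R p) \<le> norm v" by (simp add: power2_le_iff_abs_le)
  have "Sm p *v v = (1 / sqrt ?w) *\<^sub>R (v - (k * (p \<bullet> v)) *\<^sub>R p)" by (simp add: Sm_mult k_def)
  then have "norm (Sm p *v v) = (1 / sqrt ?w) * norm (v - (k * (p \<bullet> v)) *\<^sub>R p)" using w by simp
  also have "\<dots> \<le> 1 * norm v" using * w by (intro mult_mono) auto
  finally show ?thesis by simp
qed

text \<open>The power 3 is a convenient upper bound for the exponent 3/2 with which
  \<open>Rm p\<close> stretches \<open>p\<close>; since \<open>wt p \<ge> 1\<close>, later constants
  become integer powers of a bound for \<open>wt p\<close>.\<close>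

lemma norm_Rm_le: "norm (Rm p *v v) \<le> (wt p)^3 * norm v"
proof -
  let ?w = "wt p"
  have w: "?w > 0" "?w \<ge> 1" using wt_pos wt_ge1 by auto
  have "norm (((p \<bullet> v) / (?w + 1)) *\<^sub>R p) = \<bar>p \<bullet> v\<bar> * norm p / (?w + 1)" using w by simp
  also have "\<dots> \<le> (norm p * norm v) * norm p / (?w + 1)"
    using w Cauchy_Schwarz_ineq2[of p v] by (intro divide_right_mono mult_right_mono) auto
  also have "\<dots> = (p \<bullet> p) * norm v / (?w + 1)" by (simp add: dot_square_norm power2_eq_square)
  also have "\<dots> = (?w - 1) * norm v" using w by (simp add: wt_sq)
  finally have "norm (v + ((p \<bullet> v) / (?w + 1)) *\<^sub>R p) \<le> norm v + (?w - 1) * norm v"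
    using norm_triangle_ineq order_trans by (metis add_left_mono)
  also have "\<dots> = ?w * norm v" by (simp add: algebra_simps)
  finally have 1: "norm (v + ((p \<bullet> v) / (?w + 1)) *\<^sub>R p) \<le> ?w * norm v" .
  have "norm (Rm p *v v) = sqrt ?w * norm (v + ((p \<bullet> v) / (?w + 1)) *\<^sub>R p)"
    using w by (simp add: Rm_mult)
  also have "\<dots> \<le> ?w * (?w * norm v)"
    using 1 w sqrt_le_D[of "sqrt ?w" "?w"]
    by (intro mult_mono) (auto simp: real_le_lsqrt power2_eq_square)
  also have "\<dots> \<le> ?w^3 * norm v"
    using w by (simp add: power3_eq_cube mult.assoc[symmetric] mult_le_cancel_right1 mult_right_mono)
  finally show ?thesis .
qed

lemma norm_Sm_ge: "norm v \<le> (wt p)^3 * norm (Sm p *v v)"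
  using norm_Rm_le[of p "Sm p *v v"] by (simp add: Rm_Sm)

definition AS :: "real^'n \<Rightarrow> real^'n^'n \<Rightarrow> real^'n^'n" where "AS p X = Sm p ** X ** Sm p"

lemma AS_mult: "AS p X *v v = Sm p *v (X *v (Sm p *v v))"
  by (simp add: AS_def matrix_vector_mul_assoc matrix_mul_assoc)

lemma AS_Sym: "X \<in> Sym \<Longrightarrow> AS p X \<in> Sym"
  by (rule SymI) (simp add: AS_mult Sym_inner)

text \<open>The homotopy parameter enters the operator only through the product t p, so this
  function at \<open>t *\<^sub>R p\<close> carries the whole homotopy, and estimates for bounded
  \<open>p\<close> are uniform in t.\<close>

definition \<Phi> :: "real^'n \<Rightarrow> real^'n^'n \<Rightarrow> real" where "\<Phi> p X = Fs (AS p X)"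

lemma bounded_bilinear_matrix_mult: "bounded_bilinear ((**) :: real^'n^'n \<Rightarrow> real^'n^'n \<Rightarrow> real^'n^'n)"
proof -
  have "bilinear ((**) :: real^'n^'n \<Rightarrow> real^'n^'n \<Rightarrow> real^'n^'n)"
    unfolding bilinear_def
    by (auto intro!: linearI simp: matrix_eq matrix_vector_mult_add_rdistrib matrix_vector_right_distrib
        matrix_vector_mult_scaleR_left matrix_vector_mult_scaleR simp flip: matrix_vector_mul_assoc)
  then show ?thesis by (simp add: bilinear_conv_bounded_bilinear)
qed

lemma bounded_bilinear_matrix_vector_mult:
  "bounded_bilinear ((*v) :: real^'n^'n \<Rightarrow> real^'n \<Rightarrow> real^'n)"
proof -
  have "bilinear ((*v) :: real^'n^'n \<Rightarrow> real^'n \<Rightarrow> real^'n)"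
    unfolding bilinear_def
    by (auto intro!: linearI simp: matrix_vector_mult_add_rdistrib matrix_vector_right_distrib
        matrix_vector_mult_scaleR_left matrix_vector_mult_scaleR)
  then show ?thesis by (simp add: bilinear_conv_bounded_bilinear)
qed

lemma bounded_bilinear_outer: "bounded_bilinear (outer :: real^'n \<Rightarrow> real^'n \<Rightarrow> real^'n^'n)"
proof -
  have "bilinear (outer :: real^'n \<Rightarrow> real^'n \<Rightarrow> real^'n^'n)"
    unfolding bilinear_def
    by (auto intro!: linearI simp: outer_def vec_eq_iff algebra_simps)
  then show ?thesis by (simp add: bilinear_conv_bounded_bilinear)
qed

lemma has_derivative_wt: "(wt has_derivative (\<lambda>q. (p \<bullet> q) / wt p)) (at p)"
proof -
  have pos: "1 + p \<bullet> p > 0" by (simp add: add_pos_nonneg)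
  show ?thesis
    unfolding wt_def[abs_def] using pos
    by (auto intro!: derivative_eq_intros simp: inner_commute field_simps)
qed

text \<open>Existence and symmetry of the derivative suffice: symmetry moves it across inner
  products, and the one quadratic form in which it then occurs is evaluated through the derivative
  of \<open>Pm\<close>.\<close>

lemma Sm_differentiable:
  "\<exists>S'. (Sm has_derivative S') (at p) \<and> (\<forall>q. S' q \<in> Sym)"
proof -
  have w: "wt p > 0" "wt p \<noteq> 0" "wt p + 1 \<noteq> 0" using wt_pos[of p] by auto
  have "\<exists>c1'. ((\<lambda>p. 1 / sqrt (wt p)) has_derivative c1') (at p)"
    using w by (intro exI) (rule derivative_eq_intros has_derivative_wt refl | simp)+
  then obtain c1' where c1: "((\<lambda>p. 1 / sqrt (wt p)) has_derivative c1') (at p)" by blast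
  have "\<exists>c2'. ((\<lambda>p. 1 / (wt p * (wt p + 1))) has_derivative c2') (at p)"
    using w by (intro exI) (rule derivative_eq_intros has_derivative_wt refl | simp)+
  then obtain c2' where c2: "((\<lambda>p. 1 / (wt p * (wt p + 1))) has_derivative c2') (at p)" by blast
  have o: "((\<lambda>p. outer p p) has_derivative (\<lambda>q. outer p q + outer q p)) (at p)"
    by (rule bounded_bilinear.FDERIV[OF bounded_bilinear_outer has_derivative_ident has_derivative_ident])
  let ?m = "\<lambda>q. (1 / (wt p * (wt p + 1))) *\<^sub>R (outer p q + outer q p) + c2' q *\<^sub>R outer p p"
  have m: "((\<lambda>p. mat 1 - (1 / (wt p * (wt p + 1))) *\<^sub>R outer p p) has_derivative (\<lambda>q. - ?m q)) (at p)"
    using has_derivative_diff[OF has_derivative_const has_derivative_scaleR[OF c2 o], of "mat 1"]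
    by simp
  let ?D = "\<lambda>q. (1 / sqrt (wt p)) *\<^sub>R (- ?m q) +
      c1' q *\<^sub>R (mat 1 - (1 / (wt p * (wt p + 1))) *\<^sub>R outer p p)"
  have "(Sm has_derivative ?D) (at p)"
    unfolding Sm_def[abs_def] by (rule has_derivative_scaleR[OF c1 m])
  moreover have "?D q \<in> Sym" for q
    by (rule SymI)
      (simp add: matrix_vector_mult_add_rdistrib matrix_vector_mult_scaleR_left outer_mult
        matrix_vector_mult_diff_rdistrib inner_add_left inner_add_right inner_diff_left inner_diff_right
        inner_commute algebra_simps)
  ultimately show ?thesis by blast
qed

text \<open>The gradient in p, with y fixed, of the quadratic form y . \<open>Pm p\<close> y = w
  (|y|^2 + (p . y)^2), where w = \<open>wt p\<close>.\<close>

definition dP :: "real^'n \<Rightarrow> real^'n \<Rightarrow> real^'n" where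
  "dP p y = ((y \<bullet> y + (p \<bullet> y)\<^sup>2) / wt p) *\<^sub>R p + (2 * wt p * (p \<bullet> y)) *\<^sub>R y"

lemma has_derivative_Pm_form:
  "((\<lambda>p. (Pm p *v y) \<bullet> y) has_derivative (\<lambda>q. dP p y \<bullet> q)) (at p)"
proof -
  have eq: "(\<lambda>p. (Pm p *v y) \<bullet> y) = (\<lambda>p. wt p * (y \<bullet> y + (p \<bullet> y)\<^sup>2))"
    by (auto simp: Pm_mult inner_add_left power2_eq_square)
  show ?thesis unfolding eq
    by (rule derivative_eq_intros has_derivative_wt refl | simp)+
      (auto simp: dP_def fun_eq_iff inner_add_left inner_commute algebra_simps)
qed

lemma Pm_differentiable: "\<exists>P'. (Pm has_derivative P') (at p)"
proof -
  have o: "((\<lambda>p. outer p p) has_derivative (\<lambda>q. outer p q + outer q p)) (at p)"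
    by (rule bounded_bilinear.FDERIV[OF bounded_bilinear_outer has_derivative_ident has_derivative_ident])
  show ?thesis unfolding Pm_def[abs_def]
    by (rule exI) (rule has_derivative_scaleR[OF has_derivative_wt has_derivative_add[OF has_derivative_const o]])
qed

text \<open>Differentiating \<open>Sm Pm Sm = 1\<close> trades the derivative of the square root for the one of \<open>Pm\<close>.\<close>
lemma dSm_eq_dP:
  assumes S: "(Sm has_derivative S') (at p)"
  shows "2 * ((Rm p *v b) \<bullet> (S' q *v b)) = - (dP p (Sm p *v b) \<bullet> q)"
proof -
  obtain P' where P: "(Pm has_derivative P') (at p)" using Pm_differentiable by blast
  note mv = bounded_bilinear.FDERIV[OF bounded_bilinear_matrix_vector_mult]
  have Sb: "((\<lambda>p. Sm p *v b) has_derivative (\<lambda>q. S' q *v b)) (at p)"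
    using mv[OF S has_derivative_const[of b]] by simp
  have PSb: "((\<lambda>p. Pm p *v (Sm p *v b)) has_derivative
      (\<lambda>q. Pm p *v (S' q *v b) + P' q *v (Sm p *v b))) (at p)"
    by (rule mv[OF P Sb])
  have "((\<lambda>p. (Pm p *v (Sm p *v b)) \<bullet> (Sm p *v b)) has_derivative
      (\<lambda>q. (Pm p *v (Sm p *v b)) \<bullet> (S' q *v b) +
        (Pm p *v (S' q *v b) + P' q *v (Sm p *v b)) \<bullet> (Sm p *v b))) (at p)"
    by (rule has_derivative_inner[OF PSb Sb])
  moreover have "(\<lambda>p. (Pm p *v (Sm p *v b)) \<bullet> (Sm p *v b)) = (\<lambda>p. b \<bullet> b)"
    by (simp add: Pm_Sm Sym_inner[OF Rm_Sym] Rm_Sm)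
  ultimately have D: "((\<lambda>p. b \<bullet> b) has_derivative
      (\<lambda>q. (Pm p *v (Sm p *v b)) \<bullet> (S' q *v b) +
        (Pm p *v (S' q *v b) + P' q *v (Sm p *v b)) \<bullet> (Sm p *v b))) (at p)"
    by (simp only:)
  have 0: "(Pm p *v (Sm p *v b)) \<bullet> (S' q *v b) +
        (Pm p *v (S' q *v b) + P' q *v (Sm p *v b)) \<bullet> (Sm p *v b) = 0"
    using fun_cong[OF has_derivative_unique[OF D has_derivative_const], of q] by (simp only:)
  have d2: "((\<lambda>p. (Pm p *v y) \<bullet> y) has_derivative (\<lambda>q. (P' q *v y) \<bullet> y)) (at p)" for y
    using has_derivative_inner[OF mv[OF P has_derivative_const[of y]] has_derivative_const[of y]] by simp
  have "(P' q *v y) \<bullet> y = dP p y \<bullet> q" for y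
    using fun_cong[OF has_derivative_unique[OF d2 has_derivative_Pm_form], of q] by (simp only:)
  moreover have "(Pm p *v (S' q *v b)) \<bullet> (Sm p *v b) = (Rm p *v b) \<bullet> (S' q *v b)"
    unfolding Sym_inner[OF Pm_Sym] Pm_Sm by (rule inner_commute)
  ultimately show ?thesis using 0 by (simp add: Pm_Sm inner_add_left)
qed

section \<open>Coefficients of the linearized operator in an eigenbasis\<close>

definition cf :: "real^'n \<Rightarrow> real^'n^'n \<Rightarrow> real^'n \<Rightarrow> real" where
  "cf p X b = 1 / (1 + (eigv (AS p X) b)\<^sup>2)"

text \<open>The matrix S (I + A^2)^{-1} S with S = \<open>Sm p\<close> and A =
  \<open>AS p X\<close>.\<close>

definition amat :: "real^'n \<Rightarrow> real^'n^'n \<Rightarrow> real^'n^'n" where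
  "amat p X = (\<Sum>b\<in>eigb (AS p X). cf p X b *\<^sub>R outer (Sm p *v b) (Sm p *v b))"

text \<open>The gradient of \<open>\<Phi>\<close> in its first variable. The weight \<lambda>/(1 +
  \<lambda>^2) keeps it bounded however large \<open>X\<close> is.\<close>

definition bvec :: "real^'n \<Rightarrow> real^'n^'n \<Rightarrow> real^'n" where
  "bvec p X = (\<Sum>b\<in>eigb (AS p X). - (cf p X b * eigv (AS p X) b) *\<^sub>R dP p (Sm p *v b))"

lemma mat_inner_amat:
  "mat_inner (amat p X) Y = (\<Sum>b\<in>eigb (AS p X). cf p X b * ((Y *v (Sm p *v b)) \<bullet> (Sm p *v b)))"
  unfolding amat_def
  by (simp add: linear_sum[OF mat_inner_linear_left] linear_scale[OF mat_inner_linear_left]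
      mat_inner_outer inner_commute)

lemma amat_form:
  "\<xi> \<bullet> (amat p X *v \<eta>) = (\<Sum>b\<in>eigb (AS p X). cf p X b * (\<xi> \<bullet> (Sm p *v b)) * (\<eta> \<bullet> (Sm p *v b)))"
  unfolding amat_def
  by (simp add: matrix_sum_vec matrix_vector_mult_scaleR_left outer_mult inner_sum_right inner_commute mult_ac)

lemma amat_Sym: "amat p X \<in> Sym"
  by (rule SymI) (subst inner_commute, simp add: amat_form mult_ac)

text \<open>The chain rule for S X S. In direction (q, Y) and on an eigenvector b, both terms that
  differentiate S equal X S b . S' b, and X S b is the eigenvalue times \<open>Rm p\<close> b; this
  is exactly the combination that \<open>dSm_eq_dP\<close> evaluates.\<close>

lemma \<Phi>_has_derivative:
  fixes X :: "real^'n^'n"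
  assumes X: "X \<in> Sym"
  shows "((\<lambda>z. \<Phi> (fst z) (snd z)) has_derivative
           (\<lambda>z. bvec p X \<bullet> fst z + mat_inner (amat p X) (snd z))) (at (p, X))"
proof -
  obtain S' where S': "(Sm has_derivative S') (at p)" and S'S: "\<And>q. S' q \<in> Sym"
    using Sm_differentiable by blast
  note mm = bounded_bilinear.FDERIV[OF bounded_bilinear_matrix_mult]
  have fS: "((\<lambda>z. Sm (fst z)) has_derivative (\<lambda>z. S' (fst z))) (at (p, X))"
    by (rule has_derivative_compose[OF has_derivative_fst[OF has_derivative_ident]]) (simp add: S')
  have sX: "((\<lambda>z. snd z) has_derivative (\<lambda>z. snd z)) (at (p, X))"
    by (rule has_derivative_snd[OF has_derivative_ident])
  let ?A = "AS p X"
  let ?D = "\<lambda>z. (Sm p ** X) ** S' (fst z) + (Sm p ** snd z + S' (fst z) ** X) ** Sm p"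
  have A: "((\<lambda>z. AS (fst z) (snd z)) has_derivative ?D) (at (p, X))"
    unfolding AS_def using mm[OF mm[OF fS sX] fS] by simp
  have sA: "symm ?A = ?A" by (rule symm_id[OF AS_Sym[OF X]])
  have main: "((\<lambda>z. \<Phi> (fst z) (snd z)) has_derivative (\<lambda>z. dF ?A (?D z))) (at (p, X))"
    unfolding \<Phi>_def
    by (rule has_derivative_compose[OF A, of Fs]) (use Fs_has_derivative[of ?A] in \<open>simp add: sA\<close>)
  have "dF ?A (?D (q, Y)) = bvec p X \<bullet> q + mat_inner (amat p X) Y" for q Y
  proof -
    have t: "(?D (q, Y) *v b) \<bullet> b / (1 + (eigv ?A b)\<^sup>2) =
        (- (cf p X b * eigv ?A b) *\<^sub>R dP p (Sm p *v b)) \<bullet> q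
          + cf p X b * ((Y *v (Sm p *v b)) \<bullet> (Sm p *v b))" if "b \<in> eigb ?A" for b
    proof -
      have eb: "Sm p *v (X *v (Sm p *v b)) = eigv ?A b *\<^sub>R b"
        using eigb(2)[OF AS_Sym[OF X] that] by (simp add: AS_mult)
      have "X *v (Sm p *v b) = Rm p *v (Sm p *v (X *v (Sm p *v b)))" by (simp only: Rm_Sm)
      \<comment> \<open>\<open>Rm p\<close> undoes \<open>Sm p\<close>, which converts the
        eigenvalue equation of S X S into a formula for X S b.\<close>
      then have XS: "X *v (Sm p *v b) = eigv ?A b *\<^sub>R (Rm p *v b)"
        by (simp add: eb matrix_vector_mult_scaleR)
      have "(?D (q, Y) *v b) \<bullet> b = 2 * ((X *v (Sm p *v b)) \<bullet> (S' q *v b)) + (Y *v (Sm p *v b)) \<bullet> (Sm p *v b)"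
      proof -
        have "(Sm p *v (X *v (S' q *v b))) \<bullet> b = (X *v (Sm p *v b)) \<bullet> (S' q *v b)"
          by (metis Sym_inner Sm_Sym X inner_commute)
        moreover have "(S' q *v (X *v (Sm p *v b))) \<bullet> b = (X *v (Sm p *v b)) \<bullet> (S' q *v b)"
          by (rule Sym_inner[OF S'S])
        moreover have "(Sm p *v (Y *v (Sm p *v b))) \<bullet> b = (Y *v (Sm p *v b)) \<bullet> (Sm p *v b)"
          by (rule Sym_inner[OF Sm_Sym])
        ultimately show ?thesis
          by (simp add: matrix_vector_mult_add_rdistrib matrix_vector_mul_assoc[symmetric] inner_add_left)
      qed
      also have "\<dots> = - (eigv ?A b * (dP p (Sm p *v b) \<bullet> q)) + (Y *v (Sm p *v b)) \<bullet> (Sm p *v b)"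
        using dSm_eq_dP[OF S', of b q] by (simp add: XS) (metis mult.left_commute mult_minus_right)
      finally show ?thesis by (simp add: cf_def add_divide_distrib diff_divide_distrib)
    qed
    show ?thesis
      unfolding dF_def mat_inner_amat bvec_def inner_sum_left sum.distrib[symmetric]
      by (rule sum.cong[OF refl]) (rule t)
  qed
  then have "(\<lambda>z. dF ?A (?D z)) = (\<lambda>z. bvec p X \<bullet> fst z + mat_inner (amat p X) (snd z))"
    by (simp add: fun_eq_iff split_paired_all)
  with main show ?thesis by (simp only:)
qed

section \<open>The homotopy operator and its derivatives in closed form\<close>

lemma inv_sqrt_on_eqI:
  fixes f g :: "real^'n \<Rightarrow> real^'n"
  assumes "subspace T" "f ` T = T"
    and "linear g" "g ` T \<subseteq> T" "\<And>v. (\<forall>w\<in>T. v \<bullet> w = 0) \<Longrightarrow> g v = 0"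
        "\<And>v w. v\<in>T \<Longrightarrow> w\<in>T \<Longrightarrow> g v \<bullet> w = v \<bullet> g w" "\<And>v. v\<in>T \<Longrightarrow> v \<noteq> 0 \<Longrightarrow> 0 < g v \<bullet> v"
        "\<And>v. v\<in>T \<Longrightarrow> g (g (f v)) = v"
  shows "inv_sqrt_on T f = g"
  unfolding inv_sqrt_on_def
proof (rule the_equality)
  show "linear g \<and> g ` T \<subseteq> T \<and> (\<forall>v. (\<forall>w\<in>T. v \<bullet> w = 0) \<longrightarrow> g v = 0) \<and>
      (\<forall>v\<in>T. \<forall>w\<in>T. g v \<bullet> w = v \<bullet> g w) \<and> (\<forall>v\<in>T. v \<noteq> 0 \<longrightarrow> 0 < g v \<bullet> v) \<and> (\<forall>v\<in>T. g (g (f v)) = v)"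
    using assms(3-) by blast
  show "h = g" if h: "linear h \<and> h ` T \<subseteq> T \<and> (\<forall>v. (\<forall>w\<in>T. v \<bullet> w = 0) \<longrightarrow> h v = 0) \<and>
      (\<forall>v\<in>T. \<forall>w\<in>T. h v \<bullet> w = v \<bullet> h w) \<and> (\<forall>v\<in>T. v \<noteq> 0 \<longrightarrow> 0 < h v \<bullet> v) \<and> (\<forall>v\<in>T. h (h (f v)) = v)"
    for h
  proof (rule inv_sqrt_on_unique[OF assms(1,2)])
    show "linear h" "h ` T \<subseteq> T" using h by blast+
    show "h v = 0" if "\<forall>w\<in>T. v \<bullet> w = 0" for v using h that by blast
    show "h v \<bullet> w = v \<bullet> h w" if "v \<in> T" "w \<in> T" for v w using h that by blast
    show "0 < h v \<bullet> v" if "v \<in> T" "v \<noteq> 0" for v using h that by blast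
    show "h (h (f v)) = v" if "v \<in> T" for v using h that by blast
  qed (fact assms(3-))+
qed

lemma Sm_Sm_Pm: "Sm p *v (Sm p *v (Pm p *v v)) = v"
proof -
  have "Pm p ** (Sm p ** Sm p) = mat 1"
    by (simp add: matrix_eq Pm_Sm Rm_Sm flip: matrix_vector_mul_assoc)
  then have "(Sm p ** Sm p) ** Pm p = mat 1" using matrix_left_right_inverse by blast
  then show ?thesis by (simp add: matrix_vector_mul_assoc matrix_mul_assoc)
qed

lemma Pm_Sm_Sm: "Pm p *v (Sm p *v (Sm p *v v)) = v"
  by (simp add: Pm_Sm Rm_Sm)

lemma Sm_pos: "v \<noteq> 0 \<Longrightarrow> 0 < (Sm p *v v) \<bullet> v"
proof -
  assume v: "v \<noteq> 0"
  let ?w = "wt p"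
  have w: "?w > 0" using wt_pos by auto
  have "(p \<bullet> v)\<^sup>2 \<le> (p \<bullet> p) * (v \<bullet> v)" by (rule Cauchy_Schwarz_ineq)
  also have "\<dots> < ?w * (?w + 1) * (v \<bullet> v)"
  proof (rule mult_strict_right_mono)
    show "p \<bullet> p < ?w * (?w + 1)" using w by (simp add: wt_sq algebra_simps)
    show "0 < v \<bullet> v" using v by (simp only: inner_gt_zero_iff not_False_eq_True)
  qed
  finally have "(p \<bullet> v)\<^sup>2 / (?w * (?w + 1)) < v \<bullet> v"
    using w by (simp add: divide_less_eq mult.commute)
  then show ?thesis using w by (simp add: Sm_mult inner_diff_left power2_eq_square)
qed

lemma w_fun_eq: "w_fun t p = wt (t *\<^sub>R p)"
  by (simp only: w_fun_def wt_def power2_norm_eq_inner) (simp add: power2_eq_square mult.assoc)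

text \<open>\<open>Sm\<close> inverts the square root of \<open>Pm\<close>, which contains the
  additional factor \<open>wt\<close>; multiplying by the square root of \<open>wt\<close> removes
  it. The scalar 1/w in A_t(p,X) is thereby shared between the two outer factors.\<close>

lemma B_mat_eq: "B_mat t p = sqrt (wt (t *\<^sub>R p)) *\<^sub>R Sm (t *\<^sub>R p)"
proof -
  let ?p = "t *\<^sub>R p" and ?f = "\<lambda>v. (mat 1 + t\<^sup>2 *\<^sub>R outer p p) *v v"
  let ?s = "sqrt (wt ?p)"
  let ?g = "\<lambda>v. (?s *\<^sub>R Sm ?p) *v v"
  have w: "wt ?p > 0" using wt_pos by auto
  have s: "?s > 0" "?s * ?s = wt ?p" using w by auto
  have f: "wt ?p *\<^sub>R ?f v = Pm ?p *v v" for v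
    by (simp add: Pm_mult matrix_vector_mult_add_rdistrib matrix_vector_mult_scaleR_left outer_mult power2_eq_square)
  have ggf: "?g (?g (?f v)) = v" for v
  proof -
    have "?g (?g (?f v)) = Sm ?p *v (Sm ?p *v (wt ?p *\<^sub>R ?f v))"
      by (simp only: matrix_vector_mult_scaleR_left matrix_vector_mult_scaleR scaleR_scaleR s(2))
    then show ?thesis by (simp only: f Sm_Sm_Pm)
  qed
  have fgg: "?f (?g (?g v)) = v" for v
  proof -
    have "?f (?g (?g v)) = wt ?p *\<^sub>R ?f (Sm ?p *v (Sm ?p *v v))"
      by (simp only: matrix_vector_mult_scaleR_left matrix_vector_mult_scaleR scaleR_scaleR s(2))
    then show ?thesis by (simp only: f Pm_Sm_Sm)
  qed
  have "inv_sqrt_on UNIV ?f = ?g"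
  proof (rule inv_sqrt_on_eqI)
    show "range ?f = UNIV" using fgg by (rule surjI)
    show "?g v = 0" if "\<forall>w\<in>UNIV. v \<bullet> w = 0" for v
    proof -
      have "v = 0" using that[rule_format, of v] by simp
      then show ?thesis by simp
    qed
    show "?g v \<bullet> w = v \<bullet> ?g w" for v w
      using Sym_inner[OF Sm_Sym, of ?p v w] by (simp add: matrix_vector_mult_scaleR_left)
    show "0 < ?g v \<bullet> v" if "v \<noteq> 0" for v
      using Sm_pos[OF that, of ?p] w by (simp add: matrix_vector_mult_scaleR_left)
    show "?g (?g (?f v)) = v" for v by (rule ggf)
  qed auto
  then show ?thesis by (simp add: B_mat_def)
qed

lemma A_mat_eq: "A_mat t p X = AS (t *\<^sub>R p) X"
proof -
  have w: "wt (t *\<^sub>R p) > 0" using wt_pos by auto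
  have "A_mat t p X *v v = AS (t *\<^sub>R p) X *v v" for v
    using w by (simp add: A_mat_def B_mat_eq w_fun_eq AS_mult matrix_vector_mult_scaleR_left
        matrix_vector_mult_scaleR flip: matrix_vector_mul_assoc)
  then show ?thesis by (simp add: matrix_eq)
qed

lemma G_fun_eq: "X \<in> Sym \<Longrightarrow> G_fun t p X = \<Phi> (t *\<^sub>R p) X"
  by (simp add: G_fun_def A_mat_eq \<Phi>_def Fs_def symm_id AS_Sym)

lemma mat_inner_self:
  assumes "b \<in> Sym" shows "mat_inner b b = b \<bullet> b"
proof -
  have "b $ i $ k = b $ k $ i" for i k
    using assms by (simp add: Sym_def transpose_def vec_eq_iff)
  then show ?thesis by (simp add: mat_inner_def trace_def matrix_matrix_mult_def inner_vec_def)
qed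

text \<open>Stated for a curve or field of arguments and within an arbitrary set, so that one chain
  rule yields both partial derivatives, the differentiated equation, and continuity up to the
  boundary.\<close>

lemma G_fun_has_derivative:
  fixes g :: "'a::real_normed_vector \<Rightarrow> real^'n"
  assumes g: "(g has_derivative g') (at x within U)" and H: "(H has_derivative H') (at x within U)"
    and S: "\<And>y. y \<in> U \<Longrightarrow> H y \<in> Sym" and x: "x \<in> U"
  shows "((\<lambda>y. G_fun t (g y) (H y)) has_derivative
      (\<lambda>v. t * (bvec (t *\<^sub>R g x) (H x) \<bullet> g' v) + mat_inner (amat (t *\<^sub>R g x) (H x)) (H' v))) (at x within U)"
proof -
  have tg: "((\<lambda>y. (t *\<^sub>R g y, H y)) has_derivative (\<lambda>v. (t *\<^sub>R g' v, H' v))) (at x within U)"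
    by (intro has_derivative_Pair has_derivative_scaleR_right g H)
  have "((\<lambda>y. \<Phi> (fst (t *\<^sub>R g y, H y)) (snd (t *\<^sub>R g y, H y))) has_derivative
      (\<lambda>v. bvec (t *\<^sub>R g x) (H x) \<bullet> fst (t *\<^sub>R g' v, H' v) +
        mat_inner (amat (t *\<^sub>R g x) (H x)) (snd (t *\<^sub>R g' v, H' v)))) (at x within U)"
    by (rule has_derivative_compose[OF tg \<Phi>_has_derivative[OF S[OF x]]])
  then have "((\<lambda>y. \<Phi> (t *\<^sub>R g y) (H y)) has_derivative
      (\<lambda>v. t * (bvec (t *\<^sub>R g x) (H x) \<bullet> g' v) + mat_inner (amat (t *\<^sub>R g x) (H x)) (H' v))) (at x within U)"
    by simp
  then show ?thesis
    by (rule has_derivative_transform[OF x, rotated]) (simp add: G_fun_eq S)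
qed

text \<open>For uniqueness, two candidates are compared in the direction of their difference. That
  direction is symmetric, so the line through \<open>X\<close> stays in \<open>Sym\<close>, and
  there the trace pairing of the difference with itself is its squared norm.\<close>

lemma G_X_eq:
  assumes X: "X \<in> Sym" shows "G_X t p X = amat (t *\<^sub>R p) X"
  unfolding G_X_def
proof (rule the_equality)
  let ?a = "amat (t *\<^sub>R p) X"
  have d: "(G_fun t p has_derivative mat_inner ?a) (at X within Sym)"
    using G_fun_has_derivative[OF has_derivative_const has_derivative_ident _ X, of t p] by simp
  then show "?a \<in> Sym \<and> (G_fun t p has_derivative (\<lambda>Y. mat_inner ?a Y)) (at X within Sym)"
    by (simp add: amat_Sym)
  show "a = ?a" if a: "a \<in> Sym \<and> (G_fun t p has_derivative (\<lambda>Y. mat_inner a Y)) (at X within Sym)" for a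
  proof -
    let ?Y = "a - ?a"
    have Y: "?Y \<in> Sym" using a amat_Sym subspace_Sym subspace_diff by blast
    have c: "((\<lambda>s. X + s *\<^sub>R ?Y) has_derivative (\<lambda>s. s *\<^sub>R ?Y)) (at (0::real))"
      by (auto intro!: derivative_eq_intros)
    have r: "range (\<lambda>s. X + s *\<^sub>R ?Y) \<subseteq> Sym"
      using X Y subspace_Sym by (auto intro!: subspace_add subspace_scale)
    have e: "((\<lambda>s. G_fun t p (X + s *\<^sub>R ?Y)) has_derivative (\<lambda>s. mat_inner b (s *\<^sub>R ?Y))) (at 0)"
      if b: "(G_fun t p has_derivative (\<lambda>Y. mat_inner b Y)) (at X within Sym)" for b
      by (rule has_derivative_in_compose[OF c])
        (use has_derivative_subset[OF b r] in simp)
    have "(\<lambda>s. mat_inner a (s *\<^sub>R ?Y)) = (\<lambda>s. mat_inner ?a (s *\<^sub>R ?Y))"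
      by (rule has_derivative_unique[OF e e]) (use a d in auto)
    from fun_cong[OF this, of 1] have "mat_inner a ?Y - mat_inner ?a ?Y = 0" by (simp only: scaleR_one)
    moreover have "mat_inner ?Y ?Y = mat_inner a ?Y - mat_inner ?a ?Y"
      by (rule linear_diff[OF mat_inner_linear_left])
    ultimately have "mat_inner ?Y ?Y = 0" by simp
    then show ?thesis using mat_inner_self[OF Y] by simp
  qed
qed

lemma G_p_eq:
  assumes X: "X \<in> Sym" shows "G_p t p X = t *\<^sub>R bvec (t *\<^sub>R p) X"
  unfolding G_p_def grad_on_def
proof (rule the_equality)
  have l: "linear (mat_inner (amat (t *\<^sub>R p) X))" by (rule mat_inner_linear_right)
  show d: "((\<lambda>p'. G_fun t p' X) has_derivative (\<lambda>h. (t *\<^sub>R bvec (t *\<^sub>R p) X) \<bullet> h)) (at p)"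
    using G_fun_has_derivative[OF has_derivative_ident has_derivative_const, of UNIV X p t] X
    by (simp add: linear_0[OF l])
  show "g = t *\<^sub>R bvec (t *\<^sub>R p) X"
    if "((\<lambda>p'. G_fun t p' X) has_derivative (\<lambda>h. g \<bullet> h)) (at p)" for g
  proof -
    have "g \<bullet> h = (t *\<^sub>R bvec (t *\<^sub>R p) X) \<bullet> h" for h
      using fun_cong[OF has_derivative_unique[OF that d]] .
    then show ?thesis using vector_eq_rdot by blast
  qed
qed

section \<open>Size and coercivity of the linearized operator\<close>

lemma amat_nonneg: "0 \<le> \<xi> \<bullet> (amat p X *v \<xi>)"
  unfolding amat_form cf_def by (intro sum_nonneg) (auto simp: mult.assoc add_nonneg_nonneg)

text \<open>The bounds on a, aX and b that do not involve the size of \<open>X\<close> all reduce to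
  these two facts about 1/(1 + \<lambda>^2) and \<lambda>/(1 + \<lambda>^2).\<close>

lemma cf_bounds: "0 \<le> cf p X b" "cf p X b \<le> 1" "\<bar>cf p X b * eigv (AS p X) b\<bar> \<le> 1"
proof -
  let ?l = "eigv (AS p X) b"
  have p: "1 + ?l\<^sup>2 \<ge> 1" by simp
  show "0 \<le> cf p X b" "cf p X b \<le> 1" unfolding cf_def using order.strict_trans2[OF zero_less_one p] by (auto simp: divide_le_eq)
  have "\<bar>?l\<bar> \<le> 1 + ?l\<^sup>2"
    using sum_squares_bound[of 1 "\<bar>?l\<bar>"] zero_le_power2[of ?l] by (simp del: zero_le_power2)
  then show "\<bar>cf p X b * ?l\<bar> \<le> 1" unfolding cf_def using order.strict_trans2[OF zero_less_one p]
    by (simp add: abs_mult divide_le_eq)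
qed

lemma norm_Sm_eigb: "X \<in> Sym \<Longrightarrow> b \<in> eigb (AS p X) \<Longrightarrow> norm (Sm p *v b) \<le> 1"
  using norm_Sm_le[of p b] eigb(1)[OF AS_Sym[of X p]] by (auto simp: onb_def)

lemma X_Sm_eigb:
  assumes X: "X \<in> Sym" and b: "b \<in> eigb (AS p X)"
  shows "X *v (Sm p *v b) = eigv (AS p X) b *\<^sub>R (Rm p *v b)"
proof -
  have "X *v (Sm p *v b) = Rm p *v (Sm p *v (X *v (Sm p *v b)))" by (simp only: Rm_Sm)
  also have "Sm p *v (X *v (Sm p *v b)) = eigv (AS p X) b *\<^sub>R b"
    using eigb(2)[OF AS_Sym[OF X] b] by (simp add: AS_mult)
  finally show ?thesis by (simp add: matrix_vector_mult_scaleR)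
qed

lemma card_eigb: "X \<in> Sym \<Longrightarrow> real (card (eigb (AS p (X :: real^'n^'n)))) = CARD('n)"
  using onb_UNIV_card[OF eigb(1)[OF AS_Sym]] by simp

lemma abs_sum_card_le:
  assumes "\<And>b. b \<in> B \<Longrightarrow> \<bar>f b\<bar> \<le> (c::real)" shows "\<bar>sum f B\<bar> \<le> real (card B) * c"
proof -
  have "\<bar>sum f B\<bar> \<le> (\<Sum>b\<in>B. \<bar>f b\<bar>)" by (rule sum_abs)
  also have "\<dots> \<le> real (card B) * c" by (rule sum_bounded_above[OF assms])
  finally show ?thesis .
qed

lemma amat_form_bound:
  fixes X :: "real^'n^'n"
  assumes X: "X \<in> Sym" shows "\<bar>\<xi> \<bullet> (amat p X *v \<eta>)\<bar> \<le> CARD('n) * (norm \<xi> * norm \<eta>)"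
  unfolding amat_form card_eigb[OF X, of p, symmetric]
proof (rule abs_sum_card_le)
  fix b assume b: "b \<in> eigb (AS p X)"
  note n = norm_Sm_eigb[OF X b]
  have i: "\<bar>z \<bullet> (Sm p *v b)\<bar> \<le> norm z" for z
    using Cauchy_Schwarz_ineq2[of z "Sm p *v b"] mult_left_mono[OF n, of "norm z"] by simp
  have "\<bar>cf p X b\<bar> * \<bar>\<xi> \<bullet> (Sm p *v b)\<bar> * \<bar>\<eta> \<bullet> (Sm p *v b)\<bar> \<le> 1 * norm \<xi> * norm \<eta>"
    using cf_bounds[of p X b] i by (intro mult_mono) auto
  then show "\<bar>cf p X b * (\<xi> \<bullet> (Sm p *v b)) * (\<eta> \<bullet> (Sm p *v b))\<bar> \<le> norm \<xi> * norm \<eta>"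
    by (simp add: abs_mult)
qed

text \<open>Moving \<open>X\<close> onto the eigenvector side replaces S b by \<lambda> times
  \<open>Rm p\<close> b, so the weight becomes \<lambda>/(1 + \<lambda>^2). This controls products
  of the coefficient matrix with unbounded rows of the Hessian.\<close>

lemma amat_X_form_bound:
  fixes X :: "real^'n^'n"
  assumes X: "X \<in> Sym"
  shows "\<bar>\<xi> \<bullet> (amat p X *v (X *v \<eta>))\<bar> \<le> CARD('n) * ((wt p)^3 * (norm \<xi> * norm \<eta>))"
  unfolding amat_form card_eigb[OF X, of p, symmetric]
proof (rule abs_sum_card_le)
  fix b assume b: "b \<in> eigb (AS p X)"
  note n = norm_Sm_eigb[OF X b]
  have nb: "norm b = 1" using eigb(1)[OF AS_Sym[OF X]] b by (auto simp: onb_def)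
  have i: "\<bar>\<xi> \<bullet> (Sm p *v b)\<bar> \<le> norm \<xi>"
    using Cauchy_Schwarz_ineq2[of \<xi> "Sm p *v b"] mult_left_mono[OF n, of "norm \<xi>"] by simp
  have j: "\<bar>\<eta> \<bullet> (Rm p *v b)\<bar> \<le> norm \<eta> * (wt p)^3"
    using Cauchy_Schwarz_ineq2[of \<eta> "Rm p *v b"] mult_left_mono[OF norm_Rm_le[of p b], of "norm \<eta>"] nb by simp
  have "(X *v \<eta>) \<bullet> (Sm p *v b) = eigv (AS p X) b * (\<eta> \<bullet> (Rm p *v b))"
    by (simp add: Sym_inner[OF X] X_Sm_eigb[OF X b])
  then have "\<bar>cf p X b * (\<xi> \<bullet> (Sm p *v b)) * ((X *v \<eta>) \<bullet> (Sm p *v b))\<bar> =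
      \<bar>cf p X b * eigv (AS p X) b\<bar> * \<bar>\<xi> \<bullet> (Sm p *v b)\<bar> * \<bar>\<eta> \<bullet> (Rm p *v b)\<bar>"
    by (simp add: abs_mult)
  also have "\<dots> \<le> 1 * norm \<xi> * (norm \<eta> * (wt p)^3)"
    using cf_bounds[of p X b] i j by (intro mult_mono) auto
  finally show "\<bar>cf p X b * (\<xi> \<bullet> (Sm p *v b)) * ((X *v \<eta>) \<bullet> (Sm p *v b))\<bar>
      \<le> (wt p)^3 * (norm \<xi> * norm \<eta>)" by (simp add: mult_ac)
qed

lemma mat_inner_amat_bound:
  fixes X :: "real^'n^'n"
  assumes X: "X \<in> Sym" shows "\<bar>mat_inner (amat p X) Y\<bar> \<le> CARD('n) * norm Y"
  unfolding mat_inner_amat card_eigb[OF X, of p, symmetric]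
proof (rule abs_sum_card_le)
  fix b assume b: "b \<in> eigb (AS p X)"
  note n = norm_Sm_eigb[OF X b]
  have "\<bar>(Y *v (Sm p *v b)) \<bullet> (Sm p *v b)\<bar> \<le> norm (Y *v (Sm p *v b)) * norm (Sm p *v b)"
    by (rule Cauchy_Schwarz_ineq2)
  also have "\<dots> \<le> (norm Y * norm (Sm p *v b)) * norm (Sm p *v b)"
    by (intro mult_right_mono norm_matrix_vector_mult_le) auto
  also have "\<dots> \<le> norm Y * 1 * 1" using n by (intro mult_mono) auto
  finally have "\<bar>cf p X b\<bar> * \<bar>(Y *v (Sm p *v b)) \<bullet> (Sm p *v b)\<bar> \<le> 1 * norm Y"
    using cf_bounds[of p X b] by (intro mult_mono) auto
  then show "\<bar>cf p X b * ((Y *v (Sm p *v b)) \<bullet> (Sm p *v b))\<bar> \<le> norm Y"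
    by (simp add: abs_mult)
qed

lemma mat_inner_amat_nonneg: "psd Y \<Longrightarrow> 0 \<le> mat_inner (amat p X) Y"
  unfolding mat_inner_amat psd_def
  by (intro sum_nonneg mult_nonneg_nonneg cf_bounds) (simp add: inner_commute)

text \<open>The trace of aX is the sum of \<lambda>/(1 + \<lambda>^2) over the eigenvalues of
  \<open>AS p X\<close>, as \<open>Rm p\<close> and \<open>Sm p\<close> are inverse to each
  other.\<close>

lemma mat_inner_amat_X_bound:
  fixes X :: "real^'n^'n"
  assumes X: "X \<in> Sym" shows "\<bar>mat_inner (amat p X) X\<bar> \<le> CARD('n)"
proof -
  have "\<bar>mat_inner (amat p X) X\<bar> \<le> real (card (eigb (AS p X))) * 1"
    unfolding mat_inner_amat
  proof (rule abs_sum_card_le)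
    fix b assume b: "b \<in> eigb (AS p X)"
    have nb: "norm b = 1" using eigb(1)[OF AS_Sym[OF X]] b by (auto simp: onb_def)
    have "(Rm p *v b) \<bullet> (Sm p *v b) = b \<bullet> b"
      by (simp add: Sym_inner[OF Rm_Sym] Rm_Sm)
    then have "(X *v (Sm p *v b)) \<bullet> (Sm p *v b) = eigv (AS p X) b"
      using nb by (simp add: X_Sm_eigb[OF X b] norm_eq_1)
    then show "\<bar>cf p X b * ((X *v (Sm p *v b)) \<bullet> (Sm p *v b))\<bar> \<le> 1"
      using cf_bounds(3)[of p X b] by simp
  qed
  then show ?thesis by (simp add: card_eigb[OF X])
qed

lemma norm_dP_le:
  assumes "norm y \<le> 1" shows "norm (dP p y) \<le> 3 * (1 + norm p)^3"
proof -
  have w: "wt p \<ge> 1" "wt p > 0" "wt p \<le> 1 + norm p" using wt_ge1 wt_pos wt_le by auto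
  have py: "\<bar>p \<bullet> y\<bar> \<le> norm p"
    using Cauchy_Schwarz_ineq2[of p y] mult_left_mono[OF assms, of "norm p"] by simp
  have yy: "y \<bullet> y \<le> 1" using assms by (simp add: dot_square_norm power_le_one)
  have py2: "(p \<bullet> y)\<^sup>2 \<le> (norm p)\<^sup>2" using py by (metis abs_ge_zero power2_abs power_mono)
  have "norm (dP p y) \<le> ((y \<bullet> y + (p \<bullet> y)\<^sup>2) / wt p) * norm p + (2 * wt p * \<bar>p \<bullet> y\<bar>) * norm y"
    unfolding dP_def using w norm_triangle_ineq[of "((y \<bullet> y + (p \<bullet> y)\<^sup>2) / wt p) *\<^sub>R p" "(2 * wt p * (p \<bullet> y)) *\<^sub>R y"]
    by (simp add: abs_mult)
  also have "\<dots> \<le> (1 + (norm p)\<^sup>2) * norm p + (2 * (1 + norm p) * norm p) * 1"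
  proof (intro add_mono mult_mono)
    have "(y \<bullet> y + (p \<bullet> y)\<^sup>2) / wt p \<le> (y \<bullet> y + (p \<bullet> y)\<^sup>2) / 1"
      using w by (intro divide_left_mono) auto
    then show "(y \<bullet> y + (p \<bullet> y)\<^sup>2) / wt p \<le> 1 + (norm p)\<^sup>2" by (rule order.trans) (simp add: add_mono yy py2)
  qed (use w py assms in auto)
  also have "\<dots> \<le> 3 * (1 + norm p)^3"
    by (simp add: power3_eq_cube power2_eq_square algebra_simps)
  finally show ?thesis .
qed

lemma norm_bvec_le:
  fixes X :: "real^'n^'n"
  assumes X: "X \<in> Sym" shows "norm (bvec p X) \<le> CARD('n) * (3 * (1 + norm p)^3)"
proof -
  have "norm (bvec p X) \<le> (\<Sum>b\<in>eigb (AS p X). norm (- (cf p X b * eigv (AS p X) b) *\<^sub>R dP p (Sm p *v b)))"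
    unfolding bvec_def by (rule norm_sum)
  also have "\<dots> \<le> real (card (eigb (AS p X))) * (3 * (1 + norm p)^3)"
  proof (rule sum_bounded_above)
    fix b assume b: "b \<in> eigb (AS p X)"
    have "norm (- (cf p X b * eigv (AS p X) b) *\<^sub>R dP p (Sm p *v b)) =
        \<bar>cf p X b * eigv (AS p X) b\<bar> * norm (dP p (Sm p *v b))" by simp
    also have "\<dots> \<le> 1 * (3 * (1 + norm p)^3)"
      using cf_bounds[of p X b] norm_dP_le[OF norm_Sm_eigb[OF X b]] by (intro mult_mono) auto
    finally show "norm (- (cf p X b * eigv (AS p X) b) *\<^sub>R dP p (Sm p *v b)) \<le> 3 * (1 + norm p)^3" by simp
  qed
  finally show ?thesis by (simp add: card_eigb[OF X])
qed

lemma op_norm_mult_le: "norm (X *v v) \<le> op_norm X * norm v"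
  unfolding op_norm_def by (rule onorm) simp

lemma op_norm_nonneg: "0 \<le> op_norm X"
  unfolding op_norm_def by (rule onorm_pos_le) simp

text \<open>\<open>Sm p\<close> is a contraction, so the eigenvalues of \<open>AS p X\<close> are at
  most the operator norm of \<open>X\<close> and each weight is at least 1/(1 + |X|^2). Read
  backwards: if a(\<xi>,\<xi>) is small for a unit vector \<xi> and \<open>p\<close> is bounded,
  then |X| is large.\<close>

lemma amat_coercive:
  fixes X :: "real^'n^'n"
  assumes X: "X \<in> Sym"
  shows "(norm \<xi>)\<^sup>2 \<le> (wt p)^6 * (1 + (op_norm X)\<^sup>2) * (\<xi> \<bullet> (amat p X *v \<xi>))"
proof -
  let ?k = "1 + (op_norm X)\<^sup>2"
  have k: "?k > 0" by (simp add: add_pos_nonneg)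
  note B = eigb[OF AS_Sym[OF X], of p]
  have c: "1 / ?k \<le> cf p X b" if b: "b \<in> eigb (AS p X)" for b
  proof -
    note n = norm_Sm_eigb[OF X b]
    have "\<bar>eigv (AS p X) b\<bar> = \<bar>(X *v (Sm p *v b)) \<bullet> (Sm p *v b)\<bar>"
      by (simp add: eigv_def AS_mult Sym_inner[OF Sm_Sym])
    also have "\<dots> \<le> norm (X *v (Sm p *v b)) * norm (Sm p *v b)" by (rule Cauchy_Schwarz_ineq2)
    also have "\<dots> \<le> (op_norm X * norm (Sm p *v b)) * norm (Sm p *v b)"
      by (intro mult_right_mono op_norm_mult_le) auto
    also have "\<dots> \<le> (op_norm X * 1) * 1" using n op_norm_nonneg[of X] by (intro mult_mono) auto
    finally have "(eigv (AS p X) b)\<^sup>2 \<le> (op_norm X)\<^sup>2"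
      using power_mono[of "\<bar>eigv (AS p X) b\<bar>" "op_norm X" 2] by simp
    then show ?thesis unfolding cf_def by (intro divide_left_mono) (auto simp: add_pos_nonneg)
  qed
  have "(norm (Sm p *v \<xi>))\<^sup>2 = (\<Sum>b\<in>eigb (AS p X). ((Sm p *v \<xi>) \<bullet> b) * ((Sm p *v \<xi>) \<bullet> b))"
    unfolding power2_norm_eq_inner by (rule onb_parseval[OF B(1)]) simp
  also have "\<dots> / ?k = (\<Sum>b\<in>eigb (AS p X). (1 / ?k) * (\<xi> \<bullet> (Sm p *v b))\<^sup>2)"
    by (simp add: sum_divide_distrib Sym_inner[OF Sm_Sym] power2_eq_square)
  also have "\<dots> \<le> (\<Sum>b\<in>eigb (AS p X). cf p X b * (\<xi> \<bullet> (Sm p *v b))\<^sup>2)"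
    by (intro sum_mono mult_right_mono c) auto
  also have "\<dots> = \<xi> \<bullet> (amat p X *v \<xi>)" by (simp add: amat_form power2_eq_square mult.assoc)
  finally have 1: "(norm (Sm p *v \<xi>))\<^sup>2 \<le> ?k * (\<xi> \<bullet> (amat p X *v \<xi>))"
    using k by (simp add: divide_le_eq mult.commute)
  have "(norm \<xi>)\<^sup>2 \<le> ((wt p)^3 * norm (Sm p *v \<xi>))\<^sup>2" by (intro power_mono norm_Sm_ge) auto
  also have "\<dots> = (wt p)^6 * (norm (Sm p *v \<xi>))\<^sup>2" by (simp add: power_mult_distrib flip: power_mult)
  also have "\<dots> \<le> (wt p)^6 * (?k * (\<xi> \<bullet> (amat p X *v \<xi>)))"
    using 1 wt_pos[of p] by (intro mult_left_mono) auto
  finally show ?thesis by (simp add: mult.assoc)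
qed

section \<open>Monotonicity along rays in the gradient variable\<close>

lemma psd_eigv_AS:
  assumes "psd X" shows "0 \<le> eigv (AS p X) b"
proof -
  have "eigv (AS p X) b = (Sm p *v b) \<bullet> (X *v (Sm p *v b))"
    by (simp add: eigv_def AS_mult Sym_inner[OF Sm_Sym] inner_commute)
  then show ?thesis using assms by (simp add: psd_def)
qed

text \<open>Each summand is -\<lambda>/(1 + \<lambda>^2) times a radial derivative of a quadratic
  form of \<open>Pm\<close>. These forms increase with |p|, and \<lambda> >= 0 is the point where
  convexity is used.\<close>

lemma bvec_radial_nonpos:
  assumes X: "psd X" and t: "0 \<le> t" shows "bvec (t *\<^sub>R p) X \<bullet> p \<le> 0"
proof -
  have "0 \<le> dP (t *\<^sub>R p) y \<bullet> p" for y
  proof -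
    have w: "0 < wt (t *\<^sub>R p)" by (rule wt_pos)
    have "dP (t *\<^sub>R p) y \<bullet> p = ((y \<bullet> y + (t * (p \<bullet> y))\<^sup>2) / wt (t *\<^sub>R p)) * t * (p \<bullet> p) +
        2 * wt (t *\<^sub>R p) * t * (p \<bullet> y)\<^sup>2"
      by (simp add: dP_def inner_add_left power2_eq_square inner_commute[of y p])
    also have "0 \<le> \<dots>" using w t by (intro add_nonneg_nonneg mult_nonneg_nonneg divide_nonneg_nonneg) auto
    finally show ?thesis by simp
  qed
  then show ?thesis unfolding bvec_def inner_sum_left
    by (intro sum_nonpos) (auto intro!: mult_nonneg_nonneg psd_eigv_AS[OF X] cf_bounds)
qed

lemma \<Phi>_antimono_radial:
  assumes X: "X \<in> Sym" "psd X" and t: "0 \<le> t" "t \<le> 1"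
  shows "\<Phi> p X \<le> \<Phi> (t *\<^sub>R p) X"
proof -
  have d: "((\<lambda>s. \<Phi> (s *\<^sub>R p) X) has_real_derivative bvec (s *\<^sub>R p) X \<bullet> p) (at s)" for s
  proof -
    have c: "((\<lambda>s. (s *\<^sub>R p, X)) has_derivative (\<lambda>h. (h *\<^sub>R p, 0))) (at s)"
      by (intro has_derivative_Pair has_derivative_const) (auto intro!: derivative_eq_intros)
    have "((\<lambda>s. \<Phi> (fst (s *\<^sub>R p, X)) (snd (s *\<^sub>R p, X))) has_derivative
      (\<lambda>h. bvec (s *\<^sub>R p) X \<bullet> fst (h *\<^sub>R p, 0::real^'a^'a) +
        mat_inner (amat (s *\<^sub>R p) X) (snd (h *\<^sub>R p, 0)))) (at s)"
      by (rule has_derivative_compose[OF c \<Phi>_has_derivative[OF X(1)]])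
    then show ?thesis
      by (simp add: has_field_derivative_def linear_0[OF mat_inner_linear_right] mult.commute[of _ "bvec _ _ \<bullet> _"])
  qed
  have "(\<lambda>s. \<Phi> (s *\<^sub>R p) X) 1 \<le> (\<lambda>s. \<Phi> (s *\<^sub>R p) X) t"
    by (rule DERIV_nonpos_imp_nonincreasing[OF t(2)])
      (use d bvec_radial_nonpos[OF X(2)] t in \<open>meson order_trans\<close>)
  then show ?thesis by simp
qed

section \<open>Calculus on the closure of a domain\<close>

lemma C_k_on_continuous: "C_k_on k S f \<Longrightarrow> continuous_on S f"
proof (cases k)
  case (Suc m)
  assume "C_k_on k S f"
  then obtain g where "\<forall>x\<in>S. (f has_derivative (\<lambda>h. g x \<bullet> h)) (at x within S)" using Suc by auto
  then show ?thesis by (intro has_derivative_continuous_on[of S f "\<lambda>x h. g x \<bullet> h"]) blast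
qed simp

lemma has_derivative_vecI:
  fixes g :: "'a::real_normed_vector \<Rightarrow> 'b::euclidean_space^'n"
  assumes "\<And>i. ((\<lambda>x. g x $ i) has_derivative (\<lambda>h. G' h $ i)) F"
  shows "(g has_derivative G') F"
proof -
  have "((\<lambda>x. g x \<bullet> b) has_derivative (\<lambda>h. G' h \<bullet> b)) F" if b: "b \<in> Basis" for b
  proof -
    obtain i u where "b = axis i u" using b unfolding Basis_vec_def by auto
    then show ?thesis using has_derivative_inner_left[OF assms[of i], of u] by (simp add: inner_axis)
  qed
  then have "((\<lambda>x. \<Sum>b\<in>Basis. (g x \<bullet> b) *\<^sub>R b) has_derivative (\<lambda>h. \<Sum>b\<in>Basis. (G' h \<bullet> b) *\<^sub>R b)) F"
    by (intro has_derivative_sum has_derivative_scaleR_left) auto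
  then show ?thesis by (simp add: euclidean_representation)
qed

lemma has_derivative_nth:
  fixes g :: "'a::real_normed_vector \<Rightarrow> real^'n"
  assumes "(g has_derivative G') F" shows "((\<lambda>x. g x $ i) has_derivative (\<lambda>h. G' h $ i)) F"
  by (rule bounded_linear.has_derivative[OF bounded_linear_vec_nth assms])

lemma C2_onE:
  fixes f :: "real^'n \<Rightarrow> real"
  assumes "C_k_on (Suc (Suc k)) S f"
  obtains g H where
    "\<And>x. x \<in> S \<Longrightarrow> (f has_derivative (\<lambda>h. g x \<bullet> h)) (at x within S)"
    "\<And>x. x \<in> S \<Longrightarrow> (g has_derivative (\<lambda>h. H x *v h)) (at x within S)"
    "\<And>i. C_k_on (Suc k) S (\<lambda>x. g x $ i)" "\<And>i j. C_k_on k S (\<lambda>x. H x $ i $ j)"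
proof -
  obtain g where g: "\<forall>x\<in>S. (f has_derivative (\<lambda>h. g x \<bullet> h)) (at x within S)"
    and gi: "\<forall>i. C_k_on (Suc k) S (\<lambda>x. g x $ i)"
    using assms by (subst (asm) C_k_on.simps(2)) blast
  then have "\<forall>i. \<exists>G. (\<forall>x\<in>S. ((\<lambda>x. g x $ i) has_derivative (\<lambda>h. G x \<bullet> h)) (at x within S)) \<and>
      (\<forall>j. C_k_on k S (\<lambda>x. G x $ j))"
    by simp
  then obtain G where G: "\<And>i x. x \<in> S \<Longrightarrow> ((\<lambda>x. g x $ i) has_derivative (\<lambda>h. G i x \<bullet> h)) (at x within S)"
    and Gk: "\<And>i j. C_k_on k S (\<lambda>x. G i x $ j)" by metis
  define H where "H = (\<lambda>x. \<chi> i. G i x)"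
  have Hi: "(H x *v h) $ i = G i x \<bullet> h" for x h i
    by (simp add: H_def matrix_vector_mult_def inner_vec_def)
  have "(g has_derivative (\<lambda>h. H x *v h)) (at x within S)" if "x \<in> S" for x
    by (rule has_derivative_vecI) (simp add: Hi G[OF that])
  moreover have "C_k_on k S (\<lambda>x. H x $ i $ j)" for i j by (simp add: H_def Gk)
  ultimately show ?thesis using that[of g H] g gi by blast
qed

lemma curve_derivative:
  assumes f: "(f has_derivative D) (at (c 0) within S)"
    and c: "(c has_vector_derivative v) (at (0::real) within I)" and cS: "c ` I \<subseteq> S"
  shows "((\<lambda>s. f (c s)) has_vector_derivative D v) (at 0 within I)"
proof -
  have "((\<lambda>s. f (c s)) has_derivative (\<lambda>s. D (s *\<^sub>R v))) (at 0 within I)"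
    using c has_derivative_in_compose[OF _ has_derivative_subset[OF f cS]]
    unfolding has_vector_derivative_def by blast
  then show ?thesis
    unfolding has_vector_derivative_def
    using linear_scale[OF has_derivative_linear[OF f]] by simp
qed

lemma ray_derivative:
  assumes f: "(f has_derivative D) (at x within S)" and e: "0 < e"
    and S: "\<And>s. 0 \<le> s \<Longrightarrow> s < e \<Longrightarrow> x + s *\<^sub>R w \<in> S"
  shows "((\<lambda>s. f (x + s *\<^sub>R w)) has_vector_derivative D w) (at 0 within {0..<e})"
proof -
  have "((\<lambda>s. x + s *\<^sub>R w) has_vector_derivative w) (at 0 within {0..<e})"
    by (auto intro!: derivative_eq_intros)
  from curve_derivative[of f D "\<lambda>s. x + s *\<^sub>R w" S, OF _ this] show ?thesis
    using f S by (simp add: image_subset_iff)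
qed

section \<open>Uniqueness of derivatives within sets that have boundary points\<close>

lemma vector_derivative_unique_halfopen:
  assumes "0 < (e::real)" "(f has_vector_derivative a) (at 0 within {0..<e})"
    "(f has_vector_derivative b) (at 0 within {0..<e})"
  shows "a = b"
proof (rule vector_derivative_unique_within[OF _ assms(2,3)])
  have "0 islimpt {0<..<e}" using assms(1) by (simp add: islimpt_greaterThanLessThan1)
  then have "0 islimpt {0..<e}" by (rule islimpt_subset) auto
  then show "at 0 within {0..<e} \<noteq> bot" using trivial_limit_within by blast
qed

text \<open>Short rays into an open half-space of directions stay in \<open>S\<close>. Interior
  points and boundary points of smooth domains both have this property, so one uniqueness argument
  serves for the open set, its closure and the collar.\<close>

definition halfspace_at :: "(real^'n) set \<Rightarrow> real^'n \<Rightarrow> real^'n \<Rightarrow> bool" where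
  "halfspace_at S x n \<longleftrightarrow> n \<noteq> 0 \<and> x \<in> S \<and> (\<forall>w. 0 < n \<bullet> w \<longrightarrow> (\<exists>e>0. \<forall>s. 0 < s \<longrightarrow> s < e \<longrightarrow> x + s *\<^sub>R w \<in> S))"

text \<open>Rays fix a derivative on the open half-space, and any \<open>v\<close> is the difference
  of \<open>v + c *\<^sub>R n\<close> and \<open>c *\<^sub>R n\<close>, which both lie in it once c
  is large.\<close>

lemma derivative_unique_halfspace:
  assumes h: "halfspace_at S x n"
    and D1: "(f has_derivative D1) (at x within S)" and D2: "(f has_derivative D2) (at x within S)"
  shows "D1 = D2"
proof -
  have eq: "D1 w = D2 w" if w: "0 < n \<bullet> w" for w
  proof -
    obtain e where e: "e > 0" "\<And>s. 0 < s \<Longrightarrow> s < e \<Longrightarrow> x + s *\<^sub>R w \<in> S"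
      using h w unfolding halfspace_at_def by blast
    have s: "x + s *\<^sub>R w \<in> S" if "0 \<le> s" "s < e" for s
      using e(2)[of s] that h by (cases "s = 0") (auto simp: halfspace_at_def)
    show ?thesis
      by (rule vector_derivative_unique_halfopen[OF e(1) ray_derivative[OF D1 e(1) s] ray_derivative[OF D2 e(1) s]])
  qed
  have l: "linear D1" "linear D2" using D1 D2 has_derivative_linear by auto
  show ?thesis
  proof
    fix v
    have n: "n \<bullet> n > 0" using h by (simp add: halfspace_at_def)
    define c where "c = (\<bar>n \<bullet> v\<bar> + 1) / (n \<bullet> n)"
    have "n \<bullet> (v + c *\<^sub>R n) = n \<bullet> v + \<bar>n \<bullet> v\<bar> + 1" using n by (simp add: inner_add_right c_def)
    then have "D1 (v + c *\<^sub>R n) = D2 (v + c *\<^sub>R n)" by (intro eq) simp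
    moreover have "D1 n = D2 n" using eq n by blast
    ultimately show "D1 v = D2 v" using l by (simp add: linear_add linear_scale)
  qed
qed

text \<open>At an interior point every direction is admissible; \<open>axis undefined 1\<close>
  merely names some nonzero vector.\<close>

lemma halfspace_at_open:
  fixes x :: "real^'n"
  assumes "open S" "x \<in> S" shows "halfspace_at S x (axis undefined 1)"
  unfolding halfspace_at_def
proof (intro conjI allI impI)
  fix w :: "real^'n"
  assume "0 < axis undefined 1 \<bullet> w"
  then have w: "norm w > 0" by auto
  obtain r where r: "r > 0" "ball x r \<subseteq> S" using assms open_contains_ball by blast
  show "\<exists>e>0. \<forall>s. 0 < s \<longrightarrow> s < e \<longrightarrow> x + s *\<^sub>R w \<in> S"
  proof (intro exI[of _ "r / norm w"] conjI allI impI)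
    fix s assume "0 < s" "s < r / norm w"
    then have "x + s *\<^sub>R w \<in> ball x r" using w by (simp add: dist_norm pos_less_divide_eq)
    then show "x + s *\<^sub>R w \<in> S" using r by blast
  qed (use r w in auto)
qed (use assms in \<open>auto simp: axis_eq_0_iff\<close>)

lemma halfspace_at_mono: "halfspace_at S x n \<Longrightarrow> S \<subseteq> S' \<Longrightarrow> halfspace_at S' x n"
  unfolding halfspace_at_def by blast

lemma grad_on_eq:
  assumes h: "halfspace_at S x n" and d: "(f has_derivative (\<lambda>h. g \<bullet> h)) (at x within S)"
  shows "grad_on S f x = g"
  unfolding grad_on_def
proof (rule the_equality)
  show "(f has_derivative (\<lambda>h. g \<bullet> h)) (at x within S)" by (rule d)
  fix g' assume "(f has_derivative (\<lambda>h. g' \<bullet> h)) (at x within S)"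
  from derivative_unique_halfspace[OF h this d] have "g' \<bullet> z = g \<bullet> z" for z by metis
  then show "g' = g" using vector_eq_rdot by blast
qed

lemma hess_on_eq:
  assumes h: "halfspace_at S x n" and d: "(g has_derivative (\<lambda>h. H *v h)) (at x within S)"
    and g: "\<forall>\<^sub>F y in nhds x. y \<in> S \<longrightarrow> grad_on S f y = g y"
  shows "hess_on S f x = H"
proof -
  have x: "x \<in> S" using h by (simp add: halfspace_at_def)
  have gx: "grad_on S f x = g x" using eventually_nhds_x_imp_x[OF g] x by simp
  have d': "(grad_on S f has_derivative (\<lambda>h. H *v h)) (at x within S)"
  proof (rule has_derivative_transform_eventually[OF d])
    show "\<forall>\<^sub>F y in at x within S. g y = grad_on S f y"
      using g unfolding eventually_at_filter by (rule eventually_mono) auto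
  qed (use gx x in auto)
  show ?thesis unfolding hess_on_def
  proof (rule the_equality)
    show "(grad_on S f has_derivative (\<lambda>h. H *v h)) (at x within S)" by (rule d')
    fix K assume "(grad_on S f has_derivative (\<lambda>h. K *v h)) (at x within S)"
    from derivative_unique_halfspace[OF h this d'] have "K *v z = H *v z" for z by metis
    then show "K = H" by (simp add: matrix_eq)
  qed
qed

text \<open>Gradient and Hessian are carried as explicit fields, so that sums and products are
  handled by algebraic rules without evaluating definite descriptions.\<close>

definition jet2 :: "(real^'n) set \<Rightarrow> (real^'n \<Rightarrow> real) \<Rightarrow> (real^'n \<Rightarrow> real^'n) \<Rightarrow> (real^'n \<Rightarrow> real^'n^'n) \<Rightarrow> bool"
  where "jet2 U f g H \<longleftrightarrow> (\<forall>x\<in>U. (f has_derivative (\<lambda>h. g x \<bullet> h)) (at x) \<and>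
    (g has_derivative (\<lambda>h. H x *v h)) (at x))"

lemma jet2D: "jet2 U f g H \<Longrightarrow> x \<in> U \<Longrightarrow> (f has_derivative (\<lambda>h. g x \<bullet> h)) (at x)"
  "jet2 U f g H \<Longrightarrow> x \<in> U \<Longrightarrow> (g has_derivative (\<lambda>h. H x *v h)) (at x)"
  by (auto simp: jet2_def)

lemma jet2_add:
  assumes 1: "jet2 U f1 g1 H1" and 2: "jet2 U f2 g2 H2"
  shows "jet2 U (\<lambda>x. f1 x + f2 x) (\<lambda>x. g1 x + g2 x) (\<lambda>x. H1 x + H2 x)"
  unfolding jet2_def inner_add_left matrix_vector_mult_add_rdistrib
  using jet2D[OF 1] jet2D[OF 2] by (blast intro: has_derivative_add)

lemma jet2_scale:
  assumes "jet2 U f g H" shows "jet2 U (\<lambda>x. c * f x) (\<lambda>x. c *\<^sub>R g x) (\<lambda>x. c *\<^sub>R H x)"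
  unfolding jet2_def inner_scaleR_left matrix_vector_mult_scaleR_left
  using jet2D[OF assms] by (blast intro: has_derivative_mult_right has_derivative_scaleR_right)

lemma jet2_mult:
  assumes 1: "jet2 U f1 g1 H1" and 2: "jet2 U f2 g2 H2"
  shows "jet2 U (\<lambda>x. f1 x * f2 x) (\<lambda>x. f1 x *\<^sub>R g2 x + f2 x *\<^sub>R g1 x)
    (\<lambda>x. f1 x *\<^sub>R H2 x + f2 x *\<^sub>R H1 x + outer (g1 x) (g2 x) + outer (g2 x) (g1 x))"
  unfolding jet2_def
proof (intro ballI conjI)
  fix x assume x: "x \<in> U"
  note d = jet2D[OF 1 x] jet2D[OF 2 x]
  show "((\<lambda>x. f1 x * f2 x) has_derivative (\<lambda>h. (f1 x *\<^sub>R g2 x + f2 x *\<^sub>R g1 x) \<bullet> h)) (at x)"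
    using has_derivative_mult[OF d(1,3)] by (simp add: inner_add_left mult.commute)
  have "((\<lambda>x. f1 x *\<^sub>R g2 x + f2 x *\<^sub>R g1 x) has_derivative
     (\<lambda>h. (f1 x *\<^sub>R (H2 x *v h) + (g1 x \<bullet> h) *\<^sub>R g2 x) + (f2 x *\<^sub>R (H1 x *v h) + (g2 x \<bullet> h) *\<^sub>R g1 x))) (at x)"
    by (intro has_derivative_add has_derivative_scaleR d)
  moreover have "(\<lambda>h. (f1 x *\<^sub>R (H2 x *v h) + (g1 x \<bullet> h) *\<^sub>R g2 x) + (f2 x *\<^sub>R (H1 x *v h) + (g2 x \<bullet> h) *\<^sub>R g1 x))
     = (\<lambda>h. (f1 x *\<^sub>R H2 x + f2 x *\<^sub>R H1 x + outer (g1 x) (g2 x) + outer (g2 x) (g1 x)) *v h)"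
    by (auto simp: matrix_vector_mult_add_rdistrib matrix_vector_mult_scaleR_left outer_mult)
  ultimately show "((\<lambda>x. f1 x *\<^sub>R g2 x + f2 x *\<^sub>R g1 x) has_derivative
     (\<lambda>h. (f1 x *\<^sub>R H2 x + f2 x *\<^sub>R H1 x + outer (g1 x) (g2 x) + outer (g2 x) (g1 x)) *v h)) (at x)"
    by simp
qed

lemma jet2_norm_sq: "jet2 U (\<lambda>x. (x - y) \<bullet> (x - y)) (\<lambda>x. 2 *\<^sub>R (x - y)) (\<lambda>x. 2 *\<^sub>R mat 1)"
  unfolding jet2_def
  by (auto intro!: derivative_eq_intros simp: matrix_vector_mult_scaleR_left inner_commute)

text \<open>If the second derivative in direction v were negative, the slope, which vanishes at x,
  would be negative just after it, and the mean value theorem would produce a smaller value.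
  Differentiability of the gradient at the point is enough for this.\<close>

lemma jet2_local_min:
  assumes j: "jet2 U f g H" and U: "open U" "x \<in> U" and mn: "\<And>y. y \<in> U \<Longrightarrow> f x \<le> f y"
  shows "g x = 0" "psd (H x)"
proof -
  have "(\<lambda>h. g x \<bullet> h) = (\<lambda>h. 0)"
    by (rule differential_zero_maxmin[OF U(2,1) jet2D(1)[OF j U(2)]]) (use mn in auto)
  then have "g x \<bullet> g x = 0" by (rule fun_cong)
  then show g0: "g x = 0" by simp
  show "psd (H x)" unfolding psd_def
  proof (intro allI, rule ccontr)
    fix v assume "\<not> 0 \<le> v \<bullet> (H x *v v)"
    then have neg: "(H x *v v) \<bullet> v < 0" by (simp add: inner_commute)
    obtain r where r: "r > 0" "ball x r \<subseteq> U" using U open_contains_ball by blast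
    have v: "norm v > 0" using neg by auto
    let ?e = "r / norm v"
    have e: "?e > 0" using r v by simp
    have inU: "x + s *\<^sub>R v \<in> U" if "\<bar>s\<bar> < ?e" for s
    proof -
      have "x + s *\<^sub>R v \<in> ball x r" using that v by (simp add: dist_norm pos_less_divide_eq)
      then show ?thesis using r by blast
    qed
    have c: "((\<lambda>s. x + s *\<^sub>R v) has_derivative (\<lambda>h. h *\<^sub>R v)) (at s)" for s :: real
      by (auto intro!: derivative_eq_intros)
    have f': "((\<lambda>s. f (x + s *\<^sub>R v)) has_real_derivative g (x + s *\<^sub>R v) \<bullet> v) (at s)" if "\<bar>s\<bar> < ?e" for s
      using has_derivative_compose[OF c jet2D(1)[OF j inU[OF that]]]
      by (simp add: has_field_derivative_def mult.commute[of _ "g _ \<bullet> v"])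
    have g': "((\<lambda>s. g (x + s *\<^sub>R v) \<bullet> v) has_real_derivative (H x *v v) \<bullet> v) (at 0)"
    proof -
      have "((\<lambda>s. g (x + s *\<^sub>R v)) has_derivative (\<lambda>h. H x *v (h *\<^sub>R v))) (at 0)"
        by (rule has_derivative_compose[OF c]) (use jet2D(2)[OF j U(2)] in simp)
      from has_derivative_inner_left[OF this, of v] show ?thesis
        by (simp add: has_field_derivative_def matrix_vector_mult_scaleR mult.commute[of _ "(H x *v v) \<bullet> v"])
    qed
    obtain d where d: "d > 0" "\<And>h. 0 < h \<Longrightarrow> h < d \<Longrightarrow> g (x + h *\<^sub>R v) \<bullet> v < 0"
      using DERIV_neg_dec_right[OF g' neg] g0 by auto
    have "0 < min d ?e" using d e by simp
    then obtain s where "0 < s" "s < min d ?e" using dense by blast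
    then have s: "0 < s" "s < d" "s < ?e" by simp_all
    obtain z where z: "0 < z" "z < s" "f (x + s *\<^sub>R v) - f (x + 0 *\<^sub>R v) = (s - 0) * (g (x + z *\<^sub>R v) \<bullet> v)"
      using MVT2[OF s(1), of "\<lambda>s. f (x + s *\<^sub>R v)" "\<lambda>s. g (x + s *\<^sub>R v) \<bullet> v"] f' s by force
    have "g (x + z *\<^sub>R v) \<bullet> v < 0" using z s by (intro d(2)) auto
    then have "s * (g (x + z *\<^sub>R v) \<bullet> v) < 0" using s(1) by (simp add: mult_pos_neg)
    then have "f (x + s *\<^sub>R v) < f x" using z(3) by simp
    moreover have "f x \<le> f (x + s *\<^sub>R v)" using s by (intro mn inU) auto
    ultimately show False by simp
  qed
qed

text \<open>The mean value theorem in direction v, applied to the increment in direction w, leaves a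
  difference of two gradients; each is replaced by its linearization at x with relative error
  e.\<close>

lemma hessian_symmetric_aux:
  fixes f :: "real^'n \<Rightarrow> real"
  assumes f: "\<And>y. y \<in> ball x d \<Longrightarrow> (f has_derivative (\<lambda>h. g y \<bullet> h)) (at y)"
    and g: "\<And>y. y \<in> ball x d \<Longrightarrow> norm (g y - g x - H *v (y - x)) \<le> e * norm (y - x)"
    and s: "0 < s" "s * (norm v + norm w) < d" and e: "0 \<le> e"
  shows "\<bar>f (x + s *\<^sub>R v + s *\<^sub>R w) - f (x + s *\<^sub>R v) - f (x + s *\<^sub>R w) + f x - s\<^sup>2 * ((H *v w) \<bullet> v)\<bar>
     \<le> 2 * e * s\<^sup>2 * (norm v + norm w)\<^sup>2"
proof -
  let ?M = "norm v + norm w"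
  have b: "norm (r *\<^sub>R v + q *\<^sub>R w) \<le> s * ?M" if "0 \<le> r" "r \<le> s" "0 \<le> q" "q \<le> s" for r q
  proof -
    have "norm (r *\<^sub>R v + q *\<^sub>R w) \<le> r * norm v + q * norm w"
      using norm_triangle_ineq[of "r *\<^sub>R v" "q *\<^sub>R w"] that by simp
    also have "\<dots> \<le> s * norm v + s * norm w" using that by (intro add_mono mult_right_mono) auto
    finally show ?thesis by (simp add: distrib_left)
  qed
  have inb: "x + (r *\<^sub>R v + q *\<^sub>R w) \<in> ball x d" if "0 \<le> r" "r \<le> s" "0 \<le> q" "q \<le> s" for r q
    
  proof -
    have "dist x (x + y) = norm y" for y by (simp add: dist_norm)
    then show ?thesis using order.strict_trans1[OF b[OF that] s(2)] by (simp only: mem_ball)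
  qed
  let ?p = "\<lambda>r. f (x + (r *\<^sub>R v + s *\<^sub>R w)) - f (x + (r *\<^sub>R v + 0 *\<^sub>R w))"
  let ?p' = "\<lambda>r. (g (x + (r *\<^sub>R v + s *\<^sub>R w)) - g (x + (r *\<^sub>R v + 0 *\<^sub>R w))) \<bullet> v"
  have d1: "((\<lambda>r. f (x + (r *\<^sub>R v + q *\<^sub>R w))) has_real_derivative g (x + (r *\<^sub>R v + q *\<^sub>R w)) \<bullet> v) (at r)"
    if "0 \<le> r" "r \<le> s" "0 \<le> q" "q \<le> s" for r q
  proof -
    have "((\<lambda>r. x + (r *\<^sub>R v + q *\<^sub>R w)) has_derivative (\<lambda>h. h *\<^sub>R v)) (at r)"
      by (auto intro!: derivative_eq_intros)
    from has_derivative_compose[OF this f[OF inb[OF that]]] show ?thesis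
      by (simp add: has_field_derivative_def mult.commute[of _ "g _ \<bullet> v"])
  qed
  have d: "(?p has_real_derivative ?p' r) (at r)" if "0 \<le> r" "r \<le> s" for r
    unfolding inner_diff_left using s that by (intro DERIV_diff d1) auto
  obtain z where z: "0 < z" "z < s" "?p s - ?p 0 = (s - 0) * ?p' z"
    using MVT2[OF s(1), of ?p ?p'] d by blast
  have gb: "norm (g (x + y) - g x - H *v y) \<le> e * (s * ?M)" if "x + y \<in> ball x d" "norm y \<le> s * ?M" for y
    using g[OF that(1)] mult_left_mono[OF that(2) e] by simp
  let ?a = "z *\<^sub>R v + s *\<^sub>R w" and ?b = "z *\<^sub>R v + 0 *\<^sub>R w"
  have "?p' z - s * ((H *v w) \<bullet> v) = ((g (x + ?a) - g x - H *v ?a) - (g (x + ?b) - g x - H *v ?b)) \<bullet> v"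
    by (simp add: matrix_vector_right_distrib matrix_vector_mult_scaleR inner_diff_left inner_add_left)
  also have "\<bar>\<dots>\<bar> \<le> norm ((g (x + ?a) - g x - H *v ?a) - (g (x + ?b) - g x - H *v ?b)) * norm v"
    by (rule Cauchy_Schwarz_ineq2)
  also have "\<dots> \<le> (e * (s * ?M) + e * (s * ?M)) * norm v"
    using z s by (intro mult_right_mono order.trans[OF norm_triangle_ineq4] add_mono gb inb b) auto
  also have "\<dots> \<le> (e * (s * ?M) + e * (s * ?M)) * ?M"
    using s e by (intro mult_left_mono add_nonneg_nonneg mult_nonneg_nonneg) auto
  finally have "\<bar>?p' z - s * ((H *v w) \<bullet> v)\<bar> \<le> 2 * e * s * ?M\<^sup>2" by (simp add: power2_eq_square algebra_simps)
  then have "s * \<bar>?p' z - s * ((H *v w) \<bullet> v)\<bar> \<le> s * (2 * e * s * ?M\<^sup>2)" using s by (intro mult_left_mono) auto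
  moreover have "s * \<bar>?p' z - s * ((H *v w) \<bullet> v)\<bar> = \<bar>s * ?p' z - s\<^sup>2 * ((H *v w) \<bullet> v)\<bar>"
    using s by (simp add: abs_mult_pos' right_diff_distrib power2_eq_square mult.assoc)
  moreover have "f (x + s *\<^sub>R v + s *\<^sub>R w) - f (x + s *\<^sub>R v) - f (x + s *\<^sub>R w) + f x = s * ?p' z"
    using z(3) by (simp add: add.assoc)
  ultimately show ?thesis by (simp add: power2_eq_square mult_ac)
qed

text \<open>Young's form of the theorem on mixed partials: the second difference is symmetric in v
  and w, while it approximates both s^2 (H w . v) and s^2 (H v . w). The Hessian need not be
  continuous.\<close>

lemma hessian_symmetric:
  fixes f :: "real^'n \<Rightarrow> real"
  assumes U: "open U" "x \<in> U" and f: "\<And>y. y \<in> U \<Longrightarrow> (f has_derivative (\<lambda>h. g y \<bullet> h)) (at y)"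
    and g: "(g has_derivative (\<lambda>h. H *v h)) (at x)"
  shows "H \<in> Sym"
proof (rule SymI)
  fix v w :: "real^'n"
  let ?M = "norm v + norm w"
  have bound: "\<bar>(H *v w) \<bullet> v - (H *v v) \<bullet> w\<bar> \<le> (4 * ?M\<^sup>2) * e" if e: "e > 0" for e
  proof -
    obtain r where r: "r > 0" "ball x r \<subseteq> U" using U open_contains_ball by blast
    obtain d0 where d0: "d0 > 0" "\<And>y. norm (y - x) < d0 \<Longrightarrow> norm (g y - g x - H *v (y - x)) \<le> e * norm (y - x)"
      using g e unfolding has_derivative_at_alt by blast
    define d where "d = min d0 r"
    have d: "d > 0" using r d0 by (simp add: d_def)
    have f': "(f has_derivative (\<lambda>h. g y \<bullet> h)) (at y)" if "y \<in> ball x d" for y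
      using that r by (intro f) (auto simp: d_def)
    have g': "norm (g y - g x - H *v (y - x)) \<le> e * norm (y - x)" if "y \<in> ball x d" for y
      using that by (intro d0(2)) (auto simp: d_def dist_norm norm_minus_commute)
    define k where "k = ?M + 1"
    have k: "k > 0" by (simp add: k_def add_nonneg_pos)
    \<comment> \<open>Any step with s (|v| + |w|) < d would do; the added 1 in \<open>k\<close>
      covers v = w = 0.\<close>
    define s where "s = d / (2 * k)"
    have s: "s > 0" using d k by (simp add: s_def)
    have "s * k = d / 2" using k by (simp add: s_def)
    then have "s * (?M + 1) = d / 2" by (simp only: k_def)
    then have sM: "s * ?M < d" using s d by (simp add: distrib_left)
    let ?D = "f (x + s *\<^sub>R v + s *\<^sub>R w) - f (x + s *\<^sub>R v) - f (x + s *\<^sub>R w) + f x"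
    have 1: "\<bar>?D - s\<^sup>2 * ((H *v w) \<bullet> v)\<bar> \<le> 2 * e * s\<^sup>2 * ?M\<^sup>2"
      using hessian_symmetric_aux[OF f' g' s, where v=v and w=w] sM e by simp
    have 2: "\<bar>?D - s\<^sup>2 * ((H *v v) \<bullet> w)\<bar> \<le> 2 * e * s\<^sup>2 * ?M\<^sup>2"
      using hessian_symmetric_aux[OF f' g' s, where v=w and w=v] sM e by (simp add: add_ac algebra_simps)
    have "s\<^sup>2 * \<bar>(H *v w) \<bullet> v - (H *v v) \<bullet> w\<bar> = \<bar>(?D - s\<^sup>2 * ((H *v v) \<bullet> w)) - (?D - s\<^sup>2 * ((H *v w) \<bullet> v))\<bar>"
      by (simp add: abs_mult right_diff_distrib[symmetric])
    also have "\<dots> \<le> 2 * e * s\<^sup>2 * ?M\<^sup>2 + 2 * e * s\<^sup>2 * ?M\<^sup>2" using 1 2 by linarith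
    also have "\<dots> = s\<^sup>2 * ((4 * ?M\<^sup>2) * e)" by simp
    finally show ?thesis using s by simp
  qed
  have "\<bar>(H *v w) \<bullet> v - (H *v v) \<bullet> w\<bar> \<le> 0"
  proof (rule field_le_epsilon)
    fix e :: real assume e: "e > 0"
    let ?k = "4 * ?M\<^sup>2 + 1"
    have k: "?k > 0" by (simp add: add_nonneg_pos)
    have "\<bar>(H *v w) \<bullet> v - (H *v v) \<bullet> w\<bar> \<le> (4 * ?M\<^sup>2) * (e / ?k)" using e k by (intro bound) simp
    also have "\<dots> \<le> ?k * (e / ?k)" using e k by (intro mult_right_mono) auto
    finally show "\<bar>(H *v w) \<bullet> v - (H *v v) \<bullet> w\<bar> \<le> 0 + e" using k by simp
  qed
  then show "(H *v v) \<bullet> w = v \<bullet> (H *v w)" by (simp add: inner_commute)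
qed

section \<open>Tangent space and inward normal of the boundary\<close>

lemma C_k_on_cong:
  assumes "\<And>x. x \<in> S \<Longrightarrow> f x = g x" "C_k_on k S f" shows "C_k_on k S g"
proof (cases k)
  case 0
  then show ?thesis using assms continuous_on_cong by (metis C_k_on.simps(1))
next
  case (Suc m)
  then obtain G where G: "\<forall>x\<in>S. (f has_derivative (\<lambda>h. G x \<bullet> h)) (at x within S)"
    and Gi: "\<forall>i. C_k_on m S (\<lambda>x. G x $ i)"
    using assms(2) by (simp only: C_k_on.simps(2)) blast
  have "(g has_derivative (\<lambda>h. G x \<bullet> h)) (at x within S)" if "x \<in> S" for x
    by (rule has_derivative_transform[OF that _ G[rule_format, OF that]]) (simp add: assms(1))
  with Gi show ?thesis unfolding Suc C_k_on.simps(2) by blast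
qed

definition solid :: "(real^'n) set \<Rightarrow> bool" where
  "solid S \<longleftrightarrow> (\<forall>x\<in>S. \<exists>n. halfspace_at S x n)"

text \<open>Derivatives within a solid set are unique, so the definite descriptions
  \<open>grad_on\<close> and \<open>hess_on\<close> coincide with the fields supplied by
  \<open>C_k_on\<close> and inherit their regularity.\<close>

lemma C2_solid:
  fixes f :: "real^'n \<Rightarrow> real"
  assumes S: "solid S" and f: "C_k_on (Suc (Suc k)) S f"
  shows "\<And>x. x \<in> S \<Longrightarrow> (f has_derivative (\<lambda>h. grad_on S f x \<bullet> h)) (at x within S)"
    and "\<And>x. x \<in> S \<Longrightarrow> (grad_on S f has_derivative (\<lambda>h. hess_on S f x *v h)) (at x within S)"
    and "\<And>i. C_k_on (Suc k) S (\<lambda>x. grad_on S f x $ i)"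
    and "\<And>i j. C_k_on k S (\<lambda>x. hess_on S f x $ i $ j)"
    and "\<And>x i. x \<in> S \<Longrightarrow> grad_on S (\<lambda>x. grad_on S f x $ i) x = hess_on S f x $ i"
proof -
  obtain g H where
    g: "\<And>x. x \<in> S \<Longrightarrow> (f has_derivative (\<lambda>h. g x \<bullet> h)) (at x within S)" and
    H: "\<And>x. x \<in> S \<Longrightarrow> (g has_derivative (\<lambda>h. H x *v h)) (at x within S)" and
    gi: "\<And>i. C_k_on (Suc k) S (\<lambda>x. g x $ i)" and Hi: "\<And>i j. C_k_on k S (\<lambda>x. H x $ i $ j)"
    using C2_onE[OF f] by blast
  have ge: "grad_on S f x = g x" if x: "x \<in> S" for x
    using S x grad_on_eq[OF _ g[OF x]] unfolding solid_def by blast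
  have He: "hess_on S f x = H x" if x: "x \<in> S" for x
  proof -
    obtain n where n: "halfspace_at S x n" using S x unfolding solid_def by blast
    show ?thesis by (rule hess_on_eq[OF n H[OF x]]) (simp add: ge)
  qed
  show 1: "(f has_derivative (\<lambda>h. grad_on S f x \<bullet> h)) (at x within S)" if "x \<in> S" for x
    using g[OF that] by (simp add: ge that)
  show 2: "(grad_on S f has_derivative (\<lambda>h. hess_on S f x *v h)) (at x within S)" if "x \<in> S" for x
    unfolding He[OF that] by (rule has_derivative_transform[OF that _ H[OF that]]) (simp add: ge)
  show "C_k_on (Suc k) S (\<lambda>x. grad_on S f x $ i)" for i
    by (rule C_k_on_cong[OF _ gi[of i]]) (simp add: ge)
  show "C_k_on k S (\<lambda>x. hess_on S f x $ i $ j)" for i j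
    by (rule C_k_on_cong[OF _ Hi[of i j]]) (simp add: He)
  show "grad_on S (\<lambda>x. grad_on S f x $ i) x = hess_on S f x $ i" if x: "x \<in> S" for x i
  proof -
    obtain n where n: "halfspace_at S x n" using S x unfolding solid_def by blast
    have "((\<lambda>x. grad_on S f x $ i) has_derivative (\<lambda>h. hess_on S f x $ i \<bullet> h)) (at x within S)"
      using has_derivative_nth[OF 2[OF x], of i] by (simp add: matrix_vector_mult_def inner_vec_def)
    then show ?thesis by (rule grad_on_eq[OF n])
  qed
qed

text \<open>The one-sided comparison behind all first-order information at endpoints: for the length
  and direction of the gradient of the distance, and for the barrier at its contact point.\<close>

lemma slope_le:
  fixes f :: "real \<Rightarrow> real"
  assumes e: "0 < e" and d: "(f has_vector_derivative D) (at 0 within {0..<e})"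
    and le: "\<And>s. 0 < s \<Longrightarrow> s < e \<Longrightarrow> f s \<le> f 0 + L * s"
  shows "D \<le> L"
proof -
  have "(f has_field_derivative D) (at 0 within {0..<e})"
    using d has_real_derivative_iff_has_vector_derivative by blast
  then have t: "((\<lambda>y. (f y - f 0) / (y - 0)) \<longlongrightarrow> D) (at 0 within {0..<e})"
    by (simp only: has_field_derivative_iff)
  show ?thesis
  proof (rule tendsto_upperbound[OF t])
    show "\<forall>\<^sub>F y in at 0 within {0..<e}. (f y - f 0) / (y - 0) \<le> L"
      unfolding eventually_at_filter
    proof (intro always_eventually allI impI)
      fix y :: real assume "y \<noteq> 0" "y \<in> {0..<e}"
      then have "0 < y" "y < e" by auto
      then show "(f y - f 0) / (y - 0) \<le> L" using le[of y] by (simp add: divide_le_eq)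
    qed
    have "0 islimpt {0<..<e}" using e by (simp add: islimpt_greaterThanLessThan1)
    then have "0 islimpt {0..<e}" by (rule islimpt_subset) auto
    then show "at 0 within {0..<e} \<noteq> bot" using trivial_limit_within by blast
  qed
qed

locale c4_domain =
  fixes \<Omega> :: "(real^'n) set" and r :: real
  assumes dom: "bounded_C_k_domain 4 \<Omega>" and reg: "regular_collar \<Omega> r"
begin

lemma open_dom: "open \<Omega>" and bounded_dom: "bounded \<Omega>" and dom_nonempty: "\<Omega> \<noteq> {}"
  using dom by (auto simp: bounded_C_k_domain_def)

lemma frontier_nonempty: "frontier \<Omega> \<noteq> {}"
  using dom_nonempty bounded_dom by (metis frontier_eq_empty not_bounded_UNIV)

lemma compact_closure_dom: "compact (closure \<Omega>)" using bounded_dom by simp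
lemma compact_frontier_dom: "compact (frontier \<Omega>)" using bounded_dom by (rule compact_frontier_bounded)

lemma closure_cases: "x \<in> closure \<Omega> \<Longrightarrow> x \<in> \<Omega> \<or> x \<in> frontier \<Omega>"
  using open_dom by (auto simp: frontier_def interior_open)
lemma frontier_closure: "x \<in> frontier \<Omega> \<Longrightarrow> x \<in> closure \<Omega>" by (simp add: frontier_def)
lemma frontier_notin: "x \<in> frontier \<Omega> \<Longrightarrow> x \<notin> \<Omega>" using open_dom by (auto simp: frontier_def interior_open)
lemma dom_closure: "x \<in> \<Omega> \<Longrightarrow> x \<in> closure \<Omega>" using closure_subset by blast

text \<open>The vector is the normalized gradient of a local defining function. Its properties are
  phrased by rays and by \<Omega> alone, so that afterwards no reference to the defining function
  remains.\<close>

lemma ex_normal: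
  assumes x0: "x0 \<in> frontier \<Omega>"
  shows "\<exists>\<nu>. norm \<nu> = 1 \<and>
    (\<forall>w. 0 < \<nu> \<bullet> w \<longrightarrow> (\<exists>e>0. \<forall>s. 0 < s \<longrightarrow> s < e \<longrightarrow> x0 + s *\<^sub>R w \<in> \<Omega>)) \<and>
    (\<forall>w. \<nu> \<bullet> w < 0 \<longrightarrow> (\<exists>e>0. \<forall>s. 0 < s \<longrightarrow> s < e \<longrightarrow> x0 + s *\<^sub>R w \<notin> \<Omega>)) \<and>
    (\<forall>v\<in>tangent_space (frontier \<Omega>) x0. \<nu> \<bullet> v = 0)"
proof -
  obtain U \<rho> where U: "open U" "x0 \<in> U" and C: "C_k_on 4 U \<rho>" and nz: "\<forall>x\<in>U. grad_on U \<rho> x \<noteq> 0"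
    and OU: "\<Omega> \<inter> U = {x\<in>U. \<rho> x > 0}"
    using dom x0 unfolding bounded_C_k_domain_def by blast
  have "C_k_on (Suc 3) U \<rho>" using C by (simp add: eval_nat_numeral)
  then obtain g where g': "\<forall>x\<in>U. (\<rho> has_derivative (\<lambda>h. g x \<bullet> h)) (at x within U)"
    by (subst (asm) C_k_on.simps(2)) blast
  have g: "(\<rho> has_derivative (\<lambda>h. g x \<bullet> h)) (at x)" if "x \<in> U" for x
    using g' that at_within_open[OF that U(1)] by metis
  have "grad_on U \<rho> x0 = g x0"
    by (rule grad_on_eq[OF halfspace_at_open[OF U]]) (use g' U in blast)
  then have n0: "g x0 \<noteq> 0" using nz U by auto
  \<comment> \<open>A positive value would place y in the open set \<Omega>; a negative one would
    give y a neighbourhood that misses \<Omega>.\<close>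
  have zero: "\<rho> y = 0" if y: "y \<in> frontier \<Omega>" "y \<in> U" for y
  proof -
    have "\<not> \<rho> y > 0" using OU frontier_notin[OF y(1)] y(2) by blast
    moreover have "\<not> \<rho> y < 0"
    proof
      assume neg: "\<rho> y < 0"
      have "isCont \<rho> y" using g[OF y(2)] by (rule has_derivative_continuous)
      then have "\<forall>\<^sub>F z in nhds y. \<rho> z < 0"
        using neg order_tendstoD(2)[of \<rho> "\<rho> y" "nhds y" 0]
        by (simp add: continuous_at tendsto_at_iff_tendsto_nhds)
      moreover have "\<forall>\<^sub>F z in nhds y. z \<in> U" using U(1) y(2) by (rule eventually_nhds_in_open)
      ultimately have "\<forall>\<^sub>F z in nhds y. \<rho> z < 0 \<and> z \<in> U" by eventually_elim auto
      then obtain V where V: "open V" "y \<in> V" "\<forall>z\<in>V. \<rho> z < 0 \<and> z \<in> U" unfolding eventually_nhds by blast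
      then have "\<Omega> \<inter> V = {}" using OU by force
      then show False using V frontier_closure[OF y(1)] open_Int_closure_eq_empty[OF V(1), of \<Omega>] by blast
    qed
    ultimately show ?thesis by linarith
  qed
  have ray: "\<exists>e>0. \<forall>s. 0 < s \<longrightarrow> s < e \<longrightarrow> x0 + s *\<^sub>R w \<in> U" for w
  proof -
    obtain q where q: "q > 0" "ball x0 q \<subseteq> U" using U open_contains_ball by blast
    have k: "norm w + 1 > 0" by (simp add: add_nonneg_pos)
    show ?thesis
    proof (intro exI[of _ "q / (norm w + 1)"] conjI allI impI)
      fix s assume s: "0 < s" "s < q / (norm w + 1)"
      then have "s * (norm w + 1) < q" using k by (simp add: pos_less_divide_eq)
      then have "norm (s *\<^sub>R w) < q" using s by (simp add: distrib_left)
      then have "x0 + s *\<^sub>R w \<in> ball x0 q" by (simp add: dist_norm)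
      then show "x0 + s *\<^sub>R w \<in> U" using q by blast
    qed (use q k in auto)
  qed
  have der: "((\<lambda>s. \<rho> (x0 + s *\<^sub>R w)) has_real_derivative g x0 \<bullet> w) (at 0)" for w
  proof -
    have "((\<lambda>s. x0 + s *\<^sub>R w) has_derivative (\<lambda>h. h *\<^sub>R w)) (at (0::real))"
      by (auto intro!: derivative_eq_intros)
    from has_derivative_compose[OF this, of \<rho> "\<lambda>h. g x0 \<bullet> h"] g[OF U(2)] show ?thesis
      by (simp add: has_field_derivative_def mult.commute[of _ "g x0 \<bullet> w"])
  qed
  have r0: "\<rho> x0 = 0" using zero x0 U by blast
  let ?\<nu> = "(1 / norm (g x0)) *\<^sub>R g x0"
  have s: "(0 < ?\<nu> \<bullet> w) = (0 < g x0 \<bullet> w)" "(?\<nu> \<bullet> w < 0) = (g x0 \<bullet> w < 0)" for w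
    using n0 by (auto simp: zero_less_divide_iff divide_less_0_iff)
  show ?thesis
  proof (intro exI[of _ ?\<nu>] conjI allI impI ballI)
    show "norm ?\<nu> = 1" using n0 by simp
    fix w
    obtain e where e: "e > 0" "\<forall>s. 0 < s \<longrightarrow> s < e \<longrightarrow> x0 + s *\<^sub>R w \<in> U" using ray by blast
    show "\<exists>e>0. \<forall>s. 0 < s \<longrightarrow> s < e \<longrightarrow> x0 + s *\<^sub>R w \<in> \<Omega>" if pos: "0 < ?\<nu> \<bullet> w"
    proof -
      obtain d where d: "d > 0" "\<forall>h>0. h < d \<longrightarrow> \<rho> (x0 + 0 *\<^sub>R w) < \<rho> (x0 + (0 + h) *\<^sub>R w)"
        using DERIV_pos_inc_right[OF der pos[unfolded s]] by blast
      have "x0 + s *\<^sub>R w \<in> \<Omega>" if s: "0 < s" "s < min d e" for s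
      proof -
        have "\<rho> (x0 + s *\<^sub>R w) > 0" using d(2) s r0 by simp
        then show ?thesis using OU e(2) s by auto
      qed
      then show ?thesis using d e by (intro exI[of _ "min d e"]) auto
    qed
    show "\<exists>e>0. \<forall>s. 0 < s \<longrightarrow> s < e \<longrightarrow> x0 + s *\<^sub>R w \<notin> \<Omega>" if neg: "?\<nu> \<bullet> w < 0"
    proof -
      obtain d where d: "d > 0" "\<forall>h>0. h < d \<longrightarrow> \<rho> (x0 + (0 + h) *\<^sub>R w) < \<rho> (x0 + 0 *\<^sub>R w)"
        using DERIV_neg_dec_right[OF der neg[unfolded s]] by blast
      have "x0 + s *\<^sub>R w \<notin> \<Omega>" if s: "0 < s" "s < min d e" for s
      proof -
        have "\<rho> (x0 + s *\<^sub>R w) < 0" using d(2) s r0 by simp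
        then have "\<not> \<rho> (x0 + s *\<^sub>R w) > 0" by simp
        then show ?thesis using OU e(2) s by auto
      qed
      then show ?thesis using d e by (intro exI[of _ "min d e"]) auto
    qed
    fix v assume "v \<in> tangent_space (frontier \<Omega>) x0"
    then obtain c where c: "c 0 = x0" "range c \<subseteq> frontier \<Omega>" "(c has_vector_derivative v) (at (0::real))"
      unfolding tangent_space_def by blast
    have "((\<lambda>s. \<rho> (c s)) has_vector_derivative g x0 \<bullet> v) (at 0)"
      by (rule curve_derivative[where S = UNIV]) (use c g[OF U(2)] in auto)
    moreover have "((\<lambda>s. \<rho> (c s)) has_vector_derivative 0) (at 0)"
    proof -
      have "isCont c 0" using c(3) by (rule has_vector_derivative_continuous)
      then have t: "(c \<longlongrightarrow> x0) (nhds 0)" using c(1) tendsto_at_iff_tendsto_nhds[of c 0] by (simp add: continuous_at)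
      have "\<forall>\<^sub>F s in nhds 0. c s \<in> U" using topological_tendstoD[OF t U(1,2)] .
      then have ev: "\<forall>\<^sub>F s in nhds 0. \<rho> (c s) = 0"
        by eventually_elim (use c(2) zero in blast)
      show ?thesis unfolding has_vector_derivative_def
      proof (rule has_derivative_transform_eventually)
        show "((\<lambda>s. 0) has_derivative (\<lambda>s. s *\<^sub>R 0)) (at (0::real))" by simp
        show "\<forall>\<^sub>F s in at 0. 0 = \<rho> (c s)"
          using ev unfolding eventually_at_filter by (rule eventually_mono) simp
      qed (use eventually_nhds_x_imp_x[OF ev] in auto)
    qed
    ultimately have "g x0 \<bullet> v = 0" by (rule vector_derivative_unique_at)
    then show "?\<nu> \<bullet> v = 0" by simp
  qed
qed

text \<open>In place of an implicit function theorem, the line \<open>x0 + s *\<^sub>R v\<close> is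
  projected to a closest point of the frontier. Its distance to the frontier is o(s), so the
  projected curve has velocity \<open>v\<close> at 0, and the definition of the tangent space asks
  for differentiability there only.\<close>

lemma tangent_vectorI:
  assumes x0: "x0 \<in> frontier \<Omega>" and nu: "norm \<nu> = 1"
    and pos: "\<And>w. 0 < \<nu> \<bullet> w \<Longrightarrow> \<exists>e>0. \<forall>s. 0 < s \<longrightarrow> s < e \<longrightarrow> x0 + s *\<^sub>R w \<in> \<Omega>"
    and neg: "\<And>w. \<nu> \<bullet> w < 0 \<Longrightarrow> \<exists>e>0. \<forall>s. 0 < s \<longrightarrow> s < e \<longrightarrow> x0 + s *\<^sub>R w \<notin> \<Omega>"
    and v: "\<nu> \<bullet> v = 0"
  shows "v \<in> tangent_space (frontier \<Omega>) x0"
proof -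
  have nn: "\<nu> \<bullet> \<nu> = 1" using nu by (simp add: norm_eq_1)
  \<comment> \<open>Tilting the direction by \<eta> towards or away from the normal gives a point
    inside and a point outside \<Omega>; the segment between them crosses the frontier within
    distance \<eta> s of the line.\<close>
  have near: "\<exists>e>0. \<forall>s. 0 < s \<longrightarrow> s < e \<longrightarrow> (\<exists>y\<in>frontier \<Omega>. dist (x0 + s *\<^sub>R w) y \<le> \<eta> * s)"
    if w: "\<nu> \<bullet> w = 0" and eta: "\<eta> > 0" for w \<eta>
  proof -
    have "0 < \<nu> \<bullet> (w + \<eta> *\<^sub>R \<nu>)" "\<nu> \<bullet> (w - \<eta> *\<^sub>R \<nu>) < 0"
      using w eta nn by (auto simp: inner_add_right inner_diff_right)
    from pos[OF this(1)] neg[OF this(2)] obtain e1 e2 where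
      e1: "e1 > 0" "\<And>s. 0 < s \<Longrightarrow> s < e1 \<Longrightarrow> x0 + s *\<^sub>R (w + \<eta> *\<^sub>R \<nu>) \<in> \<Omega>" and
      e2: "e2 > 0" "\<And>s. 0 < s \<Longrightarrow> s < e2 \<Longrightarrow> x0 + s *\<^sub>R (w - \<eta> *\<^sub>R \<nu>) \<notin> \<Omega>" by blast
    have "\<exists>y\<in>frontier \<Omega>. dist (x0 + s *\<^sub>R w) y \<le> \<eta> * s" if s: "0 < s" "s < min e1 e2" for s
    proof -
      let ?a = "x0 + s *\<^sub>R (w + \<eta> *\<^sub>R \<nu>)" and ?b = "x0 + s *\<^sub>R (w - \<eta> *\<^sub>R \<nu>)" and ?z = "x0 + s *\<^sub>R w"
      have ab: "?a \<in> \<Omega>" "?b \<notin> \<Omega>" using e1(2)[of s] e2(2)[of s] s by auto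
      have "closed_segment ?a ?b \<inter> frontier \<Omega> \<noteq> {}"
      proof (rule connected_Int_frontier)
        show "closed_segment ?a ?b \<inter> \<Omega> \<noteq> {}" using ab(1) ends_in_segment by blast
        show "closed_segment ?a ?b - \<Omega> \<noteq> {}" using ab(2) ends_in_segment by blast
      qed simp
      then obtain y where y: "y \<in> closed_segment ?a ?b" "y \<in> frontier \<Omega>" by blast
      have eqs: "?z - ?a = - ((s * \<eta>) *\<^sub>R \<nu>)" "?z - ?b = (s * \<eta>) *\<^sub>R \<nu>" by (simp_all add: algebra_simps)
      have "?a \<in> cball ?z (\<eta> * s)" "?b \<in> cball ?z (\<eta> * s)"
        unfolding mem_cball dist_norm eqs using s eta nu by (auto simp: mult.commute)
      then have "closed_segment ?a ?b \<subseteq> cball ?z (\<eta> * s)" by (simp add: closed_segment_subset)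
      then have "dist ?z y \<le> \<eta> * s" using y(1) by (simp add: subset_iff)
      then show ?thesis using y(2) by blast
    qed
    then show ?thesis using e1(1) e2(1) by (intro exI[of _ "min e1 e2"]) auto
  qed
  define c where "c = (\<lambda>s. closest_point (frontier \<Omega>) (x0 + s *\<^sub>R v))"
  have c0: "c 0 = x0" using x0 by (simp add: c_def closest_point_self)
  have cr: "range c \<subseteq> frontier \<Omega>"
    unfolding c_def using closest_point_in_set[OF frontier_closed frontier_nonempty] by blast
  have "(c has_derivative (\<lambda>s. s *\<^sub>R v)) (at 0)"
    unfolding has_derivative_at_alt
  proof (intro conjI allI impI)
    show "bounded_linear (\<lambda>s. s *\<^sub>R v)" by (rule bounded_linear_scaleR_left)
    fix \<eta> :: real assume eta: "\<eta> > 0"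
    obtain e1 where e1: "e1 > 0" "\<And>s. 0 < s \<Longrightarrow> s < e1 \<Longrightarrow> \<exists>y\<in>frontier \<Omega>. dist (x0 + s *\<^sub>R v) y \<le> \<eta> * s"
      using near[OF v eta] by blast
    obtain e2 where e2: "e2 > 0" "\<And>s. 0 < s \<Longrightarrow> s < e2 \<Longrightarrow> \<exists>y\<in>frontier \<Omega>. dist (x0 + s *\<^sub>R (- v)) y \<le> \<eta> * s"
      using near[of "- v", OF _ eta] v by auto
    show "\<exists>d>0. \<forall>y. norm (y - 0) < d \<longrightarrow> norm (c y - c 0 - (y - 0) *\<^sub>R v) \<le> \<eta> * norm (y - 0)"
    proof (intro exI[of _ "min e1 e2"] conjI allI impI)
      fix s :: real assume s: "norm (s - 0) < min e1 e2"
      have "\<exists>y\<in>frontier \<Omega>. dist (x0 + s *\<^sub>R v) y \<le> \<eta> * \<bar>s\<bar>"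
      proof (cases s "0::real" rule: linorder_cases)
        case less then show ?thesis using e2(2)[of "- s"] s by auto
      next
        case equal then show ?thesis using x0 by (intro bexI[of _ x0]) auto
      next
        case greater then show ?thesis using e1(2)[of s] s by auto
      qed
      then obtain y where y: "y \<in> frontier \<Omega>" "dist (x0 + s *\<^sub>R v) y \<le> \<eta> * \<bar>s\<bar>" by blast
      have "dist (x0 + s *\<^sub>R v) (c s) \<le> \<eta> * \<bar>s\<bar>"
        using closest_point_le[OF frontier_closed y(1), of "x0 + s *\<^sub>R v"] y(2) by (simp add: c_def)
      moreover have "norm (c s - c 0 - (s - 0) *\<^sub>R v) = dist (x0 + s *\<^sub>R v) (c s)"
        by (simp add: c0 dist_norm norm_minus_commute algebra_simps)
      ultimately show "norm (c s - c 0 - (s - 0) *\<^sub>R v) \<le> \<eta> * norm (s - 0)" by simp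
    qed (use e1 e2 in auto)
  qed
  then have "(c has_vector_derivative v) (at 0)" by (simp add: has_vector_derivative_def)
  with c0 cr show ?thesis unfolding tangent_space_def by blast
qed

lemma inward_normal:
  assumes x0: "x0 \<in> frontier \<Omega>"
  defines "\<nu> \<equiv> inward_normal \<Omega> x0"
  shows "norm \<nu> = 1" "tangent_space (frontier \<Omega>) x0 = {v. \<nu> \<bullet> v = 0}"
    "\<And>w. 0 < \<nu> \<bullet> w \<Longrightarrow> \<exists>e>0. \<forall>s. 0 < s \<longrightarrow> s < e \<longrightarrow> x0 + s *\<^sub>R w \<in> \<Omega>"
proof -
  obtain n where n: "norm n = 1"
    "\<And>w. 0 < n \<bullet> w \<Longrightarrow> \<exists>e>0. \<forall>s. 0 < s \<longrightarrow> s < e \<longrightarrow> x0 + s *\<^sub>R w \<in> \<Omega>"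
    "\<And>w. n \<bullet> w < 0 \<Longrightarrow> \<exists>e>0. \<forall>s. 0 < s \<longrightarrow> s < e \<longrightarrow> x0 + s *\<^sub>R w \<notin> \<Omega>"
    "\<And>v. v \<in> tangent_space (frontier \<Omega>) x0 \<Longrightarrow> n \<bullet> v = 0"
    using ex_normal[OF x0] by blast
  have nn: "n \<bullet> n = 1" using n(1) by (simp add: norm_eq_1)
  have T: "tangent_space (frontier \<Omega>) x0 = {v. n \<bullet> v = 0}"
    using tangent_vectorI[OF x0 n(1-3)] n(4) by blast
  have "\<nu> = n" unfolding \<nu>_def inward_normal_def
  proof (rule the_equality)
    obtain e where "e > 0" "\<forall>s. 0 < s \<longrightarrow> s < e \<longrightarrow> x0 + s *\<^sub>R n \<in> \<Omega>" using n(2)[of n] nn by auto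
    then have "\<exists>\<epsilon>>0. \<forall>s\<in>{0<..<\<epsilon>}. x0 + s *\<^sub>R n \<in> \<Omega>" by auto
    then show "norm n = 1 \<and> (\<forall>v\<in>tangent_space (frontier \<Omega>) x0. n \<bullet> v = 0) \<and>
        (\<exists>\<epsilon>>0. \<forall>s\<in>{0<..<\<epsilon>}. x0 + s *\<^sub>R n \<in> \<Omega>)"
      using n(1,4) by blast
    fix m assume m: "norm m = 1 \<and> (\<forall>v\<in>tangent_space (frontier \<Omega>) x0. m \<bullet> v = 0) \<and>
        (\<exists>\<epsilon>>0. \<forall>s\<in>{0<..<\<epsilon>}. x0 + s *\<^sub>R m \<in> \<Omega>)"
    \<comment> \<open>The part of m orthogonal to n is itself a tangent vector, hence orthogonal to
      m as well as to n, and so it is zero.\<close>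
    let ?v = "m - (n \<bullet> m) *\<^sub>R n"
    have v: "n \<bullet> ?v = 0" using nn by (simp add: inner_diff_right)
    then have "m \<bullet> ?v = 0" using m T by blast
    then have "?v \<bullet> ?v = 0" using v by (simp add: inner_diff_left)
    then have mn: "m = (n \<bullet> m) *\<^sub>R n" by simp
    then have "\<bar>n \<bullet> m\<bar> = 1" using m n(1) by (metis mult_cancel_left1 norm_scaleR mult.right_neutral)
    moreover have "n \<bullet> m \<noteq> - 1"
    proof
      assume a: "n \<bullet> m = - 1"
      obtain e1 where e1: "e1 > 0" "\<forall>s\<in>{0<..<e1}. x0 + s *\<^sub>R m \<in> \<Omega>" using m by blast
      obtain e2 where e2: "e2 > 0" "\<forall>s. 0 < s \<longrightarrow> s < e2 \<longrightarrow> x0 + s *\<^sub>R m \<notin> \<Omega>" using n(3)[of m] a by auto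
      obtain s where "0 < s" "s < min e1 e2" using dense[of 0 "min e1 e2"] e1 e2 by auto
      then show False using e1 e2 by auto
    qed
    ultimately have "n \<bullet> m = 1" by linarith
    then show "m = n" using mn by simp
  qed
  then show "norm \<nu> = 1" "tangent_space (frontier \<Omega>) x0 = {v. \<nu> \<bullet> v = 0}"
    "\<And>w. 0 < \<nu> \<bullet> w \<Longrightarrow> \<exists>e>0. \<forall>s. 0 < s \<longrightarrow> s < e \<longrightarrow> x0 + s *\<^sub>R w \<in> \<Omega>"
    using n(1,2) T by simp_all
qed

lemma halfspace_frontier:
  assumes "x0 \<in> frontier \<Omega>" shows "halfspace_at (closure \<Omega>) x0 (inward_normal \<Omega> x0)"
  unfolding halfspace_at_def
proof (intro conjI allI impI)
  show "inward_normal \<Omega> x0 \<noteq> 0" using inward_normal(1)[OF assms] by auto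
  show "x0 \<in> closure \<Omega>" by (rule frontier_closure[OF assms])
  show "\<exists>e>0. \<forall>s. 0 < s \<longrightarrow> s < e \<longrightarrow> x0 + s *\<^sub>R w \<in> closure \<Omega>" if "0 < inward_normal \<Omega> x0 \<bullet> w" for w
    using inward_normal(3)[OF assms that] dom_closure by meson
qed

lemma solid_closure: "solid (closure \<Omega>)"
  unfolding solid_def
  using closure_cases halfspace_frontier halfspace_at_mono[OF halfspace_at_open[OF open_dom] closure_subset] by blast

end

section \<open>The distance function and the intrinsic boundary Hessian\<close>

context c4_domain begin

definition "gd = grad_on (closure \<Omega>) (bdist \<Omega>)"
definition "Hd = hess_on (closure \<Omega>) (bdist \<Omega>)"

lemma r_pos: "0 < r" and C_d: "C_k_on 4 (collar \<Omega> r) (bdist \<Omega>)"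
  using reg by (auto simp: regular_collar_def)

lemma collar_closure: "x \<in> collar \<Omega> r \<Longrightarrow> x \<in> closure \<Omega>" by (simp add: collar_def)

lemma bdist_nonneg: "0 \<le> bdist \<Omega> x" by (simp add: bdist_def infdist_nonneg)
lemma bdist_frontier: "x \<in> frontier \<Omega> \<Longrightarrow> bdist \<Omega> x = 0" by (simp add: bdist_def)
lemma bdist_le: "z \<in> frontier \<Omega> \<Longrightarrow> bdist \<Omega> x \<le> dist x z" by (simp add: bdist_def infdist_le)
lemma bdist_lipschitz: "bdist \<Omega> x \<le> bdist \<Omega> y + dist x y" by (simp add: bdist_def infdist_triangle)

lemma frontier_collar: "x \<in> frontier \<Omega> \<Longrightarrow> x \<in> collar \<Omega> r"
  using r_pos by (simp add: collar_def bdist_frontier frontier_closure)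

lemma open_bdist_less: "open {x. bdist \<Omega> x < q}"
  unfolding bdist_def by (intro open_Collect_less continuous_intros)

lemma at_collar: "x \<in> collar \<Omega> r \<Longrightarrow> at x within collar \<Omega> r = at x within closure \<Omega>"
  by (rule at_within_nhd[OF _ open_bdist_less[of r]]) (auto simp: collar_def)

lemma halfspace_collar:
  assumes x: "x \<in> collar \<Omega> r" and h: "halfspace_at (closure \<Omega>) x n"
  shows "halfspace_at (collar \<Omega> r) x n"
  unfolding halfspace_at_def
proof (intro conjI allI impI)
  show "n \<noteq> 0" "x \<in> collar \<Omega> r" using x h by (auto simp: halfspace_at_def)
  fix w assume "0 < n \<bullet> w"
  then obtain e where e: "e > 0" "\<And>s. 0 < s \<Longrightarrow> s < e \<Longrightarrow> x + s *\<^sub>R w \<in> closure \<Omega>"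
    using h unfolding halfspace_at_def by blast
  have k: "norm w + 1 > 0" by (simp add: add_nonneg_pos)
  define q where "q = (r - bdist \<Omega> x) / (norm w + 1)"
  have q: "q > 0" using x k by (simp add: q_def collar_def)
  have "x + s *\<^sub>R w \<in> collar \<Omega> r" if s: "0 < s" "s < min e q" for s
  proof -
    have "s * (norm w + 1) < r - bdist \<Omega> x" using s k by (simp add: q_def pos_less_divide_eq)
    then have "bdist \<Omega> x + s * norm w < r" using s by (simp add: distrib_left)
    moreover have "bdist \<Omega> (x + s *\<^sub>R w) \<le> bdist \<Omega> x + s * norm w"
      using bdist_lipschitz[of "x + s *\<^sub>R w" x] s by (simp add: dist_norm)
    ultimately show ?thesis using e(2)[of s] s by (simp add: collar_def)
  qed
  then show "\<exists>e>0. \<forall>s. 0 < s \<longrightarrow> s < e \<longrightarrow> x + s *\<^sub>R w \<in> collar \<Omega> r"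
    using e(1) q by (intro exI[of _ "min e q"]) auto
qed

lemma solid_collar: "solid (collar \<Omega> r)"
  unfolding solid_def
proof
  fix x assume x: "x \<in> collar \<Omega> r"
  obtain n where "halfspace_at (closure \<Omega>) x n"
    using solid_closure collar_closure[OF x] unfolding solid_def by blast
  then show "\<exists>n. halfspace_at (collar \<Omega> r) x n" using halfspace_collar[OF x] by blast
qed

text \<open>The collar is relatively open in the closure, so derivatives within either set agree
  there. Regularity known on the collar is thus available for the derivatives within the closure
  that occur in the jets.\<close>

lemma collar_C2:
  assumes f: "C_k_on (Suc (Suc k)) (collar \<Omega> r) f"
  shows "\<And>x. x \<in> collar \<Omega> r \<Longrightarrow> (f has_derivative (\<lambda>h. grad_on (closure \<Omega>) f x \<bullet> h)) (at x within closure \<Omega>)"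
    and "\<And>x. x \<in> collar \<Omega> r \<Longrightarrow> (grad_on (closure \<Omega>) f has_derivative (\<lambda>h. hess_on (closure \<Omega>) f x *v h)) (at x within closure \<Omega>)"
    and "\<And>i. C_k_on (Suc k) (collar \<Omega> r) (\<lambda>x. grad_on (closure \<Omega>) f x $ i)"
    and "\<And>i j. C_k_on k (collar \<Omega> r) (\<lambda>x. hess_on (closure \<Omega>) f x $ i $ j)"
    and "\<And>x i. x \<in> collar \<Omega> r \<Longrightarrow> grad_on (closure \<Omega>) (\<lambda>x. grad_on (closure \<Omega>) f x $ i) x = hess_on (closure \<Omega>) f x $ i"
proof -
  note C = C2_solid[OF solid_collar f]
  have ge: "grad_on (closure \<Omega>) f x = grad_on (collar \<Omega> r) f x" if "x \<in> collar \<Omega> r" for x f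
    unfolding grad_on_def at_collar[OF that] ..
  have D: "(grad_on (collar \<Omega> r) f has_derivative (\<lambda>h. hess_on (collar \<Omega> r) f x *v h)) (at x within closure \<Omega>)"
    if "x \<in> collar \<Omega> r" for x using C(2)[OF that] at_collar[OF that] by simp
  have ev: "\<forall>\<^sub>F y in nhds x. y \<in> closure \<Omega> \<longrightarrow> grad_on (closure \<Omega>) f y = grad_on (collar \<Omega> r) f y"
    if x: "x \<in> collar \<Omega> r" for x
  proof -
    have "\<forall>\<^sub>F y in nhds x. y \<in> {y. bdist \<Omega> y < r}"
      using x by (intro eventually_nhds_in_open open_bdist_less) (auto simp: collar_def)
    then show ?thesis
    proof eventually_elim
      case (elim y)
      have "y \<in> closure \<Omega> \<Longrightarrow> y \<in> collar \<Omega> r" using elim by (simp add: collar_def)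
      then show ?case using ge by blast
    qed
  qed
  have He: "hess_on (closure \<Omega>) f x = hess_on (collar \<Omega> r) f x" if x: "x \<in> collar \<Omega> r" for x
  proof -
    obtain n where n: "halfspace_at (closure \<Omega>) x n"
      using solid_closure collar_closure[OF x] unfolding solid_def by blast
    show ?thesis by (rule hess_on_eq[OF n D[OF x] ev[OF x]])
  qed
  show "(f has_derivative (\<lambda>h. grad_on (closure \<Omega>) f x \<bullet> h)) (at x within closure \<Omega>)" if "x \<in> collar \<Omega> r" for x
    using C(1)[OF that] at_collar[OF that] by (simp add: ge that)
  show 2: "(grad_on (closure \<Omega>) f has_derivative (\<lambda>h. hess_on (closure \<Omega>) f x *v h)) (at x within closure \<Omega>)"
    if x: "x \<in> collar \<Omega> r" for x
    unfolding He[OF x] at_collar[OF x, symmetric]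
    by (rule has_derivative_transform[OF x _ C(2)[OF x]]) (simp add: ge)
  show "C_k_on (Suc k) (collar \<Omega> r) (\<lambda>x. grad_on (closure \<Omega>) f x $ i)" for i
    by (rule C_k_on_cong[OF _ C(3)[of i]]) (simp add: ge)
  show "C_k_on k (collar \<Omega> r) (\<lambda>x. hess_on (closure \<Omega>) f x $ i $ j)" for i j
    by (rule C_k_on_cong[OF _ C(4)[of i j]]) (simp add: He)
  show "grad_on (closure \<Omega>) (\<lambda>x. grad_on (closure \<Omega>) f x $ i) x = hess_on (closure \<Omega>) f x $ i"
    if x: "x \<in> collar \<Omega> r" for x i
  proof -
    obtain n where n: "halfspace_at (closure \<Omega>) x n"
      using solid_closure collar_closure[OF x] unfolding solid_def by blast
    have "((\<lambda>x. grad_on (closure \<Omega>) f x $ i) has_derivative (\<lambda>h. hess_on (closure \<Omega>) f x $ i \<bullet> h)) (at x within closure \<Omega>)"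
      using has_derivative_nth[OF 2[OF x], of i] by (simp add: matrix_vector_mult_def inner_vec_def)
    then show ?thesis by (rule grad_on_eq[OF n])
  qed
qed

lemma four_eq: "(4::nat) = Suc (Suc 2)" "(3::nat) = Suc (Suc 1)" "(3::nat) = Suc (Suc (Suc 0))" "(2::nat) = Suc (Suc 0)"
  by simp_all

lemma d_grad: "x \<in> collar \<Omega> r \<Longrightarrow> (bdist \<Omega> has_derivative (\<lambda>h. gd x \<bullet> h)) (at x within closure \<Omega>)"
  using collar_C2(1)[OF C_d[unfolded four_eq(1)]] by (simp add: gd_def)
lemma d_hess: "x \<in> collar \<Omega> r \<Longrightarrow> (gd has_derivative (\<lambda>h. Hd x *v h)) (at x within closure \<Omega>)"
  using collar_C2(2)[OF C_d[unfolded four_eq(1)]] by (simp add: gd_def Hd_def)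

lemma at_dom: "x \<in> \<Omega> \<Longrightarrow> at x within closure \<Omega> = at x"
  using open_dom by (intro at_within_interior) (metis closure_subset interior_mono interior_open subsetD)

text \<open>The open ball reaching to the nearest boundary point is connected and misses the
  frontier, so it stays in \<Omega>.\<close>

lemma nearest_point:
  assumes x: "x \<in> \<Omega>"
  obtains z where "z \<in> frontier \<Omega>" "dist x z = bdist \<Omega> x" "0 < dist x z" "ball x (dist x z) \<subseteq> \<Omega>"
proof -
  obtain z where z: "z \<in> frontier \<Omega>" "infdist x (frontier \<Omega>) = dist x z"
    using infdist_attains_inf[OF frontier_closed frontier_nonempty] by metis
  have "x \<noteq> z" using frontier_notin[OF z(1)] x by auto
  then have pos: "0 < dist x z" by simp
  have "ball x (dist x z) \<subseteq> \<Omega>"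
  proof (rule ccontr)
    assume "\<not> ball x (dist x z) \<subseteq> \<Omega>"
    then have "ball x (dist x z) - \<Omega> \<noteq> {}" by blast
    moreover have "ball x (dist x z) \<inter> \<Omega> \<noteq> {}"
      using x pos centre_in_ball[of x "dist x z"] by blast
    ultimately have "ball x (dist x z) \<inter> frontier \<Omega> \<noteq> {}"
      using connected_Int_frontier[OF connected_ball] by blast
    then obtain y where "y \<in> frontier \<Omega>" "dist x y < dist x z" by auto
    then show False using infdist_le[of y "frontier \<Omega>" x] z(2) by linarith
  qed
  then show ?thesis using that[of z] z pos by (simp add: bdist_def)
qed

text \<open>The distance is 1-Lipschitz, which gives the upper bound when tested along the gradient
  itself; towards a nearest boundary point it decreases at unit speed, which gives the lower
  one.\<close>

lemma norm_gd_dom: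
  assumes x: "x \<in> \<Omega>" "x \<in> collar \<Omega> r" shows "norm (gd x) = 1"
proof (rule antisym)
  note D = d_grad[OF x(2), unfolded at_dom[OF x(1)]]
  have ray: "((\<lambda>s. bdist \<Omega> (x + s *\<^sub>R w)) has_vector_derivative gd x \<bullet> w) (at 0 within {0..<e})" if "0 < e" for w e
    by (rule ray_derivative[OF D that]) simp
  have "gd x \<bullet> gd x \<le> norm (gd x)"
  proof (rule slope_le[OF zero_less_one ray[OF zero_less_one]])
    fix s :: real assume "0 < s"
    then show "bdist \<Omega> (x + s *\<^sub>R gd x) \<le> bdist \<Omega> (x + 0 *\<^sub>R gd x) + norm (gd x) * s"
      using bdist_lipschitz[of "x + s *\<^sub>R gd x" x] by (simp add: dist_norm mult.commute)
  qed
  then have "norm (gd x) * norm (gd x) \<le> norm (gd x) * 1" by (simp add: dot_square_norm power2_eq_square)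
  then show "norm (gd x) \<le> 1" by (cases "gd x = 0") auto
  obtain z where z: "z \<in> frontier \<Omega>" "dist x z = bdist \<Omega> x" "0 < dist x z" using nearest_point[OF x(1)] by metis
  define e where "e = (1 / dist x z) *\<^sub>R (z - x)"
  have ne: "norm e = 1" using z(3) by (simp add: e_def dist_norm norm_minus_commute)
  have ze: "z = x + dist x z *\<^sub>R e" using z(3) by (simp add: e_def)
  have "gd x \<bullet> e \<le> - 1"
  proof (rule slope_le[OF z(3) ray[OF z(3)]])
    fix s assume s: "0 < s" "s < dist x z"
    have "x + s *\<^sub>R e - z = (s - dist x z) *\<^sub>R e" by (subst ze) (simp add: algebra_simps)
    then have "dist (x + s *\<^sub>R e) z = dist x z - s" using s ne by (simp add: dist_norm)
    then show "bdist \<Omega> (x + s *\<^sub>R e) \<le> bdist \<Omega> (x + 0 *\<^sub>R e) + - 1 * s"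
      using bdist_le[OF z(1), of "x + s *\<^sub>R e"] z(2) by simp
  qed
  moreover have "\<bar>gd x \<bullet> e\<bar> \<le> norm (gd x)" using Cauchy_Schwarz_ineq2[of "gd x" e] ne by simp
  ultimately show "1 \<le> norm (gd x)" by linarith
qed

text \<open>The unit length passes to the boundary by continuity along the normal ray, tangential
  derivatives vanish since the distance is zero on the frontier, and nonnegativity of the distance
  fixes the sign.\<close>

lemma gd_frontier:
  assumes x0: "x0 \<in> frontier \<Omega>" shows "gd x0 = inward_normal \<Omega> x0"
proof -
  let ?\<nu> = "inward_normal \<Omega> x0"
  note N = inward_normal[OF x0] and xc = frontier_collar[OF x0]
  have nn: "?\<nu> \<bullet> ?\<nu> = 1" using N(1) by (simp add: norm_eq_1)
  obtain e0 where e0: "e0 > 0" "\<And>s. 0 < s \<Longrightarrow> s < e0 \<Longrightarrow> x0 + s *\<^sub>R ?\<nu> \<in> \<Omega>" using N(3)[of ?\<nu>] nn by auto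
  define e where "e = min e0 r"
  have e: "e > 0" using e0 r_pos by (simp add: e_def)
  have inO: "x0 + s *\<^sub>R ?\<nu> \<in> \<Omega>" "x0 + s *\<^sub>R ?\<nu> \<in> collar \<Omega> r" if s: "0 < s" "s < e" for s
  proof -
    show 1: "x0 + s *\<^sub>R ?\<nu> \<in> \<Omega>" using e0(2)[of s] s by (simp add: e_def)
    show "x0 + s *\<^sub>R ?\<nu> \<in> collar \<Omega> r"
      using bdist_le[OF x0, of "x0 + s *\<^sub>R ?\<nu>"] s N(1) dom_closure[OF 1] by (simp add: collar_def dist_norm e_def)
  qed
  have cl: "x0 + s *\<^sub>R ?\<nu> \<in> closure \<Omega>" if "0 \<le> s" "s < e" for s
    using inO(1)[of s] dom_closure that frontier_closure[OF x0] by (cases "s = 0") auto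
  have n1: "norm (gd x0) = 1"
  proof -
    have "((\<lambda>s. gd (x0 + s *\<^sub>R ?\<nu>)) has_vector_derivative Hd x0 *v ?\<nu>) (at 0 within {0..<e})"
      by (rule ray_derivative[OF d_hess[OF xc] e cl])
    then have "continuous (at 0 within {0..<e}) (\<lambda>s. gd (x0 + s *\<^sub>R ?\<nu>))" by (rule has_vector_derivative_continuous)
    then have "((\<lambda>s. norm (gd (x0 + s *\<^sub>R ?\<nu>))) \<longlongrightarrow> norm (gd x0)) (at 0 within {0..<e})"
      by (auto simp: continuous_within intro!: tendsto_norm)
    moreover have "((\<lambda>s. norm (gd (x0 + s *\<^sub>R ?\<nu>))) \<longlongrightarrow> 1) (at 0 within {0..<e})"
    proof (rule tendsto_eventually)
      show "\<forall>\<^sub>F s in at 0 within {0..<e}. norm (gd (x0 + s *\<^sub>R ?\<nu>)) = 1"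
        unfolding eventually_at_filter
        by (intro always_eventually allI impI norm_gd_dom inO) auto
    qed
    moreover have "at 0 within {0..<e} \<noteq> bot"
    proof -
      have "0 islimpt {0<..<e}" using e by (simp add: islimpt_greaterThanLessThan1)
      then have "0 islimpt {0..<e}" by (rule islimpt_subset) auto
      then show ?thesis using trivial_limit_within by blast
    qed
    ultimately show ?thesis using tendsto_unique by blast
  qed
  have tang: "gd x0 \<bullet> v = 0" if v: "?\<nu> \<bullet> v = 0" for v
  proof -
    obtain c where c: "c 0 = x0" "range c \<subseteq> frontier \<Omega>" "(c has_vector_derivative v) (at (0::real))"
      using v N(2) unfolding tangent_space_def by blast
    have "((\<lambda>s. bdist \<Omega> (c s)) has_vector_derivative gd x0 \<bullet> v) (at 0)"
      by (rule curve_derivative[where S = "closure \<Omega>"]) (use c d_grad[OF xc] frontier_closure in auto)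
    moreover have "(\<lambda>s. bdist \<Omega> (c s)) = (\<lambda>s. 0)" using c(2) bdist_frontier by auto
    ultimately have "((\<lambda>s. 0) has_vector_derivative gd x0 \<bullet> v) (at (0::real))" by simp
    then show ?thesis using vector_derivative_unique_at[OF _ has_vector_derivative_const] by blast
  qed
  have "- (gd x0 \<bullet> ?\<nu>) \<le> 0"
  proof (rule slope_le[OF e])
    show "((\<lambda>s. - bdist \<Omega> (x0 + s *\<^sub>R ?\<nu>)) has_vector_derivative - (gd x0 \<bullet> ?\<nu>)) (at 0 within {0..<e})"
      by (intro has_vector_derivative_minus ray_derivative[OF d_grad[OF xc] e cl])
    show "- bdist \<Omega> (x0 + s *\<^sub>R ?\<nu>) \<le> - bdist \<Omega> (x0 + 0 *\<^sub>R ?\<nu>) + 0 * s" for s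
      using bdist_nonneg bdist_frontier[OF x0] by simp
  qed
  moreover have g: "gd x0 = (gd x0 \<bullet> ?\<nu>) *\<^sub>R ?\<nu>"
  proof -
    let ?v = "gd x0 - (gd x0 \<bullet> ?\<nu>) *\<^sub>R ?\<nu>"
    have v: "?\<nu> \<bullet> ?v = 0" using nn by (simp add: inner_diff_right inner_commute)
    then have "?v \<bullet> ?v = 0" using tang[OF v] by (simp add: inner_diff_left)
    then show ?thesis by simp
  qed
  moreover have "norm (gd x0) = \<bar>gd x0 \<bullet> ?\<nu>\<bar>"
    using arg_cong[OF g, of norm] N(1) by simp
  ultimately have "gd x0 \<bullet> ?\<nu> = 1" using n1 by linarith
  then show ?thesis using g by simp
qed

lemma norm_gd: "x \<in> collar \<Omega> r \<Longrightarrow> norm (gd x) = 1"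
  using closure_cases[OF collar_closure] norm_gd_dom gd_frontier inward_normal(1) by metis

text \<open>The mean value inequality on the closed ball about x that touches the frontier at a
  nearest point. This ball is convex and contained in the closure, whatever the shape of
  \<Omega>.\<close>

lemma vanishing_le_bdist:
  assumes f: "\<And>x. x \<in> closure \<Omega> \<Longrightarrow> (f has_derivative (\<lambda>h. g x \<bullet> h)) (at x within closure \<Omega>)"
    and C: "\<And>x. x \<in> closure \<Omega> \<Longrightarrow> norm (g x) \<le> C"
    and z0: "\<And>x. x \<in> frontier \<Omega> \<Longrightarrow> f x = (0::real)" and x: "x \<in> closure \<Omega>"
  shows "\<bar>f x\<bar> \<le> C * bdist \<Omega> x"
proof (cases "x \<in> \<Omega>")
  case False
  then have "x \<in> frontier \<Omega>" using closure_cases x by blast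
  then show ?thesis using z0 bdist_frontier by simp
next
  case True
  obtain z where z: "z \<in> frontier \<Omega>" "dist x z = bdist \<Omega> x" "0 < dist x z" "ball x (dist x z) \<subseteq> \<Omega>"
    using nearest_point[OF True] by metis
  have sub: "cball x (dist x z) \<subseteq> closure \<Omega>" using z(3) closure_mono[OF z(4)] by simp
  have "norm (f x - f z) \<le> C * norm (x - z)"
  proof (rule differentiable_bound[of "cball x (dist x z)" f "\<lambda>x h. g x \<bullet> h"])
    fix y assume y: "y \<in> cball x (dist x z)"
    show "(f has_derivative (\<lambda>h. g y \<bullet> h)) (at y within cball x (dist x z))"
      by (rule has_derivative_subset[OF f sub]) (use y sub in blast)
    show "onorm (\<lambda>h. g y \<bullet> h) \<le> C"
    proof (rule onorm_le)
      fix h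
      have "\<bar>g y \<bullet> h\<bar> \<le> norm (g y) * norm h" by (rule Cauchy_Schwarz_ineq2)
      also have "\<dots> \<le> C * norm h" using y sub by (intro mult_right_mono C) auto
      finally show "norm (g y \<bullet> h) \<le> C * norm h" by simp
    qed
  qed (use z in auto)
  then show ?thesis using z z0[OF z(1)] by (simp add: dist_norm)
qed

section \<open>Derivatives along the boundary hypersurface\<close>

lemma tangent_unique:
  assumes v: "v \<in> tangent_space (frontier \<Omega>) x0"
    and D1: "(f has_derivative D1) (at x0 within frontier \<Omega>)" and D2: "(f has_derivative D2) (at x0 within frontier \<Omega>)"
  shows "D1 v = D2 v"
proof -
  obtain c where c: "c 0 = x0" "range c \<subseteq> frontier \<Omega>" "(c has_vector_derivative v) (at (0::real))"
    using v unfolding tangent_space_def by blast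
  have "((\<lambda>s. f (c s)) has_vector_derivative D1 v) (at 0)" "((\<lambda>s. f (c s)) has_vector_derivative D2 v) (at 0)"
    using curve_derivative[of f D1 c "frontier \<Omega>"] curve_derivative[of f D2 c "frontier \<Omega>"] c D1 D2 by auto
  then show ?thesis by (rule vector_derivative_unique_at)
qed

lemma within_frontier: "(f has_derivative D) (at x within closure \<Omega>) \<Longrightarrow> (f has_derivative D) (at x within frontier \<Omega>)"
  by (rule has_derivative_subset) (auto simp: frontier_def)

text \<open>Subtracting (g . Dd) times the distance leaves f unchanged on the frontier and removes
  the normal part of its gradient.\<close>

lemma tangential_grad_eq:
  assumes x0: "x0 \<in> frontier \<Omega>" and f: "(f has_derivative (\<lambda>h. g \<bullet> h)) (at x0 within closure \<Omega>)"
  shows "tangential_grad (frontier \<Omega>) f x0 = g - (g \<bullet> gd x0) *\<^sub>R gd x0"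
  unfolding tangential_grad_def
proof (rule the_equality)
  note N = inward_normal[OF x0, folded gd_frontier[OF x0]]
  have nn: "gd x0 \<bullet> gd x0 = 1" using N(1) by (simp add: norm_eq_1)
  let ?q = "g - (g \<bullet> gd x0) *\<^sub>R gd x0"
  have q: "?q \<in> tangent_space (frontier \<Omega>) x0" unfolding N(2) using nn by (simp add: inner_diff_right inner_commute)
  note xc = frontier_collar[OF x0]
  have d0: "(bdist \<Omega> has_derivative (\<lambda>h. 0)) (at x0 within frontier \<Omega>)"
    by (rule has_derivative_transform[OF x0, of _ "\<lambda>_. 0"]) (auto simp: bdist_frontier)
  have "((\<lambda>x. f x - (g \<bullet> gd x0) * bdist \<Omega> x) has_derivative (\<lambda>h. g \<bullet> h - (g \<bullet> gd x0) * (gd x0 \<bullet> h))) (at x0 within frontier \<Omega>)"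
    by (intro has_derivative_diff has_derivative_mult_right within_frontier f d_grad xc)
  then have "((\<lambda>x. f x - (g \<bullet> gd x0) * bdist \<Omega> x) has_derivative (\<lambda>h. ?q \<bullet> h)) (at x0 within frontier \<Omega>)"
    by (simp add: inner_diff_left)
  then have qd: "(f has_derivative (\<lambda>h. ?q \<bullet> h)) (at x0 within frontier \<Omega>)"
    by (rule has_derivative_transform[OF x0, rotated]) (simp add: bdist_frontier)
  with q show "?q \<in> tangent_space (frontier \<Omega>) x0 \<and> (f has_derivative (\<lambda>h. ?q \<bullet> h)) (at x0 within frontier \<Omega>)" by blast
  fix p assume p: "p \<in> tangent_space (frontier \<Omega>) x0 \<and> (f has_derivative (\<lambda>h. p \<bullet> h)) (at x0 within frontier \<Omega>)"
  have "p - ?q \<in> tangent_space (frontier \<Omega>) x0" using p q unfolding N(2) by (simp add: inner_diff_right)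
  from tangent_unique[OF this, of f "\<lambda>h. p \<bullet> h" "\<lambda>h. ?q \<bullet> h"] p qd
  have "p \<bullet> (p - ?q) = ?q \<bullet> (p - ?q)" by blast
  then have "(p - ?q) \<bullet> (p - ?q) = 0" by (simp only: inner_diff_left[of p ?q])
  then show "p = ?q" by simp
qed

lemma tangential_grad_cong:
  assumes "\<And>x. x \<in> frontier \<Omega> \<Longrightarrow> f x = h x" "x0 \<in> frontier \<Omega>"
  shows "tangential_grad (frontier \<Omega>) f x0 = tangential_grad (frontier \<Omega>) h x0"
proof -
  have "(f has_derivative D) (at x0 within frontier \<Omega>) = (h has_derivative D) (at x0 within frontier \<Omega>)" for D
    using has_derivative_transform[OF assms(2), of f h D] has_derivative_transform[OF assms(2), of h f D] assms(1)
    by fastforce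
  then show ?thesis by (simp add: tangential_grad_def)
qed

text \<open>\<open>gd\<close> agrees with the inward normal on the frontier and is differentiable
  within the closure, so its derivative can be used in tangential directions.\<close>

lemma second_ff_eq:
  assumes x0: "x0 \<in> frontier \<Omega>" and v: "v \<in> tangent_space (frontier \<Omega>) x0"
  shows "second_ff \<Omega> x0 v w = - ((Hd x0 *v v) \<bullet> w)"
proof -
  have D: "(inward_normal \<Omega> has_derivative (\<lambda>h. Hd x0 *v h)) (at x0 within frontier \<Omega>)"
    by (rule has_derivative_transform[OF x0 _ within_frontier[OF d_hess[OF frontier_collar[OF x0]]]])
      (simp add: gd_frontier)
  then have "(inward_normal \<Omega> has_derivative frechet_derivative (inward_normal \<Omega>) (at x0 within frontier \<Omega>)) (at x0 within frontier \<Omega>)"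
    using frechet_derivative_works differentiableI by blast
  from tangent_unique[OF v this D] show ?thesis by (simp add: second_ff_def)
qed

lemma boundary_hess_eq:
  assumes x0: "x0 \<in> frontier \<Omega>" and v: "v \<in> tangent_space (frontier \<Omega>) x0" and w: "w \<in> tangent_space (frontier \<Omega>) x0"
    and g: "\<And>x. x \<in> frontier \<Omega> \<Longrightarrow> (f has_derivative (\<lambda>h. g x \<bullet> h)) (at x within closure \<Omega>)"
    and H: "(g has_derivative (\<lambda>h. H *v h)) (at x0 within closure \<Omega>)"
  shows "boundary_hess (frontier \<Omega>) f x0 v w = (H *v v) \<bullet> w - (g x0 \<bullet> gd x0) * ((Hd x0 *v v) \<bullet> w)"
proof -
  let ?tg = "tangential_grad (frontier \<Omega>) f"
  note xc = frontier_collar[OF x0] and N = inward_normal[OF x0, folded gd_frontier[OF x0]]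
  note wf = within_frontier
  have "((\<lambda>x. g x - (g x \<bullet> gd x) *\<^sub>R gd x) has_derivative
      (\<lambda>h. H *v h - ((g x0 \<bullet> gd x0) *\<^sub>R (Hd x0 *v h) + (g x0 \<bullet> (Hd x0 *v h) + (H *v h) \<bullet> gd x0) *\<^sub>R gd x0)))
      (at x0 within frontier \<Omega>)"
    by (intro has_derivative_diff has_derivative_scaleR has_derivative_inner wf H d_hess xc)
  then have D: "(?tg has_derivative
      (\<lambda>h. H *v h - ((g x0 \<bullet> gd x0) *\<^sub>R (Hd x0 *v h) + (g x0 \<bullet> (Hd x0 *v h) + (H *v h) \<bullet> gd x0) *\<^sub>R gd x0)))
      (at x0 within frontier \<Omega>)"
    by (rule has_derivative_transform[OF x0, rotated]) (simp add: tangential_grad_eq[OF _ g])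
  then have "(?tg has_derivative frechet_derivative ?tg (at x0 within frontier \<Omega>)) (at x0 within frontier \<Omega>)"
    using frechet_derivative_works differentiableI by blast
  from tangent_unique[OF v this D] show ?thesis
    using w unfolding N(2) by (simp add: boundary_hess_def inner_diff_left inner_add_left)
qed

text \<open>For any extension f of the boundary values, the form differs from the tangential block
  of its Hessian by (s minus the normal derivative of f) times the Hessian of the distance. It is
  applied to the solution and to \<open>ub\<close>.\<close>

lemma M_form_eq:
  assumes x0: "x0 \<in> frontier \<Omega>" and v: "v \<in> tangent_space (frontier \<Omega>) x0" and w: "w \<in> tangent_space (frontier \<Omega>) x0"
    and g: "\<And>x. x \<in> frontier \<Omega> \<Longrightarrow> (f has_derivative (\<lambda>h. g x \<bullet> h)) (at x within closure \<Omega>)"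
    and H: "(g has_derivative (\<lambda>h. H *v h)) (at x0 within closure \<Omega>)"
    and f: "\<And>x. x \<in> frontier \<Omega> \<Longrightarrow> f x = \<phi> x"
  shows "M_form \<Omega> \<phi> x0 s v w = (H *v v) \<bullet> w + (s - g x0 \<bullet> gd x0) * ((Hd x0 *v v) \<bullet> w)"
proof -
  let ?S = "frontier \<Omega>"
  note D = boundary_hess_eq[OF x0 v w g H]
  have tg: "tangential_grad ?S f x = tangential_grad ?S \<phi> x" if "x \<in> ?S" for x
    by (rule tangential_grad_cong[OF f that])
  have "(tangential_grad ?S f has_derivative D) (at x0 within ?S) = (tangential_grad ?S \<phi> has_derivative D) (at x0 within ?S)" for D
    using has_derivative_transform[OF x0, of "tangential_grad ?S f" "tangential_grad ?S \<phi>" D]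
      has_derivative_transform[OF x0, of "tangential_grad ?S \<phi>" "tangential_grad ?S f" D] tg by fastforce
  then have "boundary_hess ?S f x0 v w = boundary_hess ?S \<phi> x0 v w"
    by (simp add: boundary_hess_def frechet_derivative_def)
  then show ?thesis using D by (simp add: M_form_def second_ff_eq[OF x0 v] algebra_simps)
qed

end

section \<open>The double normal derivative\<close>

lemma arctan_le_self_nonneg: "0 \<le> x \<Longrightarrow> arctan x \<le> x"
proof -
  assume x: "0 \<le> x"
  have "(\<lambda>x. x - arctan x) 0 \<le> (\<lambda>x. x - arctan x) x"
  proof (rule DERIV_nonneg_imp_nondecreasing[OF x])
    fix y :: real
    have "((\<lambda>x. x - arctan x) has_real_derivative 1 - inverse (1 + y\<^sup>2)) (at y)"
      by (intro DERIV_diff DERIV_ident DERIV_arctan)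
    moreover have "inverse (1 + y\<^sup>2) \<le> 1" by (rule inverse_le_1_iff[THEN iffD2]) simp
    ultimately show "\<exists>z. ((\<lambda>x. x - arctan x) has_real_derivative z) (at y) \<and> 0 \<le> z" by force
  qed
  then show ?thesis by simp
qed

lemma arctan_ge_pi_half: "0 < x \<Longrightarrow> pi / 2 - 1 / x \<le> arctan x"
  using arctan_inverse[of x] arctan_le_self_nonneg[of "1 / x"] by (simp add: inverse_eq_divide)

lemma arctan_diff_ge: "0 \<le> e \<Longrightarrow> arctan x - e \<le> arctan (x - e)"
proof -
  assume e: "0 \<le> e"
  have "(\<lambda>y. y - arctan y) (x - e) \<le> (\<lambda>y. y - arctan y) x"
  proof (rule DERIV_nonneg_imp_nondecreasing[where f = "\<lambda>y. y - arctan y"])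
    fix y :: real
    have "((\<lambda>x. x - arctan x) has_real_derivative 1 - inverse (1 + y\<^sup>2)) (at y)"
      by (intro DERIV_diff DERIV_ident DERIV_arctan)
    moreover have "inverse (1 + y\<^sup>2) \<le> 1" by (rule inverse_le_1_iff[THEN iffD2]) simp
    ultimately show "\<exists>z. ((\<lambda>x. x - arctan x) has_real_derivative z) (at y) \<and> 0 \<le> z" by force
  qed (use e in simp)
  then show ?thesis by simp
qed

text \<open>Equivalent to sin s <= s (sin s + cos s). For s > 1 this is immediate; for s <= 1 the
  difference of the sides vanishes at 0 and has derivative (1 - y) sin y + y cos y >= 0.\<close>

lemma inverse_le_one_plus_cot:
  assumes s: "0 < s" "s < pi / 2" shows "1 / s \<le> 1 + cot s"
proof -
  have sp: "0 < sin s" "0 < cos s" using s by (auto simp: sin_gt_zero cos_gt_zero)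
  have "sin s \<le> s * (sin s + cos s)"
  proof (cases "s \<le> 1")
    case True
    have "(\<lambda>x. x * (sin x + cos x) - sin x) 0 \<le> (\<lambda>x. x * (sin x + cos x) - sin x) s"
    proof (rule DERIV_nonneg_imp_nondecreasing[where f = "\<lambda>x. x * (sin x + cos x) - sin x"])
      fix y assume y: "0 \<le> y" "y \<le> s"
      have "((\<lambda>x. x * (sin x + cos x) - sin x) has_real_derivative sin y * (1 - y) + y * cos y) (at y)"
        by (auto intro!: derivative_eq_intros simp: algebra_simps)
      moreover have "0 \<le> sin y * (1 - y) + y * cos y"
        using y s True by (intro add_nonneg_nonneg mult_nonneg_nonneg sin_ge_zero cos_ge_zero) auto
      ultimately show "\<exists>z. ((\<lambda>x. x * (sin x + cos x) - sin x) has_real_derivative z) (at y) \<and> 0 \<le> z" by blast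
    qed (use s in simp)
    then show ?thesis by simp
  next
    case False
    then have "1 * sin s \<le> s * sin s" using sp by (intro mult_right_mono) auto
    moreover have "0 \<le> s * cos s" using s sp by simp
    ultimately show ?thesis by (simp add: distrib_left)
  qed
  then have "sin s / (s * sin s) \<le> s * (sin s + cos s) / (s * sin s)"
    using s sp by (intro divide_right_mono) auto
  then show ?thesis using s sp by (simp add: cot_def add_divide_distrib)
qed

lemma Rm_Rm: "Rm p *v (Rm p *v v) = Pm p *v v"
  using Pm_Sm[of p "Rm p *v v"] by (simp add: Sm_Rm)

text \<open>The inverse square root occurring in the limiting phase is a multiple of
  \<open>Sm q\<close> on the tangent space, extended by zero. The final conclusion is the useful
  one: it turns the Euclidean product of \<open>T\<close> into the one given by
  \<open>Pm p\<close>.\<close>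

lemma tangential_inv_sqrt:
  fixes p \<nu> :: "real^'n"
  assumes nu: "\<nu> \<bullet> \<nu> = 1" and T_def: "T = {v. \<nu> \<bullet> v = 0}" and q_def: "q = p - (p \<bullet> \<nu>) *\<^sub>R \<nu>"
    and R0: "R0 = inv_sqrt_on T (\<lambda>v. sqrt (1 + (norm p)\<^sup>2) *\<^sub>R (v + (q \<bullet> v) *\<^sub>R q))"
  shows "linear R0" "\<exists>R'. linear R' \<and> (\<forall>z w. z \<bullet> R0 w = R' z \<bullet> w)"
    "\<And>v. v \<in> T \<Longrightarrow> R0 v \<in> T" "\<And>v w. v \<in> T \<Longrightarrow> w \<in> T \<Longrightarrow> (Pm p *v R0 v) \<bullet> R0 w = v \<bullet> w"
proof -
  define f where "f = (\<lambda>v. sqrt (1 + (norm p)\<^sup>2) *\<^sub>R (v + (q \<bullet> v) *\<^sub>R q))"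
  let ?wp = "wt p" and ?wq = "wt q"
  have w: "?wp > 0" "?wq > 0" using wt_pos by auto
  have wp: "sqrt (1 + (norm p)\<^sup>2) = ?wp" by (simp add: wt_def power2_norm_eq_inner)
  define pr where "pr = (\<lambda>v. v - (\<nu> \<bullet> v) *\<^sub>R \<nu>)"
  have pr_lin: "linear pr" by (auto intro!: linearI simp: pr_def algebra_simps inner_add_right)
  have pr_T: "pr v \<in> T" for v using nu by (simp add: pr_def T_def inner_diff_right)
  have pr_id: "pr v = v" if "v \<in> T" for v using that by (simp add: pr_def T_def)
  have pr_sym: "pr v \<bullet> u = v \<bullet> pr u" for v u by (simp add: pr_def inner_diff_left inner_diff_right inner_commute)
  have subT: "subspace T" by (simp add: T_def subspace_hyperplane)
  have qT: "q \<in> T" using nu by (simp add: T_def q_def inner_diff_right inner_commute)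
  have Sm_T: "Sm q *v v \<in> T" if "v \<in> T" for v
    unfolding Sm_mult using that qT subT by (intro subspace_scale subspace_diff) auto
  have Pm_T: "Pm q *v v \<in> T" if "v \<in> T" for v
    unfolding Pm_mult using that qT subT by (intro subspace_scale subspace_add) auto
  \<comment> \<open>The map to be inverted is (wp/wq) times \<open>Pm q\<close>, so its inverse
    square root is \<open>c\<close> times \<open>Sm q\<close>; since \<open>q\<close> lies in
    \<open>T\<close>, \<open>Sm q\<close> preserves \<open>T\<close>.\<close>
  define c where "c = sqrt (?wq / ?wp)"
  have c: "c > 0" "c * c = ?wq / ?wp" using w by (auto simp: c_def)
  define R where "R = (\<lambda>v. c *\<^sub>R (Sm q *v pr v))"
  define R' where "R' = (\<lambda>v. c *\<^sub>R pr (Sm q *v v))"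
  have fP: "f v = (?wp / ?wq) *\<^sub>R (Pm q *v v)" for v using w by (simp add: f_def wp Pm_mult)
  have linR: "linear R" unfolding R_def
    by (intro linear_compose_scale_right) (use linear_compose[OF pr_lin matrix_vector_mul_linear, of "Sm q"] in \<open>simp add: o_def\<close>)
  have linR': "linear R'" unfolding R'_def
    by (intro linear_compose_scale_right) (use linear_compose[OF matrix_vector_mul_linear pr_lin, of "Sm q"] in \<open>simp add: o_def\<close>)
  have RT: "R v \<in> T" for v unfolding R_def using subT by (intro subspace_scale Sm_T pr_T)
  have adj: "z \<bullet> R u = R' z \<bullet> u" for z u
  proof -
    have "z \<bullet> (Sm q *v pr u) = pr (Sm q *v z) \<bullet> u" by (simp add: Sym_inner[OF Sm_Sym, symmetric] pr_sym)
    then show ?thesis by (simp add: R_def R'_def)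
  qed
  have RR: "R (R v) = (?wq / ?wp) *\<^sub>R (Sm q *v (Sm q *v v))" if v: "v \<in> T" for v
  proof -
    have 1: "R u = c *\<^sub>R (Sm q *v u)" if "u \<in> T" for u using that by (simp add: R_def pr_id)
    have 2: "c *\<^sub>R (Sm q *v v) \<in> T" using subT by (intro subspace_scale Sm_T v)
    show ?thesis unfolding 1[OF v] 1[OF 2] by (simp add: matrix_vector_mult_scaleR c(2))
  qed
  have fT: "f v \<in> T" if "v \<in> T" for v unfolding fP using subT by (intro subspace_scale Pm_T that)
  have RRf: "R (R (f v)) = v" if v: "v \<in> T" for v
    unfolding RR[OF fT[OF v]] unfolding fP using w by (simp add: matrix_vector_mult_scaleR Sm_Sm_Pm)
  have fRR: "f (R (R v)) = v" if v: "v \<in> T" for v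
    unfolding RR[OF v] fP using w by (simp add: matrix_vector_mult_scaleR Pm_Sm_Sm)
  have "inv_sqrt_on T f = R"
  proof (rule inv_sqrt_on_eqI[OF subT _ linR])
    show "f ` T = T"
    proof
      show "f ` T \<subseteq> T" using fT by blast
      show "T \<subseteq> f ` T" using fRR RT by (metis image_eqI subsetI)
    qed
    show "R ` T \<subseteq> T" using RT by blast
    show "R v = 0" if v: "\<forall>u\<in>T. v \<bullet> u = 0" for v
    proof -
      have "pr v \<bullet> pr v = v \<bullet> pr (pr v)" by (rule pr_sym)
      also have "\<dots> = 0" using v pr_T by blast
      finally show ?thesis by (simp add: R_def)
    qed
    show "R v \<bullet> u = v \<bullet> R u" if "v \<in> T" "u \<in> T" for v u
      using that by (simp add: R_def pr_id Sym_inner[OF Sm_Sym])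
    show "0 < R v \<bullet> v" if "v \<in> T" "v \<noteq> 0" for v
      using that c Sm_pos[OF that(2), of q] by (simp add: R_def pr_id)
    show "R (R (f v)) = v" if "v \<in> T" for v by (rule RRf[OF that])
  qed
  moreover have "(Pm p *v R v) \<bullet> R u = v \<bullet> u" if v: "v \<in> T" and u: "u \<in> T" for v u
  proof -
    \<comment> \<open>On \<open>T\<close> the vectors p and q have the same inner products, so there
      \<open>Pm p\<close> and the prescribed map define the same form.\<close>
    have pq: "p \<bullet> y = q \<bullet> y" if "y \<in> T" for y using that by (simp add: q_def T_def inner_diff_left)
    have "(Pm p *v R v) \<bullet> R u = f (R v) \<bullet> R u"
      by (simp add: Pm_mult f_def wp inner_add_left pq RT)
    also have "\<dots> = (?wp / ?wq) * (c * c) * ((Pm q *v (Sm q *v v)) \<bullet> (Sm q *v u))"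
      by (simp add: fP R_def pr_id v u matrix_vector_mult_scaleR)
    also have "\<dots> = v \<bullet> u" using w by (simp add: c(2) Pm_Sm Sym_inner[OF Rm_Sym] Rm_Sm)
    finally show ?thesis .
  qed
  moreover have "R0 = inv_sqrt_on T f" by (simp add: R0 f_def)
  ultimately show "linear R0" "\<exists>R'. linear R' \<and> (\<forall>z w. z \<bullet> R0 w = R' z \<bullet> w)"
    "\<And>v. v \<in> T \<Longrightarrow> R0 v \<in> T" "\<And>v w. v \<in> T \<Longrightarrow> w \<in> T \<Longrightarrow> (Pm p *v R0 v) \<bullet> R0 w = v \<bullet> w"
    using linR linR' RT adj by blast+
qed

text \<open>In a suitable orthonormal basis the matrix A = \<open>AS p X\<close> has the tangential
  eigenvalues \<mu> of the limiting phase, an off-diagonal row of norm at most 2C, and the corner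
  entry \<open>ev\<close>. Lowering the tangential block by \<epsilon> and halving the corner
  absorbs that row, so the phase is at least sum arctan \<mu> - n \<epsilon> + pi/2 - 2/ev with
  \<epsilon> of order C^2/ev. The gap then bounds \<open>ev\<close> by a multiple of
  1/\<sigma>.\<close>

lemma double_normal:
  fixes X :: "real^'n^'n" and p \<nu> :: "real^'n" and C W \<sigma> t :: real
  assumes nu: "norm \<nu> = 1" and X: "X \<in> Sym" "psd X" and t: "0 \<le> t" "t \<le> 1"
    and C: "0 \<le> C" and W: "wt p \<le> W"
    and XT: "\<And>v w. \<nu> \<bullet> v = 0 \<Longrightarrow> \<nu> \<bullet> w = 0 \<Longrightarrow> \<bar>(X *v v) \<bullet> w\<bar> \<le> C * (norm v * norm w)"
    and XN: "\<And>v. \<nu> \<bullet> v = 0 \<Longrightarrow> \<bar>(X *v \<nu>) \<bullet> v\<bar> \<le> C * norm v"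
    and N: "\<And>v w. \<nu> \<bullet> v = 0 \<Longrightarrow> \<nu> \<bullet> w = 0 \<Longrightarrow> N v w = (X *v v) \<bullet> w"
    and q: "q = p - (p \<bullet> \<nu>) *\<^sub>R \<nu>"
    and R: "R = inv_sqrt_on {v. \<nu> \<bullet> v = 0} (\<lambda>v. sqrt (1 + (norm p)\<^sup>2) *\<^sub>R (v + (q \<bullet> v) *\<^sub>R q))"
    and \<sigma>: "0 < \<sigma>"
    and gap: "G_fun t p X + \<sigma> \<le> pi / 2 + arctan_sum_on {v. \<nu> \<bullet> v = 0} (\<lambda>v w. N (R v) (R w))"
  shows "(X *v \<nu>) \<bullet> \<nu> \<le> W^6 * ((8 * CARD('n) * C\<^sup>2 + 2) / \<sigma> + 2 * C)"
proof -
  let ?T = "{v. \<nu> \<bullet> v = 0}" and ?S = "\<lambda>v. Sm p *v v" and ?A = "AS p X"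
  have nn: "\<nu> \<bullet> \<nu> = 1" using nu by (simp add: norm_eq_1)
  have subT: "subspace ?T" by (rule subspace_hyperplane)
  note TI = tangential_inv_sqrt[OF nn refl q R]
  note linR = TI(1) and RT = TI(3) and iso = TI(4)
  obtain R' where R': "linear R'" and adj: "\<And>z w. z \<bullet> R w = R' z \<bullet> w" using TI(2) by blast
  \<comment> \<open>The adjoint of \<open>R\<close> makes the form X(R v) . R w the form of a linear
    map, so the spectral theorem applies to it on the tangent space.\<close>
  define f where "f = (\<lambda>v. R' (X *v R v))"
  have linf: "linear f"
    using linear_compose[OF linear_compose[OF linR matrix_vector_mul_linear[of X]] R']
    by (simp add: f_def o_def)
  have fR: "f v \<bullet> w = (X *v R v) \<bullet> R w" for v w by (simp add: f_def adj)
  have fsym: "f v \<bullet> w = v \<bullet> f w" for v w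
  proof -
    have "v \<bullet> f w = (X *v R w) \<bullet> R v" by (simp add: inner_commute[of v] fR)
    also have "\<dots> = (X *v R v) \<bullet> R w" using Sym_inner[OF X(1), of "R w" "R v"] by (simp add: inner_commute)
    finally show ?thesis by (simp only: fR)
  qed
  obtain B where B: "onb ?T B" and Bd: "\<And>b w. b \<in> B \<Longrightarrow> w \<in> ?T \<Longrightarrow> f b \<bullet> w = (f b \<bullet> b) * (b \<bullet> w)"
    using exists_orthonormal_eigenbasis[OF linf subT fsym] by blast
  define \<mu> where "\<mu> = (\<lambda>b. f b \<bullet> b)"
  have finB: "finite B" and BT: "\<And>b. b \<in> B \<Longrightarrow> b \<in> ?T" using B onb_subset[OF B] by (auto simp: onb_def)
  have NR: "N (R v) (R w) = f v \<bullet> w" if "v \<in> ?T" "w \<in> ?T" for v w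
    using N[of "R v" "R w"] RT[OF that(1)] RT[OF that(2)] by (simp add: fR)
  have asum: "arctan_sum_on ?T (\<lambda>v w. N (R v) (R w)) = (\<Sum>b\<in>B. arctan (\<mu> b))"
  proof (rule arctan_sum_on_eq[where f = f and N = "\<lambda>v w. N (R v) (R w)", OF B _ linf])
    show "N (R v) (R w) = f v \<bullet> w" if "v \<in> ?T" "w \<in> ?T" for v w using that by (rule NR)
    show "N (R b) (R w) = \<mu> b * (b \<bullet> w)" if "b \<in> B" "w \<in> ?T" for b w
      unfolding NR[OF BT[OF that(1)] that(2)] \<mu>_def by (rule Bd[OF that])
  qed
  \<comment> \<open>An isometric embedding of the tangent space, since the square of
    \<open>Rm p\<close> is \<open>Pm p\<close>. As \<open>Sm p\<close> takes \<iota> v to the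
    tangent vector \<open>R v\<close>, the image is orthogonal to \<open>Sm p\<close> \<nu>, and A
    compressed to the image is \<open>f\<close>.\<close>
  define \<iota> where "\<iota> = (\<lambda>v. Rm p *v R v)"
  have S\<iota>: "?S (\<iota> v) = R v" for v by (simp add: \<iota>_def Sm_Rm)
  have \<iota>i: "\<iota> v \<bullet> \<iota> w = v \<bullet> w" if "v \<in> ?T" "w \<in> ?T" for v w
    using iso[OF that] by (simp add: \<iota>_def Sym_inner[OF Rm_Sym, symmetric] Rm_Rm)
  have A\<iota>: "(?A *v \<iota> v) \<bullet> \<iota> w = f v \<bullet> w" for v w
    by (simp add: AS_mult Sym_inner[OF Sm_Sym] S\<iota> fR)
  define k where "k = norm (?S \<nu>)"
  \<comment> \<open>The normal direction is shortened by \<open>Sm p\<close> to length k; this lower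
    bound for k is the origin of the factor \<open>W^6\<close>, which compensates k^2.\<close>
  have kW: "1 \<le> (wt p)^3 * k" using norm_Sm_ge[of \<nu> p] nu by (simp add: k_def)
  then have k0: "k > 0" using wt_pos[of p] by (metis k_def less_numeral_extra(1) linorder_not_less mult_zero_right norm_ge_zero order_le_less)
  have k1: "k \<le> 1" using norm_Sm_le[of p \<nu>] nu by (simp add: k_def)
  have W0: "0 < W" using W wt_pos[of p] by linarith
  have kW6: "1 \<le> W^6 * k\<^sup>2"
  proof -
    have "(wt p)^3 * k \<le> W^3 * k" using W wt_pos[of p] k0 by (intro mult_right_mono power_mono) auto
    then have "1 \<le> W^3 * k" using kW by linarith
    then have "1 \<le> (W^3 * k)\<^sup>2" by simp
    then show ?thesis by (simp add: power_mult_distrib flip: power_mult)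
  qed
  define e where "e = (1 / k) *\<^sub>R ?S \<nu>"
  have ee: "e \<bullet> e = 1" using k0 by (simp add: e_def k_def dot_square_norm power2_eq_square)
  have e\<iota>: "\<iota> v \<bullet> e = 0" if "v \<in> ?T" for v
  proof -
    have "\<iota> v \<bullet> ?S \<nu> = R v \<bullet> \<nu>" using Sym_inner[OF Sm_Sym, of p "\<iota> v" \<nu>] by (simp only: S\<iota>)
    also have "\<dots> = 0" using RT[OF that] by (simp add: inner_commute)
    finally show ?thesis by (simp add: e_def)
  qed
  have \<iota>inj: "inj_on \<iota> ?T"
  proof (rule inj_onI)
    fix v w assume v: "v \<in> ?T" and w: "w \<in> ?T" and eq: "\<iota> v = \<iota> w"
    have d: "v - w \<in> ?T" using v w subT by (rule subspace_diff[rotated])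
    have "\<iota> (v - w) = \<iota> v - \<iota> w" by (simp add: \<iota>_def linear_diff[OF linR] matrix_vector_mult_diff_distrib)
    then have "(v - w) \<bullet> (v - w) = 0" using \<iota>i[OF d d] eq by simp
    then show "v = w" by simp
  qed
  have \<iota>B: "inj_on \<iota> B" by (rule inj_on_subset[OF \<iota>inj]) (use BT in blast)
  define E where "E = insert e (\<iota> ` B)"
  have enB: "e \<notin> \<iota> ` B" using e\<iota>[OF BT] ee by fastforce
  have \<iota>\<iota>: "\<iota> b \<bullet> \<iota> c = (if b = c then 1 else 0)" if "b \<in> B" "c \<in> B" for b c
    using \<iota>i[OF BT[OF that(1)] BT[OF that(2)]] onb_inner[OF B that] by simp
  have E: "onb UNIV E"
    unfolding onb_def
  proof (intro conjI)
    show finE: "finite E" using finB by (simp add: E_def)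
    have e\<iota>': "e \<bullet> \<iota> b = 0" "\<iota> b \<bullet> e = 0" if "b \<in> B" for b using e\<iota>[OF BT[OF that]] by (simp_all add: inner_commute)
    show po: "pairwise orthogonal E"
      unfolding E_def pairwise_def orthogonal_def by (auto simp: e\<iota>' \<iota>\<iota>)
    show n1: "\<forall>b\<in>E. norm b = 1" unfolding E_def norm_eq_1 using ee \<iota>\<iota> by auto
    have "independent E" using pairwise_orthogonal_independent[OF po] n1 by (metis norm_zero zero_neq_one)
    moreover have "card E = CARD('n)"
    proof -
      have "\<nu> \<noteq> 0" using nu by auto
      then have "card B = CARD('n) - 1" using onb_card[OF B] dim_hyperplane[of \<nu>] by simp
      moreover have "card E = Suc (card B)" using finB enB card_image[OF \<iota>B] by (simp add: E_def)
      moreover have "CARD('n) > 0" by simp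
      ultimately show ?thesis by linarith
    qed
    ultimately show "span E = UNIV" using card_ge_dim_independent[of E UNIV] by auto
  qed
  define ev where "ev = (?A *v e) \<bullet> e"
  have Sy: "\<nu> \<bullet> ?S y = 0" if "y \<bullet> e = 0" for y
  proof -
    have "y \<bullet> ?S \<nu> = 0" using that k0 by (simp add: e_def)
    then show ?thesis using Sym_inner[OF Sm_Sym, of p \<nu> y] by (simp add: inner_commute)
  qed
  define z where "z = ?S (?S \<nu>)"
  have z\<nu>: "z \<bullet> \<nu> = k\<^sup>2" by (simp add: z_def k_def Sym_inner[OF Sm_Sym] power2_norm_eq_inner)
  \<comment> \<open>z = S S \<nu> is split into a tangential part and k^2 \<nu>. Both have length at
    most k, which cancels the factor 1/k in \<open>?S e\<close>.\<close>
  define zT where "zT = z - k\<^sup>2 *\<^sub>R \<nu>"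
  have zT: "\<nu> \<bullet> zT = 0" using z\<nu> nn by (simp add: zT_def inner_diff_right inner_commute)
  have nz: "norm z \<le> k" using norm_Sm_le[of p "?S \<nu>"] by (simp add: z_def k_def)
  have nzT: "norm zT \<le> k"
  proof -
    have "(norm z)\<^sup>2 = (norm zT)\<^sup>2 + (k\<^sup>2)\<^sup>2"
    proof -
      have z': "z = zT + k\<^sup>2 *\<^sub>R \<nu>" by (simp add: zT_def)
      have "zT \<bullet> \<nu> = 0" using zT by (simp add: inner_commute)
      then show ?thesis using zT nn unfolding power2_norm_eq_inner
        by (subst (1 2) z') (simp add: inner_add_left inner_add_right power2_eq_square)
    qed
    then have "(norm zT)\<^sup>2 \<le> (norm z)\<^sup>2" by simp
    then show ?thesis using nz by (meson norm_ge_zero order_trans power2_le_imp_le)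
  qed
  have Xz: "X *v z = k\<^sup>2 *\<^sub>R (X *v \<nu>) + X *v zT"
    by (simp add: zT_def matrix_vector_mult_diff_distrib matrix_vector_mult_scaleR)
  have Se: "?S e = (1 / k) *\<^sub>R z" by (simp add: e_def z_def matrix_vector_mult_scaleR)
  \<comment> \<open>For y orthogonal to e the vector \<open>?S y\<close> is tangential, so this row
    of A meets only the mixed and the tangential block of X; each contributes C.\<close>
  have cross: "\<bar>(?A *v e) \<bullet> y\<bar> \<le> 2 * C * norm y" if y: "y \<bullet> e = 0" for y
  proof -
    have Ae: "(?A *v e) \<bullet> y = (1 / k) * (k\<^sup>2 * ((X *v \<nu>) \<bullet> ?S y) + (X *v zT) \<bullet> ?S y)"
      by (simp add: AS_mult Sym_inner[OF Sm_Sym] Se matrix_vector_mult_scaleR Xz inner_add_left)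
    have nS: "norm (?S y) \<le> norm y" by (rule norm_Sm_le)
    have "\<bar>(X *v \<nu>) \<bullet> ?S y\<bar> \<le> C * norm y"
      using XN[OF Sy[OF y]] mult_left_mono[OF nS C] by linarith
    then have "\<bar>k\<^sup>2 * ((X *v \<nu>) \<bullet> ?S y)\<bar> \<le> k * (C * norm y)"
      unfolding abs_mult using k0 k1 by (intro mult_mono) (auto simp: power2_eq_square mult_left_le)
    moreover have "\<bar>(X *v zT) \<bullet> ?S y\<bar> \<le> k * (C * norm y)"
    proof -
      have "\<bar>(X *v zT) \<bullet> ?S y\<bar> \<le> C * (norm zT * norm (?S y))" by (rule XT[OF zT Sy[OF y]])
      also have "\<dots> \<le> C * (k * norm y)" using C k0 nzT nS by (intro mult_left_mono mult_mono) auto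
      finally show ?thesis by (simp add: mult_ac)
    qed
    ultimately have "\<bar>k\<^sup>2 * ((X *v \<nu>) \<bullet> ?S y) + (X *v zT) \<bullet> ?S y\<bar> \<le> k * (2 * C * norm y)" by (simp add: algebra_simps)
    then have "(1 / k) * \<bar>k\<^sup>2 * ((X *v \<nu>) \<bullet> ?S y) + (X *v zT) \<bullet> ?S y\<bar> \<le> (1 / k) * (k * (2 * C * norm y))"
      using k0 by (intro mult_left_mono) auto
    then show ?thesis unfolding Ae abs_mult using k0 by simp
  qed
  \<comment> \<open>k^2 ev equals X z . z. Expanding z leaves the double normal entry, two mixed
    terms bounded through C, and a tangential square that is nonnegative because X is.\<close>
  have lam_ge: "k\<^sup>2 * ((X *v \<nu>) \<bullet> \<nu>) - 2 * C \<le> ev"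
  proof -
    have "k\<^sup>2 * ev = (X *v z) \<bullet> z"
      using k0 by (simp add: ev_def AS_mult Sym_inner[OF Sm_Sym] Se matrix_vector_mult_scaleR power2_eq_square)
    also have "\<dots> = k\<^sup>2 * (k\<^sup>2 * ((X *v \<nu>) \<bullet> \<nu>)) + 2 * (k\<^sup>2 * ((X *v \<nu>) \<bullet> zT)) + (X *v zT) \<bullet> zT"
    proof -
      have z': "z = zT + k\<^sup>2 *\<^sub>R \<nu>" by (simp add: zT_def)
      have "(X *v zT) \<bullet> \<nu> = (X *v \<nu>) \<bullet> zT" using Sym_inner[OF X(1), of zT \<nu>] by (simp add: inner_commute)
      then show ?thesis unfolding Xz
        by (subst z') (simp add: inner_add_left inner_add_right algebra_simps)
    qed
    also have "\<dots> \<ge> k\<^sup>2 * (k\<^sup>2 * ((X *v \<nu>) \<bullet> \<nu>)) - 2 * (k\<^sup>2 * C)"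
    proof -
      have "0 \<le> (X *v zT) \<bullet> zT" using X(2) by (simp add: psd_def inner_commute)
      moreover have "- C \<le> (X *v \<nu>) \<bullet> zT"
      proof -
        have "C * norm zT \<le> C * 1" using C nzT k1 by (intro mult_left_mono) auto
        then show ?thesis using XN[OF zT] by linarith
      qed
      then have "k\<^sup>2 * (- C) \<le> k\<^sup>2 * ((X *v \<nu>) \<bullet> zT)" by (intro mult_left_mono) auto
      ultimately show ?thesis by simp
    qed
    finally have "k\<^sup>2 * (k\<^sup>2 * ((X *v \<nu>) \<bullet> \<nu>) - 2 * C) \<le> k\<^sup>2 * ev" by (simp add: algebra_simps)
    then show ?thesis using k0 by simp
  qed
  have lam_le: "ev \<le> (8 * CARD('n) * C\<^sup>2 + 2) / \<sigma>"
  proof (cases "ev > 0")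
    case False
    moreover have "0 \<le> (8 * CARD('n) * C\<^sup>2 + 2) / \<sigma>" using \<sigma> by (intro divide_nonneg_pos) auto
    ultimately show ?thesis by linarith
  next
    case l0: True
    \<comment> \<open>Chosen so that (ev/2) \<epsilon> = (2C)^2: this is the discriminant condition
      for \<epsilon> |y|^2 - 4 C |a| |y| + (ev/2) a^2 >= 0.\<close>
    define \<epsilon> where "\<epsilon> = 8 * C\<^sup>2 / ev"
    have eps: "0 \<le> \<epsilon>" using l0 by (simp add: \<epsilon>_def)
    \<comment> \<open>The block-diagonal comparison matrix: \<open>\<mu> b - \<epsilon>\<close> on
      the image of the tangential eigenbasis, half of the corner on e. Its phase can be read
      off.\<close>
    define A' where "A' = (\<Sum>b\<in>B. (\<mu> b - \<epsilon>) *\<^sub>R outer (\<iota> b) (\<iota> b)) + (ev / 2) *\<^sub>R outer e e"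
    have A'v: "A' *v v = (\<Sum>b\<in>B. ((\<mu> b - \<epsilon>) * (\<iota> b \<bullet> v)) *\<^sub>R \<iota> b) + ((ev / 2) * (e \<bullet> v)) *\<^sub>R e" for v
      by (simp add: A'_def matrix_vector_mult_add_rdistrib matrix_sum_vec matrix_vector_mult_scaleR_left outer_mult)
    have A'q: "(A' *v v) \<bullet> w = (\<Sum>b\<in>B. (\<mu> b - \<epsilon>) * (\<iota> b \<bullet> v) * (\<iota> b \<bullet> w)) + (ev / 2) * (e \<bullet> v) * (e \<bullet> w)" for v w
      by (simp add: A'v inner_add_left inner_sum_left)
    have A'S: "A' \<in> Sym"
      by (rule SymI) (subst inner_commute, simp add: A'q mult_ac)
    have A'\<iota>: "A' *v \<iota> b = (\<mu> b - \<epsilon>) *\<^sub>R \<iota> b" if b: "b \<in> B" for b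
    proof -
      have "(\<Sum>c\<in>B. ((\<mu> c - \<epsilon>) * (\<iota> c \<bullet> \<iota> b)) *\<^sub>R \<iota> c) = (\<Sum>c\<in>B. if c = b then (\<mu> b - \<epsilon>) *\<^sub>R \<iota> b else 0)"
        by (rule sum.cong) (auto simp: \<iota>\<iota> b)
      then show ?thesis using finB b e\<iota>[OF BT[OF b]] by (simp add: A'v inner_commute)
    qed
    have A'e: "A' *v e = (ev / 2) *\<^sub>R e"
    proof -
      have "(\<Sum>c\<in>B. ((\<mu> c - \<epsilon>) * (\<iota> c \<bullet> e)) *\<^sub>R \<iota> c) = 0" by (rule sum.neutral) (use e\<iota>[OF BT] in auto)
      then show ?thesis by (simp add: A'v ee)
    qed
    have FA': "F_fun A' = (\<Sum>b\<in>B. arctan (\<mu> b - \<epsilon>)) + arctan (ev / 2)"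
    proof -
      have "F_fun A' = (\<Sum>y\<in>E. arctan ((A' *v y) \<bullet> y))"
      proof (rule F_fun_eq[OF E])
        fix y assume "y \<in> E"
        then show "A' *v y = ((A' *v y) \<bullet> y) *\<^sub>R y"
          unfolding E_def using A'e ee A'\<iota> \<iota>\<iota> by auto
      qed
      also have "\<dots> = arctan ((A' *v e) \<bullet> e) + (\<Sum>y\<in>\<iota> ` B. arctan ((A' *v y) \<bullet> y))"
        unfolding E_def using finB enB by simp
      also have "(\<Sum>y\<in>\<iota> ` B. arctan ((A' *v y) \<bullet> y)) = (\<Sum>b\<in>B. arctan (\<mu> b - \<epsilon>))"
        unfolding sum.reindex[OF \<iota>B] by (rule sum.cong) (auto simp: A'\<iota> \<iota>\<iota>)
      finally show ?thesis by (simp add: A'e ee)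
    qed
    have psd': "psd (?A - A')"
      unfolding psd_def
    proof
      fix v
      define a where "a = e \<bullet> v"
      define y where "y = v - a *\<^sub>R e"
      have ye: "y \<bullet> e = 0" using ee by (simp add: y_def a_def inner_diff_left inner_diff_right inner_commute)
      have v: "v = y + a *\<^sub>R e" by (simp add: y_def)
      have \<iota>y: "\<iota> b \<bullet> v = y \<bullet> \<iota> b" if "b \<in> B" for b using e\<iota>[OF BT[OF that]] by (simp add: v inner_add_left inner_add_right inner_commute)
      have pars: "u \<bullet> w = (u \<bullet> e) * (w \<bullet> e) + (\<Sum>b\<in>B. (u \<bullet> \<iota> b) * (w \<bullet> \<iota> b))" for u w
        using onb_parseval[OF E, of u w] finB enB by (simp add: E_def sum.reindex[OF \<iota>B])
      have Ay\<iota>: "(?A *v y) \<bullet> \<iota> b = \<mu> b * (y \<bullet> \<iota> b)" if b: "b \<in> B" for b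
      proof -
        have "(?A *v y) \<bullet> \<iota> b = y \<bullet> (?A *v \<iota> b)" by (rule Sym_inner[OF AS_Sym[OF X(1)]])
        also have "\<dots> = (\<Sum>c\<in>B. (y \<bullet> \<iota> c) * (f b \<bullet> c))" by (subst pars) (simp add: ye A\<iota>)
        also have "\<dots> = (\<Sum>c\<in>B. if c = b then \<mu> b * (y \<bullet> \<iota> b) else 0)"
          by (rule sum.cong) (auto simp: Bd[OF b BT] onb_inner[OF B b] \<mu>_def)
        finally show ?thesis using finB b by simp
      qed
      have Ayy: "(?A *v y) \<bullet> y = (\<Sum>b\<in>B. \<mu> b * (y \<bullet> \<iota> b)\<^sup>2)"
        by (subst pars) (simp add: ye Ay\<iota> power2_eq_square mult.assoc)
      have yy: "(norm y)\<^sup>2 = (\<Sum>b\<in>B. (y \<bullet> \<iota> b)\<^sup>2)"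
        unfolding power2_norm_eq_inner by (subst pars) (simp add: ye power2_eq_square)
      have Av: "(?A *v v) \<bullet> v = (?A *v y) \<bullet> y + 2 * a * ((?A *v e) \<bullet> y) + a\<^sup>2 * ev"
      proof -
        have "(?A *v y) \<bullet> e = (?A *v e) \<bullet> y" using Sym_inner[OF AS_Sym[OF X(1)], of p y e] by (simp add: inner_commute)
        then show ?thesis
          by (simp add: v matrix_vector_right_distrib matrix_vector_mult_scaleR inner_add_left inner_add_right
              ev_def power2_eq_square algebra_simps)
      qed
      have "(A' *v v) \<bullet> v = (\<Sum>b\<in>B. (\<mu> b - \<epsilon>) * (y \<bullet> \<iota> b)\<^sup>2) + (ev / 2) * a\<^sup>2"
        unfolding A'q a_def[symmetric] by (simp add: \<iota>y power2_eq_square mult.assoc)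
      also have "(\<Sum>b\<in>B. (\<mu> b - \<epsilon>) * (y \<bullet> \<iota> b)\<^sup>2) = (?A *v y) \<bullet> y - \<epsilon> * (norm y)\<^sup>2"
        by (simp add: Ayy yy left_diff_distrib sum_subtractf sum_distrib_left)
      finally have diff: "((?A - A') *v v) \<bullet> v = \<epsilon> * (norm y)\<^sup>2 + 2 * a * ((?A *v e) \<bullet> y) + (ev / 2) * a\<^sup>2"
        using Av by (simp add: matrix_vector_mult_diff_rdistrib inner_diff_left)
      have "2 * a * ((?A *v e) \<bullet> y) \<ge> - (2 * \<bar>a\<bar> * (2 * C * norm y))"
      proof -
        have "\<bar>2 * a * ((?A *v e) \<bullet> y)\<bar> \<le> 2 * \<bar>a\<bar> * (2 * C * norm y)"
          unfolding abs_mult using cross[OF ye] by (intro mult_mono) auto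
        then show ?thesis by linarith
      qed
      then have "((?A - A') *v v) \<bullet> v \<ge> \<epsilon> * (norm y)\<^sup>2 - 2 * \<bar>a\<bar> * (2 * C * norm y) + (ev / 2) * a\<^sup>2"
        unfolding diff by linarith
      \<comment> \<open>Multiplying by the positive number ev/2 makes the lower bound a perfect
        square.\<close>
      moreover have "(ev / 2) * (\<epsilon> * (norm y)\<^sup>2 - 2 * \<bar>a\<bar> * (2 * C * norm y) + (ev / 2) * a\<^sup>2)
          = (2 * C * norm y - (ev / 2) * \<bar>a\<bar>)\<^sup>2"
      proof -
        have "(ev / 2) * \<epsilon> = 4 * C\<^sup>2" using l0 by (simp add: \<epsilon>_def)
        then have "(ev / 2) * (\<epsilon> * (norm y)\<^sup>2) = 4 * C\<^sup>2 * (norm y)\<^sup>2" by (simp only: mult.assoc[symmetric])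
        moreover have "a\<^sup>2 = \<bar>a\<bar>\<^sup>2" by simp
        ultimately show ?thesis unfolding distrib_left right_diff_distrib
          by (simp add: power2_eq_square algebra_simps)
      qed
      ultimately have "0 \<le> ((?A - A') *v v) \<bullet> v"
        using l0 by (smt (verit) zero_le_power2 mult_pos_neg half_gt_zero)
      then show "0 \<le> v \<bullet> ((?A - A') *v v)" by (simp add: inner_commute)
    qed
    have "F_fun A' \<le> F_fun ?A" by (rule F_fun_mono[OF A'S AS_Sym[OF X(1)] psd'])
    also have "\<dots> = \<Phi> p X" by (simp add: \<Phi>_def Fs_def symm_id AS_Sym X(1))
    also have "\<dots> \<le> G_fun t p X" using \<Phi>_antimono_radial[OF X t, of p] by (simp add: G_fun_eq X(1))
    finally have FG: "F_fun A' \<le> G_fun t p X" .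
    have "(\<Sum>b\<in>B. arctan (\<mu> b)) - CARD('n) * \<epsilon> \<le> (\<Sum>b\<in>B. arctan (\<mu> b - \<epsilon>))"
    proof -
      have "card B \<le> CARD('n)" using onb_card[OF B] dim_subset_UNIV_cart[of ?T] by simp
      then have "card B * \<epsilon> \<le> CARD('n) * \<epsilon>" using eps by (intro mult_right_mono) auto
      moreover have "(\<Sum>b\<in>B. arctan (\<mu> b) - \<epsilon>) \<le> (\<Sum>b\<in>B. arctan (\<mu> b - \<epsilon>))"
        by (intro sum_mono arctan_diff_ge eps)
      ultimately show ?thesis by (simp add: sum_subtractf)
    qed
    moreover have "pi / 2 - 2 / ev \<le> arctan (ev / 2)" using arctan_ge_pi_half[of "ev / 2"] l0 by simp
    ultimately have "\<sigma> \<le> CARD('n) * \<epsilon> + 2 / ev" using FG gap unfolding FA' asum by linarith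
    also have "\<dots> = (8 * CARD('n) * C\<^sup>2 + 2) / ev" by (simp add: \<epsilon>_def add_divide_distrib)
    finally show ?thesis using l0 \<sigma> by (simp add: le_divide_eq mult.commute)
  qed
  show ?thesis
  proof (cases "(X *v \<nu>) \<bullet> \<nu> \<ge> 0")
    case True
    have "(X *v \<nu>) \<bullet> \<nu> * 1 \<le> (X *v \<nu>) \<bullet> \<nu> * (W^6 * k\<^sup>2)" using kW6 True by (rule mult_left_mono)
    also have "\<dots> = W^6 * (k\<^sup>2 * ((X *v \<nu>) \<bullet> \<nu>))" by simp
    also have "\<dots> \<le> W^6 * ((8 * CARD('n) * C\<^sup>2 + 2) / \<sigma> + 2 * C)"
      using lam_ge lam_le W0 by (intro mult_left_mono) auto
    finally show ?thesis by simp
  next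
    case False
    then have "(X *v \<nu>) \<bullet> \<nu> \<le> 0" by simp
    also have "0 \<le> W^6 * ((8 * CARD('n) * C\<^sup>2 + 2) / \<sigma> + 2 * C)"
      using W0 C \<sigma> by (intro mult_nonneg_nonneg add_nonneg_nonneg divide_nonneg_pos) auto
    finally show ?thesis .
  qed
qed

section \<open>The recession condition as a uniform inequality\<close>

lemma bounded_vec_on_compact:
  fixes g :: "'a::metric_space \<Rightarrow> real^'n"
  assumes "compact S" "\<And>i. continuous_on S (\<lambda>x. g x $ i)"
  shows "\<exists>M. \<forall>x\<in>S. norm (g x) \<le> M"
proof -
  have "continuous_on S (\<lambda>x. \<chi> i. g x $ i)" by (rule continuous_on_vec_lambda) (rule assms(2))
  then have "continuous_on S g" by (simp only: vec_lambda_eta)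
  then have c: "compact (g ` S)" using assms(1) by (rule compact_continuous_image)
  have "bounded (g ` S)" by (rule compact_imp_bounded[OF c])
  then obtain M where "\<forall>y\<in>g ` S. norm y \<le> M" unfolding bounded_iff ..
  then have "\<forall>x\<in>S. norm (g x) \<le> M" by simp
  then show ?thesis ..
qed

lemma bounded_mat_on_compact:
  fixes H :: "'a::metric_space \<Rightarrow> real^'n^'m"
  assumes "compact S" "\<And>i j. continuous_on S (\<lambda>x. H x $ i $ j)"
  shows "\<exists>M. \<forall>x\<in>S. norm (H x) \<le> M"
proof -
  have "continuous_on S (\<lambda>x. \<chi> i. \<chi> j. H x $ i $ j)" by (rule continuous_on_vec_lambda, rule continuous_on_vec_lambda) (rule assms(2))
  then have "continuous_on S H" by (simp only: vec_lambda_eta)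
  then have c: "compact (H ` S)" using assms(1) by (rule compact_continuous_image)
  have "bounded (H ` S)" by (rule compact_imp_bounded[OF c])
  then obtain M where "\<forall>y\<in>H ` S. norm y \<le> M" unfolding bounded_iff ..
  then have "\<forall>x\<in>S. norm (H x) \<le> M" by simp
  then show ?thesis ..
qed

lemma wt_scale_le:
  assumes "0 \<le> t" "t \<le> 1" "norm p \<le> M" shows "norm (t *\<^sub>R p) \<le> M" "wt (t *\<^sub>R p) \<le> 1 + M"
proof -
  have "t * norm p \<le> 1 * norm p" using assms by (intro mult_right_mono) auto
  then show 1: "norm (t *\<^sub>R p) \<le> M" using assms by simp
  show "wt (t *\<^sub>R p) \<le> 1 + M" using wt_le[of "t *\<^sub>R p"] 1 by linarith
qed

text \<open>One constant for all the jet estimates: n suffices for a, n (1 + M)^3 for aX, and 3 n (1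
  + M)^3 for b.\<close>

definition jc :: "real \<Rightarrow> real \<Rightarrow> real" where "jc n M = 3 * n * (1 + M)^3"

lemma jet_bounds:
  fixes X :: "real^'n^'n" and M t :: real
  assumes t: "0 \<le> t" "t \<le> 1" and p: "norm p \<le> M" and X: "X \<in> Sym"
  defines "a \<equiv> G_X t p X" and "b \<equiv> G_p t p X" and "c \<equiv> jc (CARD('n)) M"
  shows "1 \<le> c" "\<And>\<xi> \<eta>. \<bar>\<xi> \<bullet> (a *v \<eta>)\<bar> \<le> c * (norm \<xi> * norm \<eta>)"
    "\<And>Y. \<bar>mat_inner a Y\<bar> \<le> c * norm Y" "\<And>\<xi> \<eta>. \<bar>\<xi> \<bullet> (a *v (X *v \<eta>))\<bar> \<le> c * (norm \<xi> * norm \<eta>)"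
    "\<bar>mat_inner a X\<bar> \<le> c" "norm b \<le> c" "\<And>\<xi>. 0 \<le> \<xi> \<bullet> (a *v \<xi>)" "\<And>Y. psd Y \<Longrightarrow> 0 \<le> mat_inner a Y"
    "a \<in> Sym" "\<And>\<xi>. (norm \<xi>)\<^sup>2 \<le> (1 + M)^6 * (1 + (op_norm X)\<^sup>2) * (\<xi> \<bullet> (a *v \<xi>))"
proof -
  let ?p = "t *\<^sub>R p" and ?n = "real CARD('n)"
  have a: "a = amat ?p X" and b: "b = t *\<^sub>R bvec ?p X"
    unfolding a_def b_def by (rule G_X_eq[OF X], rule G_p_eq[OF X])
  have M0: "0 \<le> M" by (rule order_trans[OF norm_ge_zero p])
  note w = wt_scale_le[OF t p]
  have n1: "1 \<le> ?n" by (simp add: Suc_leI)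
  have M1: "1 \<le> (1 + M)^3" using M0 by (intro one_le_power) simp
  have cn: "?n * (1 + M)^3 \<le> c" using M0 by (simp add: c_def jc_def)
  have nM: "?n * 1 \<le> ?n * (1 + M)^3" using M1 n1 by (intro mult_left_mono) auto
  then have nc: "?n \<le> c" using cn by linarith
  show "1 \<le> c" using nc n1 by linarith
  show "\<bar>\<xi> \<bullet> (a *v \<eta>)\<bar> \<le> c * (norm \<xi> * norm \<eta>)" for \<xi> \<eta>
    unfolding a using amat_form_bound[OF X, of \<xi> ?p \<eta>] mult_right_mono[OF nc, of "norm \<xi> * norm \<eta>"] by simp
  show "\<bar>mat_inner a Y\<bar> \<le> c * norm Y" for Y
    unfolding a using mat_inner_amat_bound[OF X, of ?p Y] mult_right_mono[OF nc, of "norm Y"] by simp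
  show "\<bar>\<xi> \<bullet> (a *v (X *v \<eta>))\<bar> \<le> c * (norm \<xi> * norm \<eta>)" for \<xi> \<eta>
  proof -
    have "(wt ?p)^3 \<le> (1 + M)^3" using w wt_pos[of ?p] by (intro power_mono) auto
    then have "?n * (wt ?p)^3 \<le> ?n * (1 + M)^3" by (intro mult_left_mono) auto
    then have "?n * (wt ?p)^3 \<le> c" using cn by linarith
    from mult_right_mono[OF this, of "norm \<xi> * norm \<eta>"] show ?thesis
      unfolding a using amat_X_form_bound[OF X, of \<xi> ?p \<eta>] by (simp add: mult.assoc)
  qed
  show "\<bar>mat_inner a X\<bar> \<le> c" unfolding a using mat_inner_amat_X_bound[OF X, of ?p] nc by linarith
  show "norm b \<le> c"
  proof -
    have "norm b \<le> 1 * norm (bvec ?p X)" unfolding b using t by (simp add: mult_left_le_one_le)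
    also have "\<dots> \<le> ?n * (3 * (1 + norm ?p)^3)" using norm_bvec_le[OF X, of ?p] by simp
    also have "\<dots> \<le> ?n * (3 * (1 + M)^3)" using w by (intro mult_left_mono power_mono) auto
    finally show ?thesis by (simp add: c_def jc_def mult_ac)
  qed
  show "0 \<le> \<xi> \<bullet> (a *v \<xi>)" for \<xi> unfolding a by (rule amat_nonneg)
  show "0 \<le> mat_inner a Y" if "psd Y" for Y unfolding a using that by (rule mat_inner_amat_nonneg)
  show "a \<in> Sym" unfolding a by (rule amat_Sym)
  show "(norm \<xi>)\<^sup>2 \<le> (1 + M)^6 * (1 + (op_norm X)\<^sup>2) * (\<xi> \<bullet> (a *v \<xi>))" for \<xi>
  proof -
    have "(wt ?p)^6 \<le> (1 + M)^6" using w wt_pos[of ?p] by (intro power_mono) auto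
    then have "(wt ?p)^6 * ((1 + (op_norm X)\<^sup>2) * (\<xi> \<bullet> (a *v \<xi>))) \<le> (1 + M)^6 * ((1 + (op_norm X)\<^sup>2) * (\<xi> \<bullet> (a *v \<xi>)))"
      unfolding a by (intro mult_right_mono mult_nonneg_nonneg amat_nonneg) auto
    then show ?thesis using amat_coercive[OF X, of \<xi> ?p] unfolding a by (simp add: mult.assoc)
  qed
qed

locale homotopy_problem = c4_domain \<Omega> r for \<Omega> :: "(real^'n) set" and r :: real +
  fixes \<theta> :: real and ub :: "real^'n \<Rightarrow> real" and K :: "(real^'n) set"
  assumes C_ub: "C_k_on 3 (closure \<Omega>) ub" and K: "compact K"
begin

definition "gb = grad_on (closure \<Omega>) ub"
definition "Hb = hess_on (closure \<Omega>) ub"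
definition "Tb i = hess_on (closure \<Omega>) (\<lambda>x. gb x $ i)"
definition "Td i = hess_on (closure \<Omega>) (\<lambda>x. gd x $ i)"
text \<open>A compact part of the collar. The derivatives of the distance are continuous on the
  whole collar, but bounds for them come from compactness.\<close>

definition "half = {x \<in> closure \<Omega>. bdist \<Omega> x \<le> r / 2}"

lemma half_collar: "x \<in> half \<Longrightarrow> x \<in> collar \<Omega> r" using r_pos by (auto simp: half_def collar_def)

lemma compact_half: "compact half"
proof -
  have "closed {x. bdist \<Omega> x \<le> r / 2}" unfolding bdist_def by (intro closed_Collect_le continuous_intros)
  moreover have "half = closure \<Omega> \<inter> {x. bdist \<Omega> x \<le> r / 2}" by (auto simp: half_def)
  ultimately show ?thesis using compact_closure_dom by (simp add: compact_Int_closed)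
qed

lemmas ub_C2 = C2_solid[OF solid_closure C_ub[unfolded four_eq(2)], folded gb_def Hb_def]
lemmas gb_C2 = C2_solid[OF solid_closure ub_C2(3)[unfolded One_nat_def], folded Tb_def]
lemmas d_C2 = collar_C2[OF C_d[unfolded four_eq(1)], folded gd_def Hd_def]
lemmas gd_C2 = collar_C2[OF d_C2(3)[unfolded numeral_2_eq_2], folded Td_def]

lemma uniform_bound:
  obtains M where "1 \<le> M" "\<And>x. x \<in> closure \<Omega> \<Longrightarrow> norm (gb x) \<le> M" "\<And>x. x \<in> closure \<Omega> \<Longrightarrow> norm (Hb x) \<le> M"
    "\<And>x i. x \<in> closure \<Omega> \<Longrightarrow> norm (Tb i x) \<le> M" "\<And>x. x \<in> half \<Longrightarrow> norm (Hd x) \<le> M"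
    "\<And>x i. x \<in> half \<Longrightarrow> norm (Td i x) \<le> M" "\<And>p. p \<in> K \<Longrightarrow> norm p \<le> M"
proof -
  note cc = compact_closure_dom and ch = compact_half
  have sub: "half \<subseteq> collar \<Omega> r" using half_collar by blast
  obtain M1 where M1: "\<forall>x\<in>closure \<Omega>. norm (gb x) \<le> M1"
    using bounded_vec_on_compact[OF cc C_k_on_continuous[OF ub_C2(3)]] by blast
  obtain M2 where M2: "\<forall>x\<in>closure \<Omega>. norm (Hb x) \<le> M2"
    using bounded_mat_on_compact[OF cc C_k_on_continuous[OF ub_C2(4)]] by blast
  have "\<exists>m. \<forall>x\<in>closure \<Omega>. norm (Tb i x) \<le> m" for i
    by (rule bounded_mat_on_compact[OF cc C_k_on_continuous[OF gb_C2(4)]])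
  then obtain m3 where m3: "\<And>i x. x \<in> closure \<Omega> \<Longrightarrow> norm (Tb i x) \<le> m3 i" by metis
  obtain M4 where M4: "\<forall>x\<in>half. norm (Hd x) \<le> M4"
    using bounded_mat_on_compact[OF ch continuous_on_subset[OF C_k_on_continuous[OF d_C2(4)] sub]] by blast
  have "\<exists>m. \<forall>x\<in>half. norm (Td i x) \<le> m" for i
    by (rule bounded_mat_on_compact[OF ch continuous_on_subset[OF C_k_on_continuous[OF gd_C2(4)] sub]])
  then obtain m5 where m5: "\<And>i x. x \<in> half \<Longrightarrow> norm (Td i x) \<le> m5 i" by metis
  obtain M6 where M6: "\<forall>p\<in>K. norm p \<le> M6" using compact_imp_bounded[OF K] unfolding bounded_iff by blast
  define M3 where "M3 = (\<Sum>i\<in>UNIV. \<bar>m3 i\<bar>)"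
  define M5 where "M5 = (\<Sum>i\<in>UNIV. \<bar>m5 i\<bar>)"
  have 3: "m3 i \<le> M3" and 5: "m5 i \<le> M5" for i
    unfolding M3_def M5_def using member_le_sum[of i UNIV "\<lambda>i. \<bar>m3 i\<bar>"] member_le_sum[of i UNIV "\<lambda>i. \<bar>m5 i\<bar>"]
    by auto
  define M where "M = 1 + \<bar>M1\<bar> + \<bar>M2\<bar> + M3 + \<bar>M4\<bar> + M5 + \<bar>M6\<bar>"
  have nn: "0 \<le> M3" "0 \<le> M5" by (simp_all add: M3_def M5_def sum_nonneg)
  show ?thesis
  proof (rule that[of M])
    show "1 \<le> M" using nn by (simp add: M_def)
    show "norm (gb x) \<le> M" if "x \<in> closure \<Omega>" for x using M1 that nn unfolding M_def by fastforce
    show "norm (Hb x) \<le> M" if "x \<in> closure \<Omega>" for x using M2 that nn unfolding M_def by fastforce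
    show "norm (Tb i x) \<le> M" if "x \<in> closure \<Omega>" for x i using m3[OF that, of i] 3[of i] nn unfolding M_def by linarith
    show "norm (Hd x) \<le> M" if "x \<in> half" for x using M4 that nn unfolding M_def by fastforce
    show "norm (Td i x) \<le> M" if "x \<in> half" for x i using m5[OF that, of i] 5[of i] nn unfolding M_def by linarith
    show "norm p \<le> M" if "p \<in> K" for p using M6 that nn unfolding M_def by fastforce
  qed
qed

text \<open>Outside the coefficients, \<open>X\<close> enters \<open>jet_J\<close> only through the
  trace of aX, which is bounded independently of \<open>X\<close>.\<close>

lemma jet_J_l_bounds:
  fixes t :: real
  assumes M: "1 \<le> M" "\<And>x. x \<in> closure \<Omega> \<Longrightarrow> norm (gb x) \<le> M" "\<And>x. x \<in> closure \<Omega> \<Longrightarrow> norm (Hb x) \<le> M"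
     "\<And>x. x \<in> half \<Longrightarrow> norm (Hd x) \<le> M" "\<And>p. p \<in> K \<Longrightarrow> norm p \<le> M"
    and j: "level_jet \<theta> K t p X" and x: "x \<in> half"
  defines "C \<equiv> 4 * jc (CARD('n)) M * M"
  shows "\<bar>jet_J \<Omega> ub x t p X\<bar> \<le> C" "\<bar>jet_l \<Omega> x t p X\<bar> \<le> C"
proof -
  let ?c = "jc (CARD('n)) M"
  have t: "0 \<le> t" "t \<le> 1" and p: "norm p \<le> M" and X: "X \<in> Sym" using j M(5) by (auto simp: level_jet_def)
  note B = jet_bounds[OF t p X]
  have xc: "x \<in> closure \<Omega>" using half_collar[OF x] collar_closure by blast
  have c0: "0 \<le> ?c" using B(1) by linarith
  have cM: "?c \<le> ?c * M" using mult_left_mono[OF M(1) c0] by simp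
  have 1: "\<bar>mat_inner (G_X t p X) (Hb x - X)\<bar> \<le> ?c * M + ?c"
  proof -
    have "mat_inner (G_X t p X) (Hb x - X) = mat_inner (G_X t p X) (Hb x) - mat_inner (G_X t p X) X"
      by (rule linear_diff[OF mat_inner_linear_right])
    moreover have "\<bar>mat_inner (G_X t p X) (Hb x)\<bar> \<le> ?c * M"
      using B(3)[of "Hb x"] mult_left_mono[OF M(3)[OF xc] c0] by linarith
    ultimately show ?thesis using B(5) by linarith
  qed
  have bb: "\<bar>G_p t p X \<bullet> v\<bar> \<le> ?c * m" if "norm v \<le> m" for v m
  proof -
    have "\<bar>G_p t p X \<bullet> v\<bar> \<le> norm (G_p t p X) * norm v" by (rule Cauchy_Schwarz_ineq2)
    also have "\<dots> \<le> ?c * m" using B(6) that c0 by (intro mult_mono) auto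
    finally show ?thesis .
  qed
  have "norm (gb x - p) \<le> 2 * M" using norm_triangle_ineq4[of "gb x" p] M(2)[OF xc] p by linarith
  then have 2: "\<bar>G_p t p X \<bullet> (gb x - p)\<bar> \<le> ?c * (2 * M)" by (rule bb)
  show "\<bar>jet_J \<Omega> ub x t p X\<bar> \<le> C"
    unfolding jet_J_def C_def gb_def[symmetric] Hb_def[symmetric] using 1 2 cM by linarith
  have "\<bar>mat_inner (G_X t p X) (Hd x)\<bar> \<le> ?c * M"
    using B(3)[of "Hd x"] mult_left_mono[OF M(4)[OF x] c0] by linarith
  moreover have "\<bar>G_p t p X \<bullet> gd x\<bar> \<le> ?c * 1" by (rule bb) (simp add: norm_gd[OF half_collar[OF x]])
  moreover have "0 \<le> ?c * M" using c0 M(1) by simp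
  ultimately show "\<bar>jet_l \<Omega> x t p X\<bar> \<le> C"
    unfolding jet_l_def C_def gd_def[symmetric] Hd_def[symmetric] using cM by linarith
qed

text \<open>
  Doubly degenerate jets automatically have \<open>|X| \<rightarrow> \<infinity>\<close>, so the recession condition becomes
  a uniform strict inequality near \<open>x0\<close> at every jet that is almost doubly degenerate.
\<close>
lemma MRC_uniform:
  assumes mrc: "MRC_at \<Omega> \<theta> ub K r x0" and x0: "x0 \<in> frontier \<Omega>"
  shows "\<exists>\<tau>>0. \<exists>\<eta>>0. \<forall>x t p X. x \<in> collar \<Omega> r \<and> dist x x0 < \<eta> \<and> level_jet \<theta> K t p X \<and>
      jet_normal \<Omega> x t p X < \<eta> \<and> jet_Q \<Omega> ub x t p X < \<eta> \<longrightarrow>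
      \<eta> \<le> jet_J \<Omega> ub x t p X - \<tau> * jet_l \<Omega> x t p X"
proof -
  obtain \<tau> where \<tau>: "\<tau> > 0" and inf: "0 < (INF (j, g) \<in> recession_limits \<Omega> \<theta> ub K r x0. ereal (j + \<tau> * g))"
    using mrc unfolding MRC_at_def by blast
  obtain M where M7: "1 \<le> M" "\<And>x. x \<in> closure \<Omega> \<Longrightarrow> norm (gb x) \<le> M" "\<And>x. x \<in> closure \<Omega> \<Longrightarrow> norm (Hb x) \<le> M"
    "\<And>x i. x \<in> closure \<Omega> \<Longrightarrow> norm (Tb i x) \<le> M" "\<And>x. x \<in> half \<Longrightarrow> norm (Hd x) \<le> M"
    "\<And>x i. x \<in> half \<Longrightarrow> norm (Td i x) \<le> M" "\<And>p. p \<in> K \<Longrightarrow> norm p \<le> M"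
    by (rule uniform_bound) (rule that)
  note M = M7(1,2,3,5,7)
  define C where "C = 4 * jc (CARD('n)) M * M"
  show ?thesis
  proof (rule ccontr)
    assume neg: "\<not> ?thesis"
    \<comment> \<open>Failure of the inequality at scale \<open>e m\<close> supplies the m-th jet of
      a violating sequence. The cap r / 2 keeps its base point in \<open>half\<close>, where the
      quantities are bounded.\<close>
    define e where "e = (\<lambda>m::nat. min (r / 2) (1 / real (Suc m)))"
    have e: "0 < e m" "e m \<le> r / 2" "e m \<le> 1 / real (Suc m)" for m using r_pos by (auto simp: e_def)
    have "\<exists>x t p X. x \<in> collar \<Omega> r \<and> dist x x0 < e m \<and> level_jet \<theta> K t p X \<and>
      jet_normal \<Omega> x t p X < e m \<and> jet_Q \<Omega> ub x t p X < e m \<and>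
      jet_J \<Omega> ub x t p X - \<tau> * jet_l \<Omega> x t p X < e m" for m
    proof -
      have "\<not> (\<forall>x t p X. x \<in> collar \<Omega> r \<and> dist x x0 < e m \<and> level_jet \<theta> K t p X \<and>
      jet_normal \<Omega> x t p X < e m \<and> jet_Q \<Omega> ub x t p X < e m \<longrightarrow>
      e m \<le> jet_J \<Omega> ub x t p X - \<tau> * jet_l \<Omega> x t p X)"
        using neg \<tau> e(1) by blast
      then show ?thesis unfolding not_all not_imp not_le by blast
    qed
    then obtain x t p X where xm: "\<And>m. x m \<in> collar \<Omega> r" and dx: "\<And>m. dist (x m) x0 < e m"
      and lj: "\<And>m. level_jet \<theta> K (t m) (p m) (X m)"
      and jn: "\<And>m. jet_normal \<Omega> (x m) (t m) (p m) (X m) < e m"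
      and jQ: "\<And>m. jet_Q \<Omega> ub (x m) (t m) (p m) (X m) < e m"
      and jJ: "\<And>m. jet_J \<Omega> ub (x m) (t m) (p m) (X m) - \<tau> * jet_l \<Omega> (x m) (t m) (p m) (X m) < e m"
      by metis
    have B: "0 \<le> t m" "t m \<le> 1" "norm (p m) \<le> M" "X m \<in> Sym" for m using lj[of m] M(5) by (auto simp: level_jet_def)
    note JB = jet_bounds[OF B]
    have e0: "e \<longlonglongrightarrow> 0"
    proof (rule tendsto_sandwich[of "\<lambda>_. 0" e _ "\<lambda>m. 1 / real (Suc m)"])
      show "(\<lambda>m. 1 / real (Suc m)) \<longlonglongrightarrow> 0" using LIMSEQ_inverse_real_of_nat by (simp add: inverse_eq_divide)
      show "\<forall>\<^sub>F m in sequentially. 0 \<le> e m" by (intro always_eventually allI less_imp_le e(1))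
      show "\<forall>\<^sub>F m in sequentially. e m \<le> 1 / real (Suc m)" by (intro always_eventually allI e(3))
    qed simp
    have sq: "f \<longlonglongrightarrow> 0" if "\<And>m. 0 \<le> f m" "\<And>m. f m < e m" for f :: "nat \<Rightarrow> real"
    proof (rule tendsto_sandwich[of "\<lambda>_. 0" f _ e])
      show "\<forall>\<^sub>F m in sequentially. 0 \<le> f m" by (intro always_eventually allI that(1))
      show "\<forall>\<^sub>F m in sequentially. f m \<le> e m" by (intro always_eventually allI less_imp_le that(2))
    qed (use e0 in simp_all)
    have xh: "x m \<in> half" for m
    proof -
      have "bdist \<Omega> (x m) \<le> r / 2" using bdist_le[OF x0, of "x m"] dx[of m] e(2)[of m] by linarith
      then show ?thesis using collar_closure[OF xm[of m]] by (simp add: half_def)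
    qed
    have rec: "recession_sequence \<Omega> \<theta> ub K r x0 x t p X"
      unfolding recession_sequence_def
    proof (intro conjI allI)
      show "x m \<in> collar \<Omega> r" "level_jet \<theta> K (t m) (p m) (X m)" for m by (rule xm, rule lj)
      have "(\<lambda>m. dist (x m) x0) \<longlonglongrightarrow> 0" by (rule sq[OF zero_le_dist dx])
      then show "x \<longlonglongrightarrow> x0" by (rule iffD2[OF tendsto_dist_iff])
      show "(\<lambda>m. jet_normal \<Omega> (x m) (t m) (p m) (X m)) \<longlonglongrightarrow> 0"
        by (rule sq[OF _ jn]) (simp add: jet_normal_def Let_def JB(7))
      show "(\<lambda>m. jet_Q \<Omega> ub (x m) (t m) (p m) (X m)) \<longlonglongrightarrow> 0"
        by (rule sq[OF _ jQ]) (simp add: jet_Q_def Let_def JB(7))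
      \<comment> \<open>Coercivity at the unit vector Dd: an X of norm below Z would keep a(Dd,Dd)
        above a positive constant, whereas it is below 1/(m + 1).\<close>
      show "filterlim (\<lambda>m. op_norm (X m)) at_top sequentially"
        unfolding filterlim_at_top eventually_sequentially
      proof
        fix Z :: real
        obtain N :: nat where N: "(1 + M)^6 * (1 + Z\<^sup>2) \<le> real N" using real_arch_simple by blast
        have "Z \<le> op_norm (X m)" if m: "N \<le> m" for m
        proof (rule ccontr)
          assume "\<not> Z \<le> op_norm (X m)"
          then have "(op_norm (X m))\<^sup>2 \<le> Z\<^sup>2" using op_norm_nonneg[of "X m"] by (intro power_mono) auto
          then have "(1 + M)^6 * (1 + (op_norm (X m))\<^sup>2) \<le> (1 + M)^6 * (1 + Z\<^sup>2)"
            using M(1) by (intro mult_left_mono) auto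
          also have "\<dots> \<le> real (Suc m)" using N m by linarith
          finally have k: "(1 + M)^6 * (1 + (op_norm (X m))\<^sup>2) \<le> real (Suc m)" .
          have k0: "0 < (1 + M)^6 * (1 + (op_norm (X m))\<^sup>2)"
            using M(1) by (intro mult_pos_pos zero_less_power) (auto intro: add_pos_nonneg)
          have jn': "gd (x m) \<bullet> (G_X (t m) (p m) (X m) *v gd (x m)) < 1 / real (Suc m)"
            using jn[of m] e(3)[of m] by (simp add: jet_normal_def Let_def gd_def)
          have "1 \<le> (1 + M)^6 * (1 + (op_norm (X m))\<^sup>2) * (gd (x m) \<bullet> (G_X (t m) (p m) (X m) *v gd (x m)))"
            using JB(10)[of "gd (x m)" m] norm_gd[OF xm[of m]] by simp
          also have "\<dots> < (1 + M)^6 * (1 + (op_norm (X m))\<^sup>2) * (1 / real (Suc m))"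
            using k0 jn' by (rule mult_strict_left_mono[rotated])
          also have "\<dots> \<le> real (Suc m) * (1 / real (Suc m))" by (rule mult_right_mono[OF k]) simp
          also have "\<dots> = 1" by simp
          finally show False by simp
        qed
        then show "\<exists>N. \<forall>m\<ge>N. Z \<le> op_norm (X m)" by blast
      qed
    qed
    let ?J = "\<lambda>m. jet_J \<Omega> ub (x m) (t m) (p m) (X m)" and ?l = "\<lambda>m. - jet_l \<Omega> (x m) (t m) (p m) (X m)"
    have bd: "\<bar>?J m\<bar> \<le> C" "\<bar>?l m\<bar> \<le> C" for m
      using jet_J_l_bounds[OF M lj[of m] xh[of m]] by (simp_all add: C_def)
    have "bounded (range (\<lambda>m. (?J m, ?l m)))"
      unfolding bounded_iff
    proof (intro exI[of _ "C + C"] ballI)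
      fix z assume "z \<in> range (\<lambda>m. (?J m, ?l m))"
      then obtain m where "z = (?J m, ?l m)" by blast
      then show "norm z \<le> C + C" using norm_Pair_le[of "?J m" "?l m"] bd[of m] by simp
    qed
    \<comment> \<open>A convergent subsequence of the bounded pairs (J, -l) has its limit in
      \<open>recession_limits\<close>. There j + \<tau> g > 0 by the positive infimum, but j +
      \<tau> g <= 0 by the choice of the violating jets.\<close>
    then obtain jg k where k: "strict_mono (k :: nat \<Rightarrow> nat)" and lim: "((\<lambda>m. (?J m, ?l m)) \<circ> k) \<longlonglongrightarrow> jg"
      using bounded_imp_convergent_subsequence by blast
    obtain j g where jg: "jg = (j, g)" by (cases jg)
    have lj': "(\<lambda>m. ?J (k m)) \<longlonglongrightarrow> j" "(\<lambda>m. ?l (k m)) \<longlonglongrightarrow> g"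
      using tendsto_fst[OF lim] tendsto_snd[OF lim] by (simp_all add: jg o_def)
    then have "(j, g) \<in> recession_limits \<Omega> \<theta> ub K r x0"
      unfolding recession_limits_def using rec k by blast
    then have "(INF (j, g) \<in> recession_limits \<Omega> \<theta> ub K r x0. ereal (j + \<tau> * g)) \<le> ereal (j + \<tau> * g)"
      by (rule INF_lower2) simp
    then have pos: "0 < j + \<tau> * g" using inf by (metis ereal_less(2) order_less_le_trans)
    have l1: "(\<lambda>m. ?J (k m) + \<tau> * ?l (k m)) \<longlonglongrightarrow> j + \<tau> * g" by (intro tendsto_intros lj')
    have l2: "(\<lambda>m. e (k m)) \<longlonglongrightarrow> 0" using LIMSEQ_subseq_LIMSEQ[OF e0 k] by (simp add: o_def)
    have "j + \<tau> * g \<le> 0"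
    proof (rule tendsto_le[OF sequentially_bot l2 l1], intro always_eventually allI)
      show "?J (k m) + \<tau> * ?l (k m) \<le> e (k m)" for m using jJ[of "k m"] by simp
    qed
    with pos show False by simp
  qed
qed

end

section \<open>The mixed derivatives\<close>

lemma matrix_vector_nth: "((A :: real^'n^'m) *v h) $ k = A $ k \<bullet> h"
  by (simp add: matrix_vector_mult_def inner_vec_def)

lemma Sym_nth: "A \<in> Sym \<Longrightarrow> A $ i $ j = A $ j $ i"
  by (simp add: Sym_def transpose_def vec_eq_iff)

lemma Sym_axis: "A \<in> Sym \<Longrightarrow> A *v axis k 1 = A $ k"
  by (simp add: vec_eq_iff matrix_vector_nth inner_axis Sym_nth[of A k])

text \<open>Records the gradient at x and the value there of the operator a : D^2 + b . D with
  frozen coefficients, hiding the fields that witness them. A composite barrier can then be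
  evaluated by sum and product rules alone.\<close>

definition LU :: "(real^'n) set \<Rightarrow> real^'n^'n \<Rightarrow> real^'n \<Rightarrow> real^'n \<Rightarrow> (real^'n \<Rightarrow> real) \<Rightarrow> real^'n \<Rightarrow> real \<Rightarrow> bool"
  where "LU U a b x f g l \<longleftrightarrow> (\<exists>G H. jet2 U f G H \<and> G x = g \<and> mat_inner a (H x) + b \<bullet> g = l)"

lemma LU_I: "jet2 U f G H \<Longrightarrow> LU U a b x f (G x) (mat_inner a (H x) + b \<bullet> G x)"
  unfolding LU_def by blast

lemma LU_add:
  assumes "LU U a b x f1 g1 l1" "LU U a b x f2 g2 l2"
  shows "LU U a b x (\<lambda>x. f1 x + f2 x) (g1 + g2) (l1 + l2)"
proof -
  obtain G1 H1 G2 H2 where 1: "jet2 U f1 G1 H1" "G1 x = g1" "mat_inner a (H1 x) + b \<bullet> g1 = l1"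
    and 2: "jet2 U f2 G2 H2" "G2 x = g2" "mat_inner a (H2 x) + b \<bullet> g2 = l2"
    using assms unfolding LU_def by blast
  have "mat_inner a (H1 x + H2 x) + b \<bullet> (g1 + g2) = l1 + l2"
    unfolding 1(3)[symmetric] 2(3)[symmetric]
    by (simp add: linear_add[OF mat_inner_linear_right] inner_add_right)
  with LU_I[OF jet2_add[OF 1(1) 2(1)], of a b x] show ?thesis by (simp only: 1(2) 2(2))
qed

lemma LU_scale:
  assumes "LU U a b x f1 g1 l1"
  shows "LU U a b x (\<lambda>x. c * f1 x) (c *\<^sub>R g1) (c * l1)"
proof -
  obtain G1 H1 where 1: "jet2 U f1 G1 H1" "G1 x = g1" "mat_inner a (H1 x) + b \<bullet> g1 = l1"
    using assms unfolding LU_def by blast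
  have "mat_inner a (c *\<^sub>R H1 x) + b \<bullet> (c *\<^sub>R g1) = c * l1"
    unfolding 1(3)[symmetric]
    by (simp add: linear_scale[OF mat_inner_linear_right] distrib_left)
  with LU_I[OF jet2_scale[OF 1(1)], of a b x c] show ?thesis by (simp only: 1(2))
qed

lemma LU_diff:
  assumes "LU U a b x f1 g1 l1" "LU U a b x f2 g2 l2"
  shows "LU U a b x (\<lambda>x. f1 x - f2 x) (g1 - g2) (l1 - l2)"
  using LU_add[OF assms(1) LU_scale[OF assms(2), of "-1"]] by simp

text \<open>The cross term 2 a(Df1, Df2) gives squares in the barrier their sign; for products with
  gradient components of the solution it is the term that needs the bound on aX.\<close>

lemma LU_mult:
  assumes a: "a \<in> Sym" and "LU U a b x f1 g1 l1" "LU U a b x f2 g2 l2"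
  shows "LU U a b x (\<lambda>x. f1 x * f2 x) (f1 x *\<^sub>R g2 + f2 x *\<^sub>R g1) (f1 x * l2 + f2 x * l1 + 2 * (g1 \<bullet> (a *v g2)))"
proof -
  obtain G1 H1 G2 H2 where 1: "jet2 U f1 G1 H1" "G1 x = g1" "mat_inner a (H1 x) + b \<bullet> g1 = l1"
    and 2: "jet2 U f2 G2 H2" "G2 x = g2" "mat_inner a (H2 x) + b \<bullet> g2 = l2"
    using assms(2,3) unfolding LU_def by blast
  have o: "mat_inner a (outer p q) = p \<bullet> (a *v q)" for p q
    using mat_inner_outer[of p q a] Sym_inner[OF a, of q p] by (simp add: mat_inner_commute inner_commute)
  have s: "g2 \<bullet> (a *v g1) = g1 \<bullet> (a *v g2)" using Sym_inner[OF a, of g2 g1] by (simp add: inner_commute)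
  have "mat_inner a (f1 x *\<^sub>R H2 x + f2 x *\<^sub>R H1 x + outer g1 g2 + outer g2 g1) + b \<bullet> (f1 x *\<^sub>R g2 + f2 x *\<^sub>R g1)
      = f1 x * l2 + f2 x * l1 + 2 * (g1 \<bullet> (a *v g2))"
    unfolding 1(3)[symmetric] 2(3)[symmetric]
    by (simp add: linear_add[OF mat_inner_linear_right] linear_scale[OF mat_inner_linear_right] o s
        inner_add_right distrib_left)
  with LU_I[OF jet2_mult[OF 1(1) 2(1)], of a b x] show ?thesis by (simp only: 1(2) 2(2))
qed

lemma LU_norm_sq: "LU U a b x (\<lambda>x. (x - y) \<bullet> (x - y)) (2 *\<^sub>R (x - y)) (2 * mat_inner a (mat 1) + 2 * (b \<bullet> (x - y)))"
  using LU_I[OF jet2_norm_sq[of U y], of a b x] by (simp add: linear_scale[OF mat_inner_linear_right])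

lemma LU_min:
  assumes "open U" "x \<in> U" "\<And>y. y \<in> U \<Longrightarrow> f x \<le> f y" "\<And>Y. psd Y \<Longrightarrow> 0 \<le> mat_inner a Y" "LU U a b x f g l"
  shows "0 \<le> l"
proof -
  obtain G H where 1: "jet2 U f G H" "G x = g" "mat_inner a (H x) + b \<bullet> g = l"
    using assms(5) unfolding LU_def by blast
  from jet2_local_min[OF 1(1) assms(1-3)] show ?thesis using 1(2,3) assms(4)[of "H x"] by simp
qed

context c4_domain begin

lemma jet2_interior:
  assumes f: "\<And>x. x \<in> V \<Longrightarrow> (f has_derivative (\<lambda>h. g x \<bullet> h)) (at x within closure \<Omega>)"
    and g: "\<And>x. x \<in> V \<Longrightarrow> (g has_derivative (\<lambda>h. H x *v h)) (at x within closure \<Omega>)" and V: "V \<subseteq> \<Omega>"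
  shows "jet2 V f g H"
  unfolding jet2_def
proof (intro ballI conjI)
  fix x assume x: "x \<in> V"
  then have a: "at x within closure \<Omega> = at x" using V at_dom by blast
  show "(f has_derivative (\<lambda>h. g x \<bullet> h)) (at x)" "(g has_derivative (\<lambda>h. H x *v h)) (at x)"
    using f[OF x] g[OF x] unfolding a by simp_all
qed

end

section \<open>Solutions, their linearized equation and the barrier argument\<close>

locale homotopy_solution = homotopy_problem \<Omega> r \<theta> ub K
  for \<Omega> :: "(real^'n) set" and r \<theta> :: real and ub :: "real^'n \<Rightarrow> real" and K :: "(real^'n) set" +
  fixes t :: real and u :: "real^'n \<Rightarrow> real"
  assumes t: "0 \<le> t" "t \<le> 1" and sol: "solution \<Omega> \<theta> ub K t u"
begin

definition "gu = grad_on (closure \<Omega>) u"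
definition "Hu = hess_on (closure \<Omega>) u"
definition "Tu i = hess_on (closure \<Omega>) (\<lambda>x. gu x $ i)"

lemma C_u: "C_k_on 4 (closure \<Omega>) u" using sol by (simp add: solution_def)

lemmas u_C2 = C2_solid[OF solid_closure C_u[unfolded four_eq(1)], folded gu_def Hu_def]
lemmas gu_C2 = C2_solid[OF solid_closure u_C2(3)[unfolded numeral_2_eq_2], folded Tu_def]

lemma Hu_row_derivative:
  assumes x: "x \<in> closure \<Omega>"
  shows "((\<lambda>x. Hu x $ i) has_derivative (\<lambda>h. Tu i x *v h)) (at x within closure \<Omega>)"
  by (rule has_derivative_transform[OF x _ gu_C2(2)[OF x]]) (simp add: u_C2(5))

lemma Hu_derivative:
  assumes x: "x \<in> closure \<Omega>"
  shows "(Hu has_derivative (\<lambda>h. \<chi> i. Tu i x *v h)) (at x within closure \<Omega>)"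
  by (rule has_derivative_vecI) (simp add: Hu_row_derivative[OF x])

lemma Hu_Sym_dom: assumes x: "x \<in> \<Omega>" shows "Hu x \<in> Sym"
proof (rule hessian_symmetric[OF open_dom x])
  show "(u has_derivative (\<lambda>h. gu y \<bullet> h)) (at y)" if "y \<in> \<Omega>" for y
    using u_C2(1)[OF dom_closure[OF that]] at_dom[OF that] by simp
  show "(gu has_derivative (\<lambda>h. Hu x *v h)) (at x)"
    using u_C2(2)[OF dom_closure[OF x]] at_dom[OF x] by simp
qed

lemma Tu_Sym_dom: assumes x: "x \<in> \<Omega>" shows "Tu i x \<in> Sym"
proof (rule hessian_symmetric[OF open_dom x])
  show "((\<lambda>x. gu x $ i) has_derivative (\<lambda>h. Hu y $ i \<bullet> h)) (at y)" if "y \<in> \<Omega>" for y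
    using has_derivative_nth[OF u_C2(2)[OF dom_closure[OF that]], of i] at_dom[OF that] by (simp add: matrix_vector_nth)
  show "((\<lambda>x. Hu x $ i) has_derivative (\<lambda>h. Tu i x *v h)) (at x)"
    using Hu_row_derivative[OF dom_closure[OF x]] at_dom[OF x] by simp
qed

lemma gu_K: "x \<in> closure \<Omega> \<Longrightarrow> gu x \<in> K" using sol unfolding solution_def gu_def by blast

lemma level_jet_dom: "x \<in> \<Omega> \<Longrightarrow> level_jet \<theta> K t (gu x) (Hu x)"
  using sol t Hu_Sym_dom gu_K dom_closure unfolding level_jet_def solution_def gu_def Hu_def by auto

text \<open>The Hessian is symmetric throughout the open set \<Omega>, so the equal entries (i,k)
  and (k,i) have equal derivatives.\<close>

lemma Tu_swap: assumes x: "x \<in> \<Omega>" shows "Tu i x $ k = Tu k x $ i"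
proof -
  have D: "((\<lambda>y. Hu y $ i $ k) has_derivative (\<lambda>h. Tu i x $ k \<bullet> h)) (at x within \<Omega>)" for i k
    using has_derivative_subset[OF has_derivative_nth[OF Hu_row_derivative[OF dom_closure[OF x], of i], of k] closure_subset]
    by (simp add: matrix_vector_nth)
  have "((\<lambda>y. Hu y $ k $ i) has_derivative (\<lambda>h. Tu i x $ k \<bullet> h)) (at x within \<Omega>)"
    by (rule has_derivative_transform[OF x _ D]) (simp add: Sym_nth[OF Hu_Sym_dom])
  from has_derivative_unique[OF this[unfolded at_within_open[OF x open_dom]] D[unfolded at_within_open[OF x open_dom]]]
  have "Tu i x $ k \<bullet> h = Tu k x $ i \<bullet> h" for h by metis
  then show ?thesis using vector_eq_rdot by blast
qed

text \<open>The equation is differentiated in direction e_k. Symmetry of the third derivatives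
  identifies the derivative of the Hessian in that direction with the Hessian of the k-th component
  of Du.\<close>

lemma linearized:
  assumes x: "x \<in> \<Omega>"
  shows "mat_inner (G_X t (gu x) (Hu x)) (Tu k x) + G_p t (gu x) (Hu x) \<bullet> (Hu x $ k) = 0"
proof -
  let ?a = "amat (t *\<^sub>R gu x) (Hu x)" and ?b = "bvec (t *\<^sub>R gu x) (Hu x)"
  note S = Hu_Sym_dom and xc = dom_closure[OF x]
  have "((\<lambda>y. G_fun t (gu y) (Hu y)) has_derivative
      (\<lambda>v. t * (?b \<bullet> (Hu x *v v)) + mat_inner ?a (\<chi> i. Tu i x *v v))) (at x within \<Omega>)"
    by (rule G_fun_has_derivative[OF has_derivative_subset[OF u_C2(2)[OF xc] closure_subset]
          has_derivative_subset[OF Hu_derivative[OF xc] closure_subset] S x])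
  moreover have "((\<lambda>y. G_fun t (gu y) (Hu y)) has_derivative (\<lambda>v. 0)) (at x within \<Omega>)"
    by (rule has_derivative_transform[OF x, of _ "\<lambda>_. \<theta>"])
      (use level_jet_dom in \<open>auto simp: level_jet_def\<close>)
  ultimately have "(\<lambda>v. t * (?b \<bullet> (Hu x *v v)) + mat_inner ?a (\<chi> i. Tu i x *v v)) = (\<lambda>v. 0)"
    unfolding at_within_open[OF x open_dom] by (rule has_derivative_unique)
  from fun_cong[OF this, of "axis k 1"]
  have "t * (?b \<bullet> (Hu x $ k)) + mat_inner ?a (\<chi> i. Tu i x *v axis k 1) = 0"
    by (simp add: Sym_axis[OF S[OF x]])
  moreover have "(\<chi> i. Tu i x *v axis k 1) = Tu k x"
    by (simp add: vec_eq_iff Sym_axis[OF Tu_Sym_dom[OF x]] Tu_swap[OF x, of _ k])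
  ultimately show ?thesis by (simp add: G_X_eq[OF S[OF x]] G_p_eq[OF S[OF x]])
qed

abbreviation (input) "h \<equiv> \<lambda>x. u x - ub x"
definition "gh x = gu x - gb x"

lemma h_frontier: "x \<in> frontier \<Omega> \<Longrightarrow> u x - ub x = 0" using sol by (simp add: solution_def)
lemma h_nonneg: "x \<in> closure \<Omega> \<Longrightarrow> 0 \<le> u x - ub x"
  using closure_cases[of x] h_frontier[of x] sol by (auto simp: solution_def)

lemma h_derivative: "x \<in> closure \<Omega> \<Longrightarrow> (h has_derivative (\<lambda>k. gh x \<bullet> k)) (at x within closure \<Omega>)"
  using has_derivative_diff[OF u_C2(1) ub_C2(1)] by (simp add: gh_def inner_diff_left)

text \<open>h vanishes along the frontier, so its gradient has no tangential part; tangential fields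
  therefore annihilate h there.\<close>

lemma gh_frontier:
  assumes z: "z \<in> frontier \<Omega>" shows "gh z = (gh z \<bullet> gd z) *\<^sub>R gd z"
proof -
  note N = inward_normal[OF z, folded gd_frontier[OF z]]
  have nn: "gd z \<bullet> gd z = 1" using N(1) by (simp add: norm_eq_1)
  have 0: "(h has_derivative (\<lambda>k. 0)) (at z within frontier \<Omega>)"
    by (rule has_derivative_transform[OF z, of _ "\<lambda>_. 0"]) (auto simp: h_frontier)
  let ?v = "gh z - (gh z \<bullet> gd z) *\<^sub>R gd z"
  have v: "gd z \<bullet> ?v = 0" using nn by (simp add: inner_diff_right inner_commute)
  then have "?v \<in> tangent_space (frontier \<Omega>) z" by (simp add: N(2))
  from tangent_unique[OF this within_frontier[OF h_derivative[OF frontier_closure[OF z]]] 0]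
  have "gh z \<bullet> ?v = 0" .
  then have "?v \<bullet> ?v = 0" using v by (simp add: inner_diff_left)
  then show ?thesis by simp
qed

text \<open>
  The fields \<open>\<partial>\<^sub>jd e\<^sub>i - \<partial>\<^sub>id e\<^sub>j\<close> are tangential on the boundary, so the derivatives of \<open>u - ub\<close>
  along them vanish there; the barrier is \<open>h + \<tau> d - N d\<^sup>2 - N h\<^sup>2\<close> with \<open>h = u - ub\<close>.
\<close>
lemma mixed_at:
  fixes M \<tau> \<eta> N \<delta> A Bq :: real
  defines "c \<equiv> jc (CARD('n)) M" and "CJ \<equiv> 4 * jc (CARD('n)) M * M"
  assumes M: "1 \<le> M" "\<And>x. x \<in> closure \<Omega> \<Longrightarrow> norm (gb x) \<le> M" "\<And>x. x \<in> closure \<Omega> \<Longrightarrow> norm (Hb x) \<le> M"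
    "\<And>x i. x \<in> closure \<Omega> \<Longrightarrow> norm (Tb i x) \<le> M" "\<And>x. x \<in> half \<Longrightarrow> norm (Hd x) \<le> M"
    "\<And>x i. x \<in> half \<Longrightarrow> norm (Td i x) \<le> M" "\<And>p. p \<in> K \<Longrightarrow> norm p \<le> M"
    and pos: "0 < \<tau>" "0 < \<eta>" "0 < \<delta>" "0 \<le> N" "0 \<le> Bq" "0 \<le> A"
    and deg: "\<forall>x t p X. x \<in> collar \<Omega> r \<and> dist x x0 < \<eta> \<and> level_jet \<theta> K t p X \<and>
      jet_normal \<Omega> x t p X < \<eta> \<and> jet_Q \<Omega> ub x t p X < \<eta> \<longrightarrow>
      \<eta> \<le> jet_J \<Omega> ub x t p X - \<tau> * jet_l \<Omega> x t p X"
    and y: "y \<in> frontier \<Omega>" "dist y x0 < \<eta> / 2"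
    and N: "CJ * (1 + \<tau>) + \<eta> \<le> 2 * N * \<eta>"
    and \<delta>: "\<delta> \<le> \<eta> / 2" "\<delta> \<le> r / 2" "2 * N * CJ * (1 + 2 * M) * \<delta> \<le> \<eta> / 2" "2 * M * N * \<delta> \<le> 1" "N * \<delta> \<le> \<tau>"
    and Bq: "4 * M \<le> Bq * \<delta>\<^sup>2"
    and A: "Bq * (2 * c * norm (mat 1 :: real^'n^'n) + 2 * c * \<delta>) + 20 * c * M\<^sup>2 < A * (\<eta> / 2)"
  shows "\<bar>gd y $ j * (Hu y *v gd y) $ i - gd y $ i * (Hu y *v gd y) $ j\<bar> \<le> A * (2 * M + \<tau>) + 2 * M + 4 * M\<^sup>2"
proof -
  let ?d = "bdist \<Omega>"
  define \<psi> where "\<psi> = (\<lambda>x. h x + \<tau> * ?d x - N * (?d x * ?d x) - N * (h x * h x))"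
  define v where "v = (\<lambda>x. gd x $ j * (gu x $ i - gb x $ i) - gd x $ i * (gu x $ j - gb x $ j))"
  \<comment> \<open>The quadratic penalty localizes at the contact point y: with
    \<open>Bq * \<delta>\<^sup>2 \<ge> 4 * M\<close> it exceeds |v| on the sphere of radius
    \<delta>. The sign s = 1 or -1 will give a two-sided bound.\<close>
  define \<phi> where "\<phi> = (\<lambda>s x. A * \<psi> x + Bq * ((x - y) \<bullet> (x - y)) + s * v x)"
  define Z where "Z = closure \<Omega> \<inter> cball y \<delta>"
  define V where "V = \<Omega> \<inter> ball y \<delta>"
  have M0: "0 \<le> M" using M(1) by linarith
  have c1: "1 \<le> c" unfolding c_def using jet_bounds(1)[OF t M(7)[OF gu_K[OF frontier_closure[OF y(1)]]] symm_Sym] .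
  have c0: "0 \<le> c" using c1 by linarith
  have Vopen: "open V" using open_dom by (simp add: V_def open_Int)
  have VO: "V \<subseteq> \<Omega>" by (auto simp: V_def)
  have yZ: "y \<in> Z" using y frontier_closure pos by (simp add: Z_def)
  have Zh: "x \<in> half" if "x \<in> Z" for x
    using that bdist_le[OF y(1), of x] \<delta>(2) by (simp add: Z_def half_def dist_commute)
  have Zd: "?d x \<le> \<delta>" if "x \<in> Z" for x
    using that bdist_le[OF y(1), of x] by (simp add: Z_def dist_commute)
  have ngu: "norm (gu x) \<le> M" if "x \<in> closure \<Omega>" for x using M(7) gu_K that by blast
  have ngh: "norm (gh x) \<le> 2 * M" if "x \<in> closure \<Omega>" for x
    using norm_triangle_ineq4[of "gu x" "gb x"] ngu[OF that] M(2)[OF that] by (simp add: gh_def)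
  have hd: "h x \<le> 2 * M * ?d x" if "x \<in> closure \<Omega>" for x
    using vanishing_le_bdist[OF h_derivative ngh h_frontier that] by simp
  have nth: "\<bar>w $ k\<bar> \<le> norm w" for w :: "real^'n" and k by (rule component_le_norm_cart)
  have row: "norm (T $ k) \<le> norm T" for T :: "real^'n^'n" and k by (rule Finite_Cartesian_Product.norm_nth_le)
  have gd1: "\<bar>gd x $ k\<bar> \<le> 1" if "x \<in> half" for x k
    using nth[of "gd x" k] norm_gd[OF half_collar[OF that]] by simp
  have ghk: "\<bar>gu x $ k - gb x $ k\<bar> \<le> 2 * M" if "x \<in> closure \<Omega>" for x k
    using nth[of "gh x" k] ngh[OF that] by (simp add: gh_def)

  have v_frontier: "v z = 0" if z: "z \<in> frontier \<Omega>" for z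
  proof -
    have "gh z $ k = (gh z \<bullet> gd z) * gd z $ k" for k
      using arg_cong[OF gh_frontier[OF z], of "\<lambda>w. w $ k"] by simp
    then have "gu z $ k - gb z $ k = (gh z \<bullet> gd z) * gd z $ k" for k by (simp add: gh_def)
    then show ?thesis by (simp add: v_def)
  qed
  have v_bound: "\<bar>v x\<bar> \<le> 4 * M" if x: "x \<in> Z" for x
  proof -
    have xc: "x \<in> closure \<Omega>" using x by (simp add: Z_def)
    have 1: "\<bar>gd x $ k * (gu x $ l - gb x $ l)\<bar> \<le> 1 * (2 * M)" for k l
      unfolding abs_mult by (intro mult_mono gd1 Zh x ghk xc) auto
    show ?thesis using 1[of j i] 1[of i j] unfolding v_def by linarith
  qed
  \<comment> \<open>The choice of \<delta> makes N h <= 1 and N d <= \<tau>, so each subtracted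
    square is dominated by its linear term.\<close>
  have psi_nonneg: "0 \<le> \<psi> x" if x: "x \<in> Z" for x
  proof -
    have xc: "x \<in> closure \<Omega>" using x by (simp add: Z_def)
    have d0: "0 \<le> ?d x" by (rule bdist_nonneg)
    have "h x \<le> 2 * M * \<delta>" using hd[OF xc] mult_left_mono[OF Zd[OF x], of "2 * M"] M0 by linarith
    then have "N * h x \<le> 2 * M * N * \<delta>" using mult_left_mono[of "h x" "2 * M * \<delta>" N] pos by (simp add: mult_ac)
    then have "N * h x \<le> 1" using \<delta>(4) by linarith
    then have "N * h x * h x \<le> 1 * h x" using h_nonneg[OF xc] by (rule mult_right_mono)
    moreover have "N * ?d x \<le> \<tau>" using mult_left_mono[OF Zd[OF x] pos(4)] \<delta>(5) by linarith
    then have "N * ?d x * ?d x \<le> \<tau> * ?d x" using d0 by (rule mult_right_mono)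
    ultimately show ?thesis by (simp add: \<psi>_def mult.assoc)
  qed
  have psi_frontier: "\<psi> z = 0" if "z \<in> frontier \<Omega>" for z
    using h_frontier[OF that] bdist_frontier[OF that] by (simp add: \<psi>_def)

  have interior: "\<exists>g l. LU V (G_X t (gu x) (Hu x)) (G_p t (gu x) (Hu x)) x (\<phi> s) g l \<and> l < 0"
    if x: "x \<in> V" and s: "\<bar>s\<bar> = 1" for x s
  proof -
    let ?X = "Hu x" and ?a = "G_X t (gu x) (Hu x)" and ?b = "G_p t (gu x) (Hu x)"
    have xO: "x \<in> \<Omega>" and xc: "x \<in> closure \<Omega>" and xZ: "x \<in> Z"
      using x dom_closure by (auto simp: V_def Z_def)
    note xh = Zh[OF xZ] and lj = level_jet_dom[OF xO] and XS = Hu_Sym_dom[OF xO]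
    have xcol: "x \<in> collar \<Omega> r" by (rule half_collar[OF xh])
    have dx0: "dist x x0 < \<eta>"
    proof -
      have "dist y x < \<delta>" using x by (simp add: V_def)
      then show ?thesis using dist_triangle[of x x0 y] y(2) \<delta>(1) by (simp add: dist_commute)
    qed
    note JB = jet_bounds[OF t ngu[OF xc] XS, folded c_def]
    note JL = jet_J_l_bounds[OF M(1,2,3,5,7) lj xh, folded CJ_def]
    let ?J = "jet_J \<Omega> ub x t (gu x) ?X" and ?l = "jet_l \<Omega> x t (gu x) ?X"
      and ?jn = "jet_normal \<Omega> x t (gu x) ?X" and ?Q = "jet_Q \<Omega> ub x t (gu x) ?X"
    have LUf: "LU V ?a ?b x f (g x) (mat_inner ?a (H x) + ?b \<bullet> g x)"
      if "\<And>x. x \<in> V \<Longrightarrow> (f has_derivative (\<lambda>h. g x \<bullet> h)) (at x within closure \<Omega>)"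
        "\<And>x. x \<in> V \<Longrightarrow> (g has_derivative (\<lambda>h. H x *v h)) (at x within closure \<Omega>)" for f g H
      by (rule LU_I[OF jet2_interior[OF that VO]])
    have Vc: "z \<in> closure \<Omega>" "z \<in> collar \<Omega> r" if "z \<in> V" for z
      using that half_collar[OF Zh[of z]] dom_closure by (auto simp: V_def Z_def)
    have Lu: "LU V ?a ?b x u (gu x) (mat_inner ?a ?X + ?b \<bullet> gu x)"
      by (rule LUf[OF u_C2(1) u_C2(2)]) (simp_all add: Vc)
    have Lub: "LU V ?a ?b x ub (gb x) (mat_inner ?a (Hb x) + ?b \<bullet> gb x)"
      by (rule LUf[OF ub_C2(1) ub_C2(2)]) (simp_all add: Vc)
    have Lh: "LU V ?a ?b x h (gh x) (- ?J)"
    proof -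
      have "mat_inner ?a ?X + ?b \<bullet> gu x - (mat_inner ?a (Hb x) + ?b \<bullet> gb x) = - ?J"
        unfolding jet_J_def gb_def[symmetric] Hb_def[symmetric]
        by (simp add: linear_diff[OF mat_inner_linear_right] inner_diff_right)
      with LU_diff[OF Lu Lub] show ?thesis by (simp only: gh_def)
    qed
    have Ld: "LU V ?a ?b x ?d (gd x) ?l"
      unfolding jet_l_def gd_def[symmetric] Hd_def[symmetric]
      by (rule LUf[OF d_C2(1) d_C2(2)]) (simp_all add: Vc)
    \<comment> \<open>The operator takes h to -J and d to l; squaring d and h adds 2 a(Dd,Dd) and 2
      a(Dh,Dh), which are twice \<open>jet_normal\<close> and \<open>jet_Q\<close>.\<close>
    have Lpsi: "\<exists>g. LU V ?a ?b x \<psi> g (- ?J + \<tau> * ?l - N * (?d x * ?l + ?d x * ?l + 2 * ?jn) - N * (h x * - ?J + h x * - ?J + 2 * ?Q))"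
    proof -
      have "gh x \<bullet> (?a *v gh x) = ?Q" by (simp add: jet_Q_def Let_def gh_def gb_def)
      moreover have "gd x \<bullet> (?a *v gd x) = ?jn" by (simp add: jet_normal_def Let_def gd_def)
      ultimately show ?thesis
        using LU_diff[OF LU_diff[OF LU_add[OF Lh LU_scale[OF Ld, of \<tau>]] LU_scale[OF LU_mult[OF JB(9) Ld Ld], of N]]
            LU_scale[OF LU_mult[OF JB(9) Lh Lh], of N]]
        unfolding \<psi>_def by metis
    qed
    have jn0: "0 \<le> ?jn" "0 \<le> ?Q" using JB(7) by (simp_all add: jet_normal_def jet_Q_def Let_def)
    \<comment> \<open>The products d l and h J are O(\<delta>) because h <= 2 M d, and they use up
      at most \<eta>/2 of the gain \<eta>.\<close>
    have psi_l: "- ?J + \<tau> * ?l - N * (?d x * ?l + ?d x * ?l + 2 * ?jn) - N * (h x * - ?J + h x * - ?J + 2 * ?Q) \<le> - (\<eta> / 2)"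
    proof -
      have d: "0 \<le> ?d x" "?d x \<le> \<delta>" using bdist_nonneg Zd[OF xZ] by auto
      have h: "0 \<le> h x" "h x \<le> 2 * M * \<delta>"
        using h_nonneg[OF xc] hd[OF xc] mult_left_mono[OF d(2), of "2 * M"] M0 by auto
      have CJ0: "0 \<le> CJ" using JL(1) by linarith
      have "\<bar>?d x * ?l\<bar> \<le> \<delta> * CJ" unfolding abs_mult using d JL(2) CJ0 by (intro mult_mono) auto
      moreover have "\<bar>h x * ?J\<bar> \<le> 2 * M * \<delta> * CJ" unfolding abs_mult using h JL(1) CJ0 by (intro mult_mono) auto
      ultimately have "- (2 * (?d x * ?l)) + 2 * (h x * ?J) \<le> 2 * (CJ * (1 + 2 * M) * \<delta>)" by (simp add: algebra_simps)
      then have "N * (- (2 * (?d x * ?l)) + 2 * (h x * ?J)) \<le> N * (2 * (CJ * (1 + 2 * M) * \<delta>))"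
        using pos(4) by (rule mult_left_mono)
      also have "\<dots> \<le> \<eta> / 2" using \<delta>(3) by (simp add: mult_ac)
      finally have err: "N * (- (2 * (?d x * ?l)) + 2 * (h x * ?J)) \<le> \<eta> / 2" .
      have main: "- (?J - \<tau> * ?l) - 2 * (N * ?jn) - 2 * (N * ?Q) \<le> - \<eta>"
      \<comment> \<open>If both forms are small, the uniform recession inequality yields the gain.
        Otherwise their sum is at least \<eta>, and 2 N \<eta> outweighs the bound CJ (1 + \<tau>)
        on the remaining terms.\<close>
      proof (cases "?jn < \<eta> \<and> ?Q < \<eta>")
        case True
        then have "\<eta> \<le> ?J - \<tau> * ?l" using deg xcol dx0 lj by blast
        moreover have "0 \<le> N * ?jn" "0 \<le> N * ?Q" using jn0 pos by simp_all
        ultimately show ?thesis by linarith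
      next
        case False
        then have "\<eta> \<le> ?jn + ?Q" using jn0 by linarith
        then have "N * \<eta> \<le> N * ?jn + N * ?Q" using mult_left_mono[OF _ pos(4), of \<eta> "?jn + ?Q"] by (simp add: distrib_left)
        moreover have "- (?J - \<tau> * ?l) \<le> CJ * (1 + \<tau>)"
        proof -
          have "\<bar>\<tau> * ?l\<bar> \<le> \<tau> * CJ" unfolding abs_mult using pos JL(2) by (intro mult_mono) auto
          then show ?thesis using JL(1) by (simp add: algebra_simps)
        qed
        ultimately show ?thesis using N by linarith
      qed
      show ?thesis using err main by (simp add: algebra_simps)
    qed
    have Lgu: "LU V ?a ?b x (\<lambda>x. gu x $ k) (?X $ k) 0" for k
    proof -
      have "LU V ?a ?b x (\<lambda>x. gu x $ k) (?X $ k) (mat_inner ?a (Tu k x) + ?b \<bullet> (?X $ k))"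
      proof (rule LUf)
        show "((\<lambda>x. gu x $ k) has_derivative (\<lambda>h. Hu z $ k \<bullet> h)) (at z within closure \<Omega>)" if "z \<in> V" for z
          using has_derivative_nth[OF u_C2(2)[OF Vc(1)[OF that]], of k] by (simp add: matrix_vector_nth)
        show "((\<lambda>x. Hu x $ k) has_derivative (\<lambda>h. Tu k z *v h)) (at z within closure \<Omega>)" if "z \<in> V" for z
          by (rule Hu_row_derivative[OF Vc(1)[OF that]])
      qed
      then show ?thesis by (simp only: linearized[OF xO])
    qed
    have bb: "\<bar>?b \<bullet> w\<bar> \<le> c * m" if "norm w \<le> m" for w m
    proof -
      have "\<bar>?b \<bullet> w\<bar> \<le> norm ?b * norm w" by (rule Cauchy_Schwarz_ineq2)
      also have "\<dots> \<le> c * m" using JB(6) that c0 by (intro mult_mono) auto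
      finally show ?thesis .
    qed
    have low: "\<bar>mat_inner ?a T + ?b \<bullet> w\<bar> \<le> 2 * (c * M)" if "norm T \<le> M" "norm w \<le> M" for T w
      using JB(3)[of T] mult_left_mono[OF that(1) c0] bb[OF that(2)] by linarith
    have Lgb: "\<exists>l. LU V ?a ?b x (\<lambda>x. gb x $ k) (Hb x $ k) l \<and> \<bar>l\<bar> \<le> 2 * (c * M)" for k
    proof -
      have "LU V ?a ?b x (\<lambda>x. gb x $ k) (Hb x $ k) (mat_inner ?a (Tb k x) + ?b \<bullet> (Hb x $ k))"
      proof (rule LUf)
        show "((\<lambda>x. gb x $ k) has_derivative (\<lambda>h. Hb z $ k \<bullet> h)) (at z within closure \<Omega>)" if "z \<in> V" for z
          using has_derivative_nth[OF ub_C2(2)[OF Vc(1)[OF that]], of k] by (simp add: matrix_vector_nth)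
        show "((\<lambda>x. Hb x $ k) has_derivative (\<lambda>h. Tb k z *v h)) (at z within closure \<Omega>)" if "z \<in> V" for z
          by (rule has_derivative_transform[OF Vc(1)[OF that] _ gb_C2(2)[OF Vc(1)[OF that]]]) (simp add: ub_C2(5))
      qed
      moreover have "norm (Hb x $ k) \<le> M" using row[of "Hb x" k] M(3)[OF xc] by linarith
      ultimately show ?thesis using low[OF M(4)[OF xc]] by blast
    qed
    have Lgd: "\<exists>l. LU V ?a ?b x (\<lambda>x. gd x $ k) (Hd x $ k) l \<and> \<bar>l\<bar> \<le> 2 * (c * M)" for k
    proof -
      have "LU V ?a ?b x (\<lambda>x. gd x $ k) (Hd x $ k) (mat_inner ?a (Td k x) + ?b \<bullet> (Hd x $ k))"
      proof (rule LUf)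
        show "((\<lambda>x. gd x $ k) has_derivative (\<lambda>h. Hd z $ k \<bullet> h)) (at z within closure \<Omega>)" if "z \<in> V" for z
          using has_derivative_nth[OF d_C2(2)[OF Vc(2)[OF that]], of k] by (simp add: matrix_vector_nth)
        show "((\<lambda>x. Hd x $ k) has_derivative (\<lambda>h. Td k z *v h)) (at z within closure \<Omega>)" if z: "z \<in> V" for z
        proof -
          have "((\<lambda>x. Hd x $ k) has_derivative (\<lambda>h. Td k z *v h)) (at z within collar \<Omega> r)"
            by (rule has_derivative_transform[OF Vc(2)[OF z] _
                  gd_C2(2)[OF Vc(2)[OF z], of k, unfolded at_collar[OF Vc(2)[OF z], symmetric]]]) (simp add: d_C2(5))
          then show ?thesis by (simp only: at_collar[OF Vc(2)[OF z]])
        qed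
      qed
      moreover have "norm (Hd x $ k) \<le> M" using row[of "Hd x" k] M(5)[OF xh] by linarith
      ultimately show ?thesis using low[OF M(6)[OF xh]] by blast
    qed
    \<comment> \<open>The only unbounded ingredient is the row \<open>?X $ m\<close> in the cross
      term, and it is controlled through aX. As M >= 1, the pieces add up to 2 + 4 + 2 (1 + 1) = 10
      multiples of c M^2.\<close>
    have Lpair: "\<exists>g l. LU V ?a ?b x (\<lambda>x. gd x $ k * (gu x $ m - gb x $ m)) g l \<and> \<bar>l\<bar> \<le> 10 * (c * M\<^sup>2)" for k m
    proof -
      obtain l1 where l1: "LU V ?a ?b x (\<lambda>x. gb x $ m) (Hb x $ m) l1" "\<bar>l1\<bar> \<le> 2 * (c * M)" using Lgb by blast
      obtain l2 where l2: "LU V ?a ?b x (\<lambda>x. gd x $ k) (Hd x $ k) l2" "\<bar>l2\<bar> \<le> 2 * (c * M)" using Lgd by blast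
      let ?l = "gd x $ k * (0 - l1) + (gu x $ m - gb x $ m) * l2 + 2 * (Hd x $ k \<bullet> (?a *v (?X $ m - Hb x $ m)))"
      have L: "LU V ?a ?b x (\<lambda>x. gd x $ k * (gu x $ m - gb x $ m))
          (gd x $ k *\<^sub>R (?X $ m - Hb x $ m) + (gu x $ m - gb x $ m) *\<^sub>R (Hd x $ k)) ?l"
        by (rule LU_mult[OF JB(9) l2(1) LU_diff[OF Lgu l1(1)]])
      have cM: "0 \<le> c * M" using c0 M0 by simp
      have nHd: "norm (Hd x $ k) \<le> M" using row[of "Hd x" k] M(5)[OF xh] by linarith
      have nHb: "norm (Hb x $ m) \<le> M" using row[of "Hb x" m] M(3)[OF xc] by linarith
      have 1: "\<bar>gd x $ k * (0 - l1)\<bar> \<le> 1 * (2 * (c * M))"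
        unfolding abs_mult using l1(2) by (intro mult_mono gd1[OF xh]) auto
      have 2: "\<bar>(gu x $ m - gb x $ m) * l2\<bar> \<le> 2 * M * (2 * (c * M))"
        unfolding abs_mult using l2(2) M0 by (intro mult_mono ghk[OF xc]) auto
      have 3: "\<bar>Hd x $ k \<bullet> (?a *v (?X $ m))\<bar> \<le> c * M"
      proof -
        have "\<bar>Hd x $ k \<bullet> (?a *v (?X *v axis m 1))\<bar> \<le> c * (norm (Hd x $ k) * norm (axis m (1::real)))"
          by (rule JB(4))
        then show ?thesis using mult_left_mono[OF nHd c0] by (simp add: Sym_axis[OF XS])
      qed
      have 4: "\<bar>Hd x $ k \<bullet> (?a *v (Hb x $ m))\<bar> \<le> c * (M * M)"
      proof -
        have "norm (Hd x $ k) * norm (Hb x $ m) \<le> M * M" using nHd nHb M0 by (intro mult_mono) auto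
        then show ?thesis using JB(2)[of "Hd x $ k" "Hb x $ m"] mult_left_mono[OF _ c0] order_trans by blast
      qed
      have "c * M \<le> c * (M * M)" using mult_left_mono[OF M(1) cM] by (simp add: mult.assoc)
      moreover have "Hd x $ k \<bullet> (?a *v (?X $ m - Hb x $ m)) = Hd x $ k \<bullet> (?a *v (?X $ m)) - Hd x $ k \<bullet> (?a *v (Hb x $ m))"
        by (simp add: matrix_vector_mult_diff_distrib inner_diff_right)
      moreover have "2 * M * (2 * (c * M)) = 4 * (c * (M * M))" by simp
      ultimately have "\<bar>?l\<bar> \<le> 10 * (c * (M * M))" using 1 2 3 4 by linarith
      then show ?thesis using L by (auto simp: power2_eq_square)
    qed
    obtain gv lv where Lv: "LU V ?a ?b x v gv lv" and lv: "\<bar>lv\<bar> \<le> 20 * (c * M\<^sup>2)"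
    proof -
      obtain g1 l1 where 1: "LU V ?a ?b x (\<lambda>x. gd x $ j * (gu x $ i - gb x $ i)) g1 l1" "\<bar>l1\<bar> \<le> 10 * (c * M\<^sup>2)"
        using Lpair by blast
      obtain g2 l2 where 2: "LU V ?a ?b x (\<lambda>x. gd x $ i * (gu x $ j - gb x $ j)) g2 l2" "\<bar>l2\<bar> \<le> 10 * (c * M\<^sup>2)"
        using Lpair by blast
      have "\<bar>l1 - l2\<bar> \<le> 20 * (c * M\<^sup>2)" using 1(2) 2(2) by linarith
      with LU_diff[OF 1(1) 2(1)] show thesis by (intro that[of "g1 - g2" "l1 - l2"]) (simp_all only: v_def)
    qed
    obtain gp where gp: "LU V ?a ?b x \<psi> gp (- ?J + \<tau> * ?l - N * (?d x * ?l + ?d x * ?l + 2 * ?jn) - N * (h x * - ?J + h x * - ?J + 2 * ?Q))" (is "LU _ _ _ _ _ _ ?lp")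
      using Lpsi by blast
    have q: "2 * mat_inner ?a (mat 1) + 2 * (?b \<bullet> (x - y)) \<le> 2 * c * norm (mat 1 :: real^'n^'n) + 2 * c * \<delta>"
    proof -
      have "norm (x - y) \<le> \<delta>" using xZ by (simp add: Z_def dist_norm norm_minus_commute)
      from bb[OF this] show ?thesis using JB(3)[of "mat 1"] by linarith
    qed
    have "LU V ?a ?b x (\<phi> s) (A *\<^sub>R gp + Bq *\<^sub>R (2 *\<^sub>R (x - y)) + s *\<^sub>R gv)
        (A * ?lp + Bq * (2 * mat_inner ?a (mat 1) + 2 * (?b \<bullet> (x - y))) + s * lv)"
      unfolding \<phi>_def
      by (rule LU_add[OF LU_add[OF LU_scale[OF gp] LU_scale[OF LU_norm_sq]] LU_scale[OF Lv]])
    moreover have "A * ?lp + Bq * (2 * mat_inner ?a (mat 1) + 2 * (?b \<bullet> (x - y))) + s * lv < 0"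
    proof -
      have e1: "A * ?lp \<le> A * (- (\<eta> / 2))" using psi_l pos(6) by (rule mult_left_mono)
      have e2: "Bq * (2 * mat_inner ?a (mat 1) + 2 * (?b \<bullet> (x - y))) \<le> Bq * (2 * c * norm (mat 1 :: real^'n^'n) + 2 * c * \<delta>)"
        using q pos(5) by (rule mult_left_mono)
      have e3: "s * lv \<le> 20 * (c * M\<^sup>2)"
      proof -
        have "\<bar>s * lv\<bar> = \<bar>lv\<bar>" using s by (simp add: abs_mult)
        then show ?thesis using lv by linarith
      qed
      have "A * (- (\<eta> / 2)) + Bq * (2 * c * norm (mat 1 :: real^'n^'n) + 2 * c * \<delta>) + 20 * (c * M\<^sup>2) < 0"
        using A unfolding mult_minus_right mult.assoc by linarith
      with add_mono[OF add_mono[OF e1 e2] e3] show ?thesis by (rule order_le_less_trans)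
    qed
    ultimately show ?thesis by blast
  qed

  have contZ: "continuous_on Z (\<phi> s)" for s
  proof -
    have Zc: "Z \<subseteq> closure \<Omega>" by (simp add: Z_def)
    have Zcol: "Z \<subseteq> collar \<Omega> r" using half_collar[OF Zh] by blast
    note cu = continuous_on_subset[OF C_k_on_continuous[OF C_u] Zc] continuous_on_subset[OF C_k_on_continuous[OF C_ub] Zc]
      continuous_on_subset[OF C_k_on_continuous[OF u_C2(3)] Zc] continuous_on_subset[OF C_k_on_continuous[OF ub_C2(3)] Zc]
    note cd = continuous_on_subset[OF C_k_on_continuous[OF C_d] Zcol] continuous_on_subset[OF C_k_on_continuous[OF d_C2(3)] Zcol]
    show ?thesis unfolding \<phi>_def \<psi>_def v_def 
      by (intro continuous_on_add continuous_on_diff continuous_on_mult continuous_on_inner continuous_on_const continuous_on_id cu cd)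
  qed
  have compZ: "compact Z" unfolding Z_def by (intro compact_Int_closed compact_closure_dom closed_cball)
  \<comment> \<open>Minimum principle on \<open>Z\<close>: a minimum in \<open>V\<close> contradicts
    the strict negativity of the operator, on the sphere the penalty exceeds |v|, and on the
    frontier only the nonnegative penalty remains.\<close>
  have phi_nonneg: "0 \<le> \<phi> s x" if x: "x \<in> Z" and s: "\<bar>s\<bar> = 1" for s x
  proof -
    obtain z where z: "z \<in> Z" and zmin: "\<And>w. w \<in> Z \<Longrightarrow> \<phi> s z \<le> \<phi> s w"
      using continuous_attains_inf[OF compZ _ contZ[of s]] yZ by blast
    have zc: "z \<in> closure \<Omega>" using z by (simp add: Z_def)
    have "0 \<le> \<phi> s z"
    proof (cases "z \<in> V")
      case True
      obtain g l where gl: "LU V (G_X t (gu z) (Hu z)) (G_p t (gu z) (Hu z)) z (\<phi> s) g l" "l < 0"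
        using interior[OF True s] by blast
      have zO: "z \<in> \<Omega>" using True by (simp add: V_def)
      note JB = jet_bounds[OF t ngu[OF zc] Hu_Sym_dom[OF zO]]
      have "0 \<le> l"
      proof (rule LU_min[OF Vopen True _ JB(8) gl(1)])
        fix w assume "w \<in> V"
        then have "w \<in> Z" using dom_closure by (auto simp: V_def Z_def)
        then show "\<phi> s z \<le> \<phi> s w" by (rule zmin)
      qed
      then show ?thesis using gl(2) by simp
    next
      case False
      show ?thesis
      proof (cases "z \<in> \<Omega>")
        case True
        then have "dist y z = \<delta>" using False z by (simp add: V_def Z_def)
        then have "(z - y) \<bullet> (z - y) = \<delta>\<^sup>2" by (simp add: dist_norm norm_minus_commute dot_square_norm)
        then have "4 * M \<le> Bq * ((z - y) \<bullet> (z - y))" using Bq by simp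
        moreover have "\<bar>s * v z\<bar> \<le> 4 * M" using v_bound[OF z] s by (simp add: abs_mult)
        moreover have "0 \<le> A * \<psi> z" using psi_nonneg[OF z] pos(6) by simp
        ultimately show ?thesis unfolding \<phi>_def by linarith
      next
        case False
        then have zf: "z \<in> frontier \<Omega>" using closure_cases[OF zc] by blast
        show ?thesis using pos(5) by (simp add: \<phi>_def psi_frontier[OF zf] v_frontier[OF zf])
      qed
    qed
    then show ?thesis using zmin[OF x] by linarith
  qed

  let ?\<nu> = "gd y"
  note yc = frontier_closure[OF y(1)] and ycol = frontier_collar[OF y(1)]
  have yh: "y \<in> half" by (rule Zh[OF yZ])
  have n1: "norm ?\<nu> = 1" by (rule norm_gd[OF ycol])
  have nn: "?\<nu> \<bullet> ?\<nu> = 1" using n1 by (simp add: norm_eq_1)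
  define gv where "gv = (gd y $ j *\<^sub>R (Hu y $ i - Hb y $ i) + (gu y $ i - gb y $ i) *\<^sub>R (Hd y $ j))
      - (gd y $ i *\<^sub>R (Hu y $ j - Hb y $ j) + (gu y $ j - gb y $ j) *\<^sub>R (Hd y $ i))"
  have Dv: "(v has_derivative (\<lambda>k. gv \<bullet> k)) (at y within closure \<Omega>)"
  proof -
    have Dgu: "((\<lambda>x. gu x $ k) has_derivative (\<lambda>h. Hu y $ k \<bullet> h)) (at y within closure \<Omega>)" for k
      using has_derivative_nth[OF u_C2(2)[OF yc], of k] by (simp add: matrix_vector_nth)
    have Dgb: "((\<lambda>x. gb x $ k) has_derivative (\<lambda>h. Hb y $ k \<bullet> h)) (at y within closure \<Omega>)" for k
      using has_derivative_nth[OF ub_C2(2)[OF yc], of k] by (simp add: matrix_vector_nth)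
    have Dgd: "((\<lambda>x. gd x $ k) has_derivative (\<lambda>h. Hd y $ k \<bullet> h)) (at y within closure \<Omega>)" for k
      using has_derivative_nth[OF d_C2(2)[OF ycol], of k] by (simp add: matrix_vector_nth)
    have "(v has_derivative (\<lambda>k. (gd y $ j * (Hu y $ i \<bullet> k - Hb y $ i \<bullet> k) + (Hd y $ j \<bullet> k) * (gu y $ i - gb y $ i))
      - (gd y $ i * (Hu y $ j \<bullet> k - Hb y $ j \<bullet> k) + (Hd y $ i \<bullet> k) * (gu y $ j - gb y $ j)))) (at y within closure \<Omega>)"
      unfolding v_def by (intro has_derivative_diff has_derivative_mult Dgu Dgb Dgd)
    then show ?thesis
      by (rule has_derivative_eq_rhs) (simp add: gv_def fun_eq_iff inner_diff_left inner_add_left mult.commute)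
  qed
  have Dpsi: "(\<psi> has_derivative (\<lambda>k. (gh y + \<tau> *\<^sub>R ?\<nu>) \<bullet> k)) (at y within closure \<Omega>)"
  proof -
    note Dh = h_derivative[OF yc] and Dd = d_C2(1)[OF ycol]
    have "(\<psi> has_derivative (\<lambda>k. gh y \<bullet> k + \<tau> * (?\<nu> \<bullet> k) - N * (?d y * (?\<nu> \<bullet> k) + (?\<nu> \<bullet> k) * ?d y)
        - N * (h y * (gh y \<bullet> k) + (gh y \<bullet> k) * h y))) (at y within closure \<Omega>)"
      unfolding \<psi>_def
      by (intro has_derivative_diff has_derivative_add has_derivative_mult_right has_derivative_mult Dh Dd)
    then show ?thesis
      by (rule has_derivative_eq_rhs)
        (simp add: fun_eq_iff inner_add_left h_frontier[OF y(1)] bdist_frontier[OF y(1)])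
  qed
  \<comment> \<open>\<phi> is nonnegative on \<open>Z\<close> and zero at y, so its derivative along
    the inward normal is nonnegative; the penalty contributes nothing to it. Both signs of s
    together bound the normal derivative of v.\<close>
  have key: "0 \<le> A * ((gh y + \<tau> *\<^sub>R ?\<nu>) \<bullet> ?\<nu>) + s * (gv \<bullet> ?\<nu>)" if s: "\<bar>s\<bar> = 1" for s
  proof -
    have Dq: "((\<lambda>x. (x - y) \<bullet> (x - y)) has_derivative (\<lambda>k. 0)) (at y within closure \<Omega>)"
      by (auto intro!: derivative_eq_intros)
    have D: "(\<phi> s has_derivative (\<lambda>k. A * ((gh y + \<tau> *\<^sub>R ?\<nu>) \<bullet> k) + Bq * 0 + s * (gv \<bullet> k))) (at y within closure \<Omega>)"
      unfolding \<phi>_def by (intro has_derivative_add has_derivative_mult_right Dpsi Dq Dv)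
    have "0 < inward_normal \<Omega> y \<bullet> ?\<nu>" using nn by (simp add: gd_frontier[OF y(1)])
    from inward_normal(3)[OF y(1) this] obtain e0 where e0: "e0 > 0" "\<And>q. 0 < q \<Longrightarrow> q < e0 \<Longrightarrow> y + q *\<^sub>R ?\<nu> \<in> \<Omega>"
      by blast
    define e where "e = min e0 \<delta>"
    have e: "e > 0" using e0 pos by (simp add: e_def)
    have inZ: "y + q *\<^sub>R ?\<nu> \<in> Z" if "0 \<le> q" "q < e" for q
    proof (cases "q = 0")
      case False
      then show ?thesis using e0(2)[of q] that dom_closure n1 by (simp add: Z_def e_def dist_norm)
    qed (simp add: yZ)
    have "- (A * ((gh y + \<tau> *\<^sub>R ?\<nu>) \<bullet> ?\<nu>) + Bq * 0 + s * (gv \<bullet> ?\<nu>)) \<le> 0"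
    proof (rule slope_le[OF e])
      show "((\<lambda>q. - \<phi> s (y + q *\<^sub>R ?\<nu>)) has_vector_derivative
          - (A * ((gh y + \<tau> *\<^sub>R ?\<nu>) \<bullet> ?\<nu>) + Bq * 0 + s * (gv \<bullet> ?\<nu>))) (at 0 within {0..<e})"
      proof (rule has_vector_derivative_minus, rule ray_derivative[OF D e])
        show "y + q *\<^sub>R ?\<nu> \<in> closure \<Omega>" if "0 \<le> q" "q < e" for q using inZ[OF that] by (simp add: Z_def)
      qed
      show "- \<phi> s (y + q *\<^sub>R ?\<nu>) \<le> - \<phi> s (y + 0 *\<^sub>R ?\<nu>) + 0 * q" if "0 < q" "q < e" for q
      proof -
        have "\<phi> s y = 0" by (simp add: \<phi>_def psi_frontier[OF y(1)] v_frontier[OF y(1)])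
        moreover have "0 \<le> \<phi> s (y + q *\<^sub>R ?\<nu>)" using that by (intro phi_nonneg inZ s) auto
        ultimately show ?thesis by simp
      qed
    qed
    then show ?thesis by simp
  qed
  have "(gh y + \<tau> *\<^sub>R ?\<nu>) \<bullet> ?\<nu> \<le> 2 * M + \<tau>"
    using Cauchy_Schwarz_ineq2[of "gh y" ?\<nu>] ngh[OF yc] n1 nn by (simp add: inner_add_left)
  then have "A * ((gh y + \<tau> *\<^sub>R ?\<nu>) \<bullet> ?\<nu>) \<le> A * (2 * M + \<tau>)" using pos(6) by (rule mult_left_mono)
  then have gv_bound: "\<bar>gv \<bullet> ?\<nu>\<bar> \<le> A * (2 * M + \<tau>)" using key[of 1] key[of "-1"] by auto
  have rest: "\<bar>gd y $ k * (Hb y $ m \<bullet> ?\<nu>)\<bar> \<le> M" "\<bar>(gu y $ m - gb y $ m) * (Hd y $ k \<bullet> ?\<nu>)\<bar> \<le> 2 * M * M" for k m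
  proof -
    have in_row: "\<bar>T $ p \<bullet> ?\<nu>\<bar> \<le> M" if "norm T \<le> M" for T :: "real^'n^'n" and p
      using Cauchy_Schwarz_ineq2[of "T $ p" ?\<nu>] row[of T p] that n1 by simp
    have "\<bar>gd y $ k\<bar> * \<bar>Hb y $ m \<bullet> ?\<nu>\<bar> \<le> 1 * M" using M(3)[OF yc] by (intro mult_mono gd1[OF yh] in_row) auto
    then show "\<bar>gd y $ k * (Hb y $ m \<bullet> ?\<nu>)\<bar> \<le> M" by (simp add: abs_mult)
    have "\<bar>gu y $ m - gb y $ m\<bar> * \<bar>Hd y $ k \<bullet> ?\<nu>\<bar> \<le> 2 * M * M"
      using M(5)[OF yh] M0 by (intro mult_mono ghk[OF yc] in_row) auto
    then show "\<bar>(gu y $ m - gb y $ m) * (Hd y $ k \<bullet> ?\<nu>)\<bar> \<le> 2 * M * M" by (simp add: abs_mult)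
  qed
  \<comment> \<open>Up to terms made of first derivatives of the solution and of the data, the
    antisymmetrized Hessian entry is the normal derivative of v.\<close>
  have "gd y $ j * (Hu y *v ?\<nu>) $ i - gd y $ i * (Hu y *v ?\<nu>) $ j =
      gv \<bullet> ?\<nu> + gd y $ j * (Hb y $ i \<bullet> ?\<nu>) - gd y $ i * (Hb y $ j \<bullet> ?\<nu>)
      - (gu y $ i - gb y $ i) * (Hd y $ j \<bullet> ?\<nu>) + (gu y $ j - gb y $ j) * (Hd y $ i \<bullet> ?\<nu>)"
    unfolding gv_def matrix_vector_nth by (simp add: inner_add_left inner_diff_left algebra_simps)
  then show ?thesis
    using gv_bound rest(1)[of j i] rest(1)[of i j] rest(2)[of i j] rest(2)[of j i]
    by (simp only: power2_eq_square)
qed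

end

section \<open>The full boundary Hessian\<close>

text \<open>The denominator k + 1 allows k = 0 in the choice of small parameters.\<close>

lemma mult_le_of_le_divide:
  fixes k m q :: real
  assumes "0 \<le> k" "0 \<le> m" "q \<le> m / (k + 1)" shows "k * q \<le> m"
proof -
  have "k * q \<le> k * (m / (k + 1))" using assms by (intro mult_left_mono)
  also have "\<dots> = m * (k / (k + 1))" by simp
  also have "\<dots> \<le> m * 1" using assms by (intro mult_left_mono) auto
  finally show ?thesis by simp
qed

lemma op_norm_le:
  fixes X :: "real^'n^'n"
  assumes b: "\<And>v w. \<bar>(X *v v) \<bullet> w\<bar> \<le> b * (norm v * norm w)" shows "op_norm X \<le> b"
  unfolding op_norm_def
proof (rule onorm_le)
  fix v
  have "norm (X *v v) * norm (X *v v) \<le> (b * norm v) * norm (X *v v)"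
    using b[of v "X *v v"] by (simp add: dot_square_norm power2_eq_square mult.assoc)
  moreover have "0 \<le> b * norm v"
  proof (cases "v = 0")
    case False
    have "0 \<le> b * (norm v * norm v)" using b[of v v] by linarith
    moreover have "0 < norm v * norm v" using False by simp
    ultimately have "0 \<le> b" by (meson mult_neg_pos not_le)
    then show ?thesis by simp
  qed simp
  ultimately show "norm (X *v v) \<le> b * norm v"
    by (cases "X *v v = 0") auto
qed

text \<open>Splitting both arguments into tangential and normal parts gives one tangential and two
  mixed terms, whence the factor 3, and the double normal entry.\<close>

lemma op_norm_split:
  fixes X :: "real^'n^'n"
  assumes X: "X \<in> Sym" "psd X" and nu: "norm \<nu> = 1" and C: "0 \<le> C"
    and XT: "\<And>v w. \<nu> \<bullet> v = 0 \<Longrightarrow> \<nu> \<bullet> w = 0 \<Longrightarrow> \<bar>(X *v v) \<bullet> w\<bar> \<le> C * (norm v * norm w)"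
    and XN: "\<And>v. \<nu> \<bullet> v = 0 \<Longrightarrow> \<bar>(X *v \<nu>) \<bullet> v\<bar> \<le> C * norm v"
  shows "op_norm X \<le> 3 * C + (X *v \<nu>) \<bullet> \<nu>"
proof (rule op_norm_le)
  fix v w :: "real^'n"
  have nn: "\<nu> \<bullet> \<nu> = 1" using nu by (simp add: norm_eq_1)
  let ?N = "(X *v \<nu>) \<bullet> \<nu>"
  have N: "0 \<le> ?N" using X(2) by (simp add: psd_def inner_commute)
  define pr where "pr = (\<lambda>v. v - (\<nu> \<bullet> v) *\<^sub>R \<nu>)"
  have pT: "\<nu> \<bullet> pr v = 0" for v using nn by (simp add: pr_def inner_diff_right)
  have dec: "v = pr v + (\<nu> \<bullet> v) *\<^sub>R \<nu>" for v by (simp add: pr_def)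
  have npr: "norm (pr v) \<le> norm v" for v
  proof -
    have "(norm v)\<^sup>2 = (norm (pr v))\<^sup>2 + (\<nu> \<bullet> v)\<^sup>2"
      unfolding power2_norm_eq_inner using nn
      by (simp add: pr_def inner_diff_left inner_diff_right inner_commute power2_eq_square)
    then have "(norm (pr v))\<^sup>2 \<le> (norm v)\<^sup>2" by simp
    then show ?thesis by (rule power2_le_imp_le) simp
  qed
  have a: "\<bar>\<nu> \<bullet> v\<bar> \<le> norm v" for v using Cauchy_Schwarz_ineq2[of \<nu> v] nu by simp
  have cr: "\<bar>(\<nu> \<bullet> w) * ((X *v \<nu>) \<bullet> pr v)\<bar> \<le> C * (norm v * norm w)" for v w
  proof -
    have "\<bar>(X *v \<nu>) \<bullet> pr v\<bar> \<le> C * norm v" using XN[OF pT[of v]] mult_left_mono[OF npr[of v] C] by linarith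
    then have "\<bar>\<nu> \<bullet> w\<bar> * \<bar>(X *v \<nu>) \<bullet> pr v\<bar> \<le> norm w * (C * norm v)" by (intro mult_mono a) auto
    then show ?thesis by (simp add: abs_mult mult_ac)
  qed
  have "(X *v v) \<bullet> w = (X *v pr v) \<bullet> pr w + (\<nu> \<bullet> w) * ((X *v \<nu>) \<bullet> pr v) + (\<nu> \<bullet> v) * ((X *v \<nu>) \<bullet> pr w) + (\<nu> \<bullet> v) * (\<nu> \<bullet> w) * ?N"
  proof -
    have s: "(X *v pr v) \<bullet> \<nu> = (X *v \<nu>) \<bullet> pr v" using Sym_inner[OF X(1), of "pr v" \<nu>] by (simp add: inner_commute)
    show ?thesis
      by (subst (1) dec[of v], subst (1) dec[of w])
        (simp add: matrix_vector_right_distrib matrix_vector_mult_scaleR inner_add_left inner_add_right s algebra_simps)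
  qed
  moreover have "\<bar>(X *v pr v) \<bullet> pr w\<bar> \<le> C * (norm v * norm w)"
  proof -
    have "norm (pr v) * norm (pr w) \<le> norm v * norm w" by (intro mult_mono npr) auto
    then show ?thesis using XT[OF pT[of v] pT[of w]] mult_left_mono[OF _ C] order_trans by blast
  qed
  moreover have "\<bar>(\<nu> \<bullet> v) * ((X *v \<nu>) \<bullet> pr w)\<bar> \<le> C * (norm v * norm w)" using cr[where v = w and w = v] by (simp add: mult_ac)
  moreover note cr[where v = v and w = w]
  moreover have "\<bar>(\<nu> \<bullet> v) * (\<nu> \<bullet> w) * ?N\<bar> \<le> ?N * (norm v * norm w)"
  proof -
    have "\<bar>\<nu> \<bullet> v\<bar> * \<bar>\<nu> \<bullet> w\<bar> \<le> norm v * norm w" by (intro mult_mono a) auto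
    then have "?N * (\<bar>\<nu> \<bullet> v\<bar> * \<bar>\<nu> \<bullet> w\<bar>) \<le> ?N * (norm v * norm w)" using N by (rule mult_left_mono)
    then show ?thesis using N by (simp add: abs_mult mult_ac)
  qed
  ultimately have "\<bar>(X *v v) \<bullet> w\<bar> \<le> 3 * (C * (norm v * norm w)) + ?N * (norm v * norm w)" by linarith
  then show "\<bar>(X *v v) \<bullet> w\<bar> \<le> (3 * C + ?N) * (norm v * norm w)" by (simp add: distrib_right)
qed

context homotopy_solution begin

lemma Hu_Sym: assumes x: "x \<in> closure \<Omega>" shows "Hu x \<in> Sym"
proof -
  have "Hu x $ i $ j - Hu x $ j $ i = 0" for i j
    by (rule continuous_constant_on_closure[of \<Omega> "\<lambda>x. Hu x $ i $ j - Hu x $ j $ i", OF _ _ x])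
      (intro continuous_on_diff C_k_on_continuous[OF u_C2(4)], simp add: Sym_nth[OF Hu_Sym_dom])
  then show ?thesis by (simp add: Sym_def transpose_def vec_eq_iff)
qed

lemma Hu_psd: assumes x: "x \<in> closure \<Omega>" shows "psd (Hu x)"
  unfolding psd_def
proof
  fix v
  have "continuous_on (closure \<Omega>) (\<lambda>x. v \<bullet> (Hu x *v v))"
    unfolding inner_vec_def matrix_vector_mult_def
    by (simp, intro continuous_on_sum continuous_on_mult continuous_on_const C_k_on_continuous[OF u_C2(4)])
  then show "0 \<le> v \<bullet> (Hu x *v v)"
    by (rule continuous_ge_on_closure[OF _ x]) (use level_jet_dom in \<open>simp add: level_jet_def psd_def\<close>)
qed

text \<open>The equation is posed in the open set; continuity of the operator along the solution
  carries it to the boundary, where the double normal estimate needs it.\<close>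

lemma G_closure: assumes x: "x \<in> closure \<Omega>" shows "G_fun t (gu x) (Hu x) = \<theta>"
proof (rule continuous_constant_on_closure[of \<Omega> "\<lambda>x. G_fun t (gu x) (Hu x)", OF _ _ x])
  show "continuous_on (closure \<Omega>) (\<lambda>x. G_fun t (gu x) (Hu x))"
    by (rule has_derivative_continuous_on) (rule G_fun_has_derivative[OF u_C2(2) Hu_derivative Hu_Sym])
  show "G_fun t (gu y) (Hu y) = \<theta>" if "y \<in> \<Omega>" for y using level_jet_dom[OF that] by (simp add: level_jet_def)
qed

text \<open>The same form is computed from two extensions of the boundary values. From the solution,
  with s its normal derivative, only the tangential block of D^2u remains; from \<open>ub\<close>
  one obtains an expression in the data and the gradient, which bounds that block.\<close>

lemma M_form_u:
  assumes y: "y \<in> frontier \<Omega>" and v: "gd y \<bullet> v = 0" and w: "gd y \<bullet> w = 0"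
  shows "M_form \<Omega> ub y (normal_deriv \<Omega> u y) v w = (Hu y *v v) \<bullet> w"
    "(Hu y *v v) \<bullet> w = (Hb y *v v) \<bullet> w + (gu y \<bullet> gd y - gb y \<bullet> gd y) * ((Hd y *v v) \<bullet> w)"
proof -
  note N = inward_normal[OF y, folded gd_frontier[OF y]]
  have T: "v \<in> tangent_space (frontier \<Omega>) y" "w \<in> tangent_space (frontier \<Omega>) y" using v w by (simp_all add: N(2))
  have s: "normal_deriv \<Omega> u y = gu y \<bullet> gd y" by (simp add: normal_deriv_def gu_def gd_frontier[OF y])
  have bu: "u x = ub x" if "x \<in> frontier \<Omega>" for x using h_frontier[OF that] by simp
  show 1: "M_form \<Omega> ub y (normal_deriv \<Omega> u y) v w = (Hu y *v v) \<bullet> w"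
    using M_form_eq[OF y T u_C2(1)[OF frontier_closure] u_C2(2)[OF frontier_closure[OF y]] bu,
        of "normal_deriv \<Omega> u y"] by (simp add: s)
  show "(Hu y *v v) \<bullet> w = (Hb y *v v) \<bullet> w + (gu y \<bullet> gd y - gb y \<bullet> gd y) * ((Hd y *v v) \<bullet> w)"
    using M_form_eq[OF y T ub_C2(1)[OF frontier_closure] ub_C2(2)[OF frontier_closure[OF y]] refl,
        of "normal_deriv \<Omega> u y"] unfolding 1 by (simp add: s)
qed

lemma M_nonneg_u: "y \<in> frontier \<Omega> \<Longrightarrow> M_nonneg \<Omega> ub y (normal_deriv \<Omega> u y)"
  unfolding M_nonneg_def
proof
  fix v assume y: "y \<in> frontier \<Omega>" and "v \<in> tangent_space (frontier \<Omega>) y"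
  then have "gd y \<bullet> v = 0" using inward_normal(2)[OF y] by (simp add: gd_frontier)
  then show "0 \<le> M_form \<Omega> ub y (normal_deriv \<Omega> u y) v v"
    using Hu_psd[OF frontier_closure[OF y]] by (simp add: M_form_u[OF y] psd_def inner_commute)
qed

text \<open>On the boundary Du has tangential part D_T of the boundary data and normal part s =
  u_\<nu>. The limiting phase at this s is therefore pi/2 plus the arctan sum over the tangential
  block of D^2u, the form in which \<open>double_normal\<close> expects the gap.\<close>

lemma boundary_estimate:
  fixes M C \<sigma> :: real
  assumes M: "1 \<le> M" "\<And>x. x \<in> closure \<Omega> \<Longrightarrow> norm (gb x) \<le> M" "\<And>x. x \<in> closure \<Omega> \<Longrightarrow> norm (Hb x) \<le> M"
    "\<And>x. x \<in> half \<Longrightarrow> norm (Hd x) \<le> M" "\<And>p. p \<in> K \<Longrightarrow> norm p \<le> M"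
    and C: "M + 2 * M * M \<le> C" and y: "y \<in> frontier \<Omega>"
    and mixed: "\<And>w. gd y \<bullet> w = 0 \<Longrightarrow> \<bar>(Hu y *v gd y) \<bullet> w\<bar> \<le> C * norm w"
    and \<sigma>: "0 < \<sigma>" and gap: "\<theta> + \<sigma> \<le> limiting_phase \<Omega> ub y (normal_deriv \<Omega> u y)"
  shows "op_norm (Hu y) \<le> 3 * C + (1 + M)^6 * ((8 * CARD('n) * C\<^sup>2 + 2) / \<sigma> + 2 * C)"
proof -
  let ?\<nu> = "gd y" and ?s = "normal_deriv \<Omega> u y"
  note yc = frontier_closure[OF y] and ycol = frontier_collar[OF y]
  note N = inward_normal[OF y, folded gd_frontier[OF y]]
  have yh: "y \<in> half" using yc bdist_frontier[OF y] r_pos by (simp add: half_def)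
  have C0: "0 \<le> C" using C M(1) by (smt (verit) mult_nonneg_nonneg)
  have ngu: "norm (gu y) \<le> M" using M(5) gu_K yc by blast
  have s: "?s = gu y \<bullet> ?\<nu>" by (simp add: normal_deriv_def gu_def gd_frontier[OF y])
  have XT: "\<bar>(Hu y *v v) \<bullet> w\<bar> \<le> C * (norm v * norm w)" if vw: "?\<nu> \<bullet> v = 0" "?\<nu> \<bullet> w = 0" for v w
  proof -
    have mb: "\<bar>(T *v v) \<bullet> w\<bar> \<le> M * (norm v * norm w)" if "norm T \<le> M" for T :: "real^'n^'n"
    proof -
      have "\<bar>(T *v v) \<bullet> w\<bar> \<le> norm (T *v v) * norm w" by (rule Cauchy_Schwarz_ineq2)
      also have "\<dots> \<le> (norm T * norm v) * norm w" by (intro mult_right_mono norm_matrix_vector_mult_le) simp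
      also have "\<dots> \<le> (M * norm v) * norm w" using that by (intro mult_right_mono) auto
      finally show ?thesis by (simp add: mult.assoc)
    qed
    have in\<nu>: "\<bar>g \<bullet> ?\<nu>\<bar> \<le> norm g" for g using Cauchy_Schwarz_ineq2[of g ?\<nu>] N(1) by simp
    have "\<bar>gu y \<bullet> ?\<nu> - gb y \<bullet> ?\<nu>\<bar> \<le> 2 * M" using in\<nu>[of "gu y"] in\<nu>[of "gb y"] ngu M(2)[OF yc] by linarith
    then have "\<bar>gu y \<bullet> ?\<nu> - gb y \<bullet> ?\<nu>\<bar> * \<bar>(Hd y *v v) \<bullet> w\<bar> \<le> (2 * M) * (M * (norm v * norm w))"
      using mb[OF M(4)[OF yh]] M(1) by (intro mult_mono) auto
    then have "\<bar>(Hu y *v v) \<bullet> w\<bar> \<le> M * (norm v * norm w) + (2 * M) * (M * (norm v * norm w))"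
      using mb[OF M(3)[OF yc]] unfolding M_form_u(2)[OF y vw] abs_mult[symmetric] by linarith
    also have "\<dots> = (M + 2 * M * M) * (norm v * norm w)" by (simp add: distrib_right)
    also have "\<dots> \<le> C * (norm v * norm w)" using C by (intro mult_right_mono) auto
    finally show ?thesis .
  qed
  have tg: "tangential_grad (frontier \<Omega>) ub y = gu y - (gu y \<bullet> ?\<nu>) *\<^sub>R ?\<nu>"
  proof -
    have "tangential_grad (frontier \<Omega>) ub y = tangential_grad (frontier \<Omega>) u y"
      by (rule tangential_grad_cong[OF _ y]) (use h_frontier in simp)
    also have "\<dots> = gu y - (gu y \<bullet> ?\<nu>) *\<^sub>R ?\<nu>" by (rule tangential_grad_eq[OF y u_C2(1)[OF yc]])
    finally show ?thesis .
  qed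
  let ?q = "gu y - (gu y \<bullet> ?\<nu>) *\<^sub>R ?\<nu>"
  have C1: "C1T \<Omega> ub y ?s = (\<lambda>v. sqrt (1 + (norm (gu y))\<^sup>2) *\<^sub>R (v + (?q \<bullet> v) *\<^sub>R ?q))"
    by (simp add: C1T_def Let_def tg s gd_frontier[OF y, symmetric] fun_eq_iff)
  define R where "R = inv_sqrt_on {v. ?\<nu> \<bullet> v = 0} (\<lambda>v. sqrt (1 + (norm (gu y))\<^sup>2) *\<^sub>R (v + (?q \<bullet> v) *\<^sub>R ?q))"
  have lp: "limiting_phase \<Omega> ub y ?s = pi / 2 + arctan_sum_on {v. ?\<nu> \<bullet> v = 0} (\<lambda>v w. M_form \<Omega> ub y ?s (R v) (R w))"
    by (simp add: limiting_phase_def Let_def N(2) C1 R_def)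
  have "(Hu y *v ?\<nu>) \<bullet> ?\<nu> \<le> (1 + M)^6 * ((8 * CARD('n) * C\<^sup>2 + 2) / \<sigma> + 2 * C)"
  proof (rule double_normal[OF N(1) Hu_Sym[OF yc] Hu_psd[OF yc] t C0 _ XT mixed M_form_u(1)[OF y] refl R_def \<sigma>])
    show "wt (gu y) \<le> 1 + M" using wt_le[of "gu y"] ngu by linarith
    show "G_fun t (gu y) (Hu y) + \<sigma> \<le> pi / 2 + arctan_sum_on {v. ?\<nu> \<bullet> v = 0} (\<lambda>v w. M_form \<Omega> ub y ?s (R v) (R w))"
      using gap unfolding lp G_closure[OF yc] .
  qed
  moreover have "op_norm (Hu y) \<le> 3 * C + (Hu y *v ?\<nu>) \<bullet> ?\<nu>"
    by (rule op_norm_split[OF Hu_Sym[OF yc] Hu_psd[OF yc] N(1) C0 XT mixed])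
  ultimately show ?thesis by linarith
qed

end

section \<open>Constants independent of the solution, of t and of the gap\<close>

context homotopy_problem begin

text \<open>The parameters are fixed in the order N, \<delta>, Bq, A. Each depends only on the data
  and on \<tau>, \<eta> at \<open>x0\<close>, so one constant serves all t, all solutions and all
  boundary points near \<open>x0\<close>.\<close>

lemma mixed_local:
  assumes mrc: "MRC_at \<Omega> \<theta> ub K r x0" and x0: "x0 \<in> frontier \<Omega>"
  shows "\<exists>\<rho>>0. \<exists>C\<ge>0. \<forall>t u y w. homotopy_solution \<Omega> r \<theta> ub K t u \<longrightarrow> y \<in> frontier \<Omega> \<longrightarrow> dist x0 y < \<rho> \<longrightarrow>
    gd y \<bullet> w = 0 \<longrightarrow> \<bar>(hess_on (closure \<Omega>) u y *v gd y) \<bullet> w\<bar> \<le> C * norm w"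
proof -
  obtain \<tau> \<eta> where te: "\<tau> > 0" "\<eta> > 0" and deg: "\<forall>x t p X. x \<in> collar \<Omega> r \<and> dist x x0 < \<eta> \<and> level_jet \<theta> K t p X \<and>
      jet_normal \<Omega> x t p X < \<eta> \<and> jet_Q \<Omega> ub x t p X < \<eta> \<longrightarrow>
      \<eta> \<le> jet_J \<Omega> ub x t p X - \<tau> * jet_l \<Omega> x t p X"
    using MRC_uniform[OF mrc x0] by blast
  obtain M where M: "1 \<le> M" "\<And>x. x \<in> closure \<Omega> \<Longrightarrow> norm (gb x) \<le> M" "\<And>x. x \<in> closure \<Omega> \<Longrightarrow> norm (Hb x) \<le> M"
    "\<And>x i. x \<in> closure \<Omega> \<Longrightarrow> norm (Tb i x) \<le> M" "\<And>x. x \<in> half \<Longrightarrow> norm (Hd x) \<le> M"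
    "\<And>x i. x \<in> half \<Longrightarrow> norm (Td i x) \<le> M" "\<And>p. p \<in> K \<Longrightarrow> norm p \<le> M"
    by (rule uniform_bound) (rule that)
  let ?c = "jc (CARD('n)) M" and ?CJ = "4 * jc (CARD('n)) M * M"
  have c0: "0 \<le> ?c" using M(1) by (simp add: jc_def)
  have CJ0: "0 \<le> ?CJ" using c0 M(1) by simp
  \<comment> \<open>The smallest N for which 2 N \<eta> covers the bound on J and \<tau> l plus the
    gain \<eta>.\<close>
  define N where "N = (?CJ * (1 + \<tau>) + \<eta>) / (2 * \<eta>)"
  have "0 \<le> ?CJ * (1 + \<tau>)" by (rule mult_nonneg_nonneg[OF CJ0]) (use te in simp)
  then have N0: "0 \<le> N" unfolding N_def using te by (intro divide_nonneg_pos) auto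
  have N: "?CJ * (1 + \<tau>) + \<eta> \<le> 2 * N * \<eta>" using te by (simp add: N_def)
  define k1 where "k1 = 2 * N * ?CJ * (1 + 2 * M)"
  define k2 where "k2 = 2 * M * N"
  have k: "0 \<le> k1" "0 \<le> k2" 
    unfolding k1_def k2_def by (intro mult_nonneg_nonneg; use N0 c0 M(1) in auto)+
  \<comment> \<open>In order: staying within reach of the recession inequality, staying in
    \<open>half\<close>, smallness of the error terms of the squares, and the two conditions that
    make the barrier nonnegative.\<close>
  define \<delta> where "\<delta> = Min {\<eta> / 2, r / 2, (\<eta> / 2) / (k1 + 1), 1 / (k2 + 1), \<tau> / (N + 1)}"
  have \<delta>0: "0 < \<delta>" unfolding \<delta>_def using te r_pos k N0 by (subst Min_gr_iff) (auto intro!: divide_pos_pos)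
  have \<delta>: "\<delta> \<le> \<eta> / 2" "\<delta> \<le> r / 2" "\<delta> \<le> (\<eta> / 2) / (k1 + 1)" "\<delta> \<le> 1 / (k2 + 1)" "\<delta> \<le> \<tau> / (N + 1)"
    unfolding \<delta>_def by (rule Min_le; simp)+
  have \<delta>': "k1 * \<delta> \<le> \<eta> / 2" "k2 * \<delta> \<le> 1" "N * \<delta> \<le> \<tau>"
    by (rule mult_le_of_le_divide[OF k(1) _ \<delta>(3)], use te in simp)
      (rule mult_le_of_le_divide[OF k(2) _ \<delta>(4)], simp,
        rule mult_le_of_le_divide[OF N0 _ \<delta>(5)], use te in simp)
  define Bq where "Bq = 4 * M / \<delta>\<^sup>2"
  have Bq: "4 * M \<le> Bq * \<delta>\<^sup>2" "0 \<le> Bq" using \<delta>0 M(1) by (simp_all add: Bq_def)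
  define L where "L = Bq * (2 * ?c * norm (mat 1 :: real^'n^'n) + 2 * ?c * \<delta>) + 20 * ?c * M\<^sup>2"
  have L0: "0 \<le> L" unfolding L_def using Bq(2) c0 \<delta>0 by (intro add_nonneg_nonneg mult_nonneg_nonneg) auto
  \<comment> \<open>\<open>L\<close> collects what the penalty and v can add to the operator, while
    the barrier contributes at most -\<eta>/2; here A \<eta>/2 = L + 1 > L.\<close>
  define A where "A = (L + 1) * (2 / \<eta>)"
  have A0: "0 \<le> A" unfolding A_def using L0 te by (intro mult_nonneg_nonneg) auto
  have A: "L < A * (\<eta> / 2)" using te by (simp add: A_def)
  define E where "E = A * (2 * M + \<tau>) + 2 * M + 4 * M\<^sup>2"
  have E0: "0 \<le> E" unfolding E_def using A0 M(1) te by (intro add_nonneg_nonneg mult_nonneg_nonneg) auto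
  have main: "\<bar>(hess_on (closure \<Omega>) u y *v gd y) \<bullet> w\<bar> \<le> (CARD('n) * (CARD('n) * E)) * norm w"
    if S: "homotopy_solution \<Omega> r \<theta> ub K t u" and y: "y \<in> frontier \<Omega>" and near: "dist x0 y < \<eta> / 2" and w: "gd y \<bullet> w = 0"
    for t u y w
  proof -
    interpret S: homotopy_solution \<Omega> r \<theta> ub K t u by (rule S)
    let ?\<nu> = "gd y" and ?z = "S.Hu y *v gd y"
    have n1: "norm ?\<nu> = 1" by (rule norm_gd[OF frontier_collar[OF y]])
    have nn: "?\<nu> \<bullet> ?\<nu> = 1" using n1 by (simp add: norm_eq_1)
    have near': "dist y x0 < \<eta> / 2" using near by (simp only: dist_commute)
    have ij: "\<bar>?\<nu> $ j * ?z $ i - ?\<nu> $ i * ?z $ j\<bar> \<le> E" for i j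
      unfolding E_def
      by (rule S.mixed_at[OF M te \<delta>0 N0 Bq(2) A0 deg y near' N \<delta>(1,2) \<delta>'[unfolded k1_def k2_def] Bq(1) A[unfolded L_def]])
    \<comment> \<open>For a unit normal and w orthogonal to it, Lagrange's identity recovers z . w
      from the two-by-two minors of the pair formed by the normal and z.\<close>
    have "?z \<bullet> w = (\<Sum>i\<in>UNIV. \<Sum>j\<in>UNIV. w $ i * ?\<nu> $ j * (?\<nu> $ j * ?z $ i - ?\<nu> $ i * ?z $ j))"
    proof -
      have "(\<Sum>i\<in>UNIV. \<Sum>j\<in>UNIV. w $ i * ?\<nu> $ j * (?\<nu> $ j * ?z $ i - ?\<nu> $ i * ?z $ j))
          = (\<Sum>i\<in>UNIV. w $ i * ?z $ i) * (\<Sum>j\<in>UNIV. ?\<nu> $ j * ?\<nu> $ j) - (\<Sum>i\<in>UNIV. ?\<nu> $ i * w $ i) * (\<Sum>j\<in>UNIV. ?\<nu> $ j * ?z $ j)"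
        unfolding sum_product sum_subtractf[symmetric] by (intro sum.cong refl) (simp add: algebra_simps)
      also have "\<dots> = (w \<bullet> ?z) * (?\<nu> \<bullet> ?\<nu>) - (?\<nu> \<bullet> w) * (?\<nu> \<bullet> ?z)" by (simp add: inner_vec_def)
      finally show ?thesis using nn w by (simp add: inner_commute)
    qed
    also have "\<bar>\<dots>\<bar> \<le> CARD('n) * (CARD('n) * (norm w * E))"
    proof (rule abs_sum_card_le, rule abs_sum_card_le)
      fix i j
      have "\<bar>w $ i\<bar> * \<bar>?\<nu> $ j\<bar> * \<bar>?\<nu> $ j * ?z $ i - ?\<nu> $ i * ?z $ j\<bar> \<le> norm w * 1 * E"
        using component_le_norm_cart[of w i] component_le_norm_cart[of ?\<nu> j] n1 ij[of j i] by (intro mult_mono) auto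
      then show "\<bar>w $ i * ?\<nu> $ j * (?\<nu> $ j * ?z $ i - ?\<nu> $ i * ?z $ j)\<bar> \<le> norm w * E" by (simp add: abs_mult)
    qed
    finally show ?thesis by (simp add: S.Hu_def mult_ac)
  qed
  have "\<exists>C\<ge>0. \<forall>t u y w. homotopy_solution \<Omega> r \<theta> ub K t u \<longrightarrow> y \<in> frontier \<Omega> \<longrightarrow> dist x0 y < \<eta> / 2 \<longrightarrow>
    gd y \<bullet> w = 0 \<longrightarrow> \<bar>(hess_on (closure \<Omega>) u y *v gd y) \<bullet> w\<bar> \<le> C * norm w"
  proof (intro exI[of _ "CARD('n) * (CARD('n) * E)"] conjI allI impI)
    show "0 \<le> CARD('n) * (CARD('n) * E)" using E0 by simp
  qed (rule main)
  moreover have "0 < \<eta> / 2" using te by simp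
  ultimately show ?thesis by blast
qed

text \<open>Compactness of the frontier: finitely many of the local neighbourhoods cover it, and the
  sum of their constants dominates each. The local constants precede t and u, and so does the
  sum.\<close>

lemma mixed_uniform:
  assumes mrc: "\<forall>x0\<in>frontier \<Omega>. MRC_at \<Omega> \<theta> ub K r x0"
  shows "\<exists>C\<ge>0. \<forall>t u y w. homotopy_solution \<Omega> r \<theta> ub K t u \<longrightarrow> y \<in> frontier \<Omega> \<longrightarrow>
    gd y \<bullet> w = 0 \<longrightarrow> \<bar>(hess_on (closure \<Omega>) u y *v gd y) \<bullet> w\<bar> \<le> C * norm w"
proof -
  define P where "P = (\<lambda>x0 \<rho> C. \<forall>t u y w. homotopy_solution \<Omega> r \<theta> ub K t u \<longrightarrow> y \<in> frontier \<Omega> \<longrightarrow> dist x0 y < \<rho> \<longrightarrow>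
    gd y \<bullet> w = 0 \<longrightarrow> \<bar>(hess_on (closure \<Omega>) u y *v gd y) \<bullet> w\<bar> \<le> C * norm w)"
  have "\<forall>x0\<in>frontier \<Omega>. \<exists>z. 0 < fst z \<and> 0 \<le> snd z \<and> P x0 (fst z) (snd z)"
  proof
    fix x0 assume x0: "x0 \<in> frontier \<Omega>"
    obtain \<rho> C where "0 < \<rho>" "0 \<le> C" "P x0 \<rho> C"
      using mixed_local[OF mrc[rule_format, OF x0] x0] unfolding P_def by blast
    then show "\<exists>z. 0 < fst z \<and> 0 \<le> snd z \<and> P x0 (fst z) (snd z)" by (intro exI[of _ "(\<rho>, C)"]) simp
  qed
  then obtain z where z: "\<forall>x0\<in>frontier \<Omega>. 0 < fst (z x0) \<and> 0 \<le> snd (z x0) \<and> P x0 (fst (z x0)) (snd (z x0))"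
    by (rule bchoice[THEN exE])
  define \<rho> C where "\<rho> = (\<lambda>x. fst (z x))" and "C = (\<lambda>x. snd (z x))"
  have \<rho>: "\<rho> x0 > 0" and C: "C x0 \<ge> 0" and est: "P x0 (\<rho> x0) (C x0)" if "x0 \<in> frontier \<Omega>" for x0
    using z that by (simp_all add: \<rho>_def C_def)
  have "frontier \<Omega> \<subseteq> (\<Union>x0\<in>frontier \<Omega>. ball x0 (\<rho> x0))" using \<rho> by force
  then obtain F where F: "F \<subseteq> frontier \<Omega>" "finite F" "frontier \<Omega> \<subseteq> (\<Union>x0\<in>F. ball x0 (\<rho> x0))"
    using compactE_image[OF compact_frontier_dom, of "frontier \<Omega>" "\<lambda>x0. ball x0 (\<rho> x0)"] by auto
  have "\<bar>(hess_on (closure \<Omega>) u y *v gd y) \<bullet> w\<bar> \<le> (\<Sum>x\<in>F. C x) * norm w"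
    if S: "homotopy_solution \<Omega> r \<theta> ub K t u" and y: "y \<in> frontier \<Omega>" and w: "gd y \<bullet> w = 0" for t u y w
  proof -
    obtain x0 where x0: "x0 \<in> F" "dist x0 y < \<rho> x0" using F(3) y by auto
    have "\<bar>(hess_on (closure \<Omega>) u y *v gd y) \<bullet> w\<bar> \<le> C x0 * norm w"
      using est[of x0] x0 F(1) S y w unfolding P_def by blast
    also have "\<dots> \<le> (\<Sum>x\<in>F. C x) * norm w"
      using F C x0 by (intro mult_right_mono member_le_sum) auto
    finally show ?thesis .
  qed
  moreover have "0 \<le> (\<Sum>x\<in>F. C x)" using F(1) C by (intro sum_nonneg) auto
  ultimately show ?thesis by blast
qed

lemma boundary_hessian_bound:
  assumes mrc: "\<forall>x0\<in>frontier \<Omega>. MRC_at \<Omega> \<theta> ub K r x0"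
  shows "\<exists>C0 C1. \<forall>t u y \<sigma>. homotopy_solution \<Omega> r \<theta> ub K t u \<longrightarrow> y \<in> frontier \<Omega> \<longrightarrow> 0 < \<sigma> \<longrightarrow> \<sigma> < pi / 2 \<longrightarrow>
    \<theta> + \<sigma> \<le> limiting_phase \<Omega> ub y (normal_deriv \<Omega> u y) \<longrightarrow>
    op_norm (hess_on (closure \<Omega>) u y) \<le> C0 + C1 * cot \<sigma>"
proof -
  obtain M where M: "1 \<le> M" "\<And>x. x \<in> closure \<Omega> \<Longrightarrow> norm (gb x) \<le> M" "\<And>x. x \<in> closure \<Omega> \<Longrightarrow> norm (Hb x) \<le> M"
    "\<And>x i. x \<in> closure \<Omega> \<Longrightarrow> norm (Tb i x) \<le> M" "\<And>x. x \<in> half \<Longrightarrow> norm (Hd x) \<le> M"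
    "\<And>x i. x \<in> half \<Longrightarrow> norm (Td i x) \<le> M" "\<And>p. p \<in> K \<Longrightarrow> norm p \<le> M"
    by (rule uniform_bound) (rule that)
  obtain Cm where Cm: "Cm \<ge> 0" and mixed: "\<And>t u y w. homotopy_solution \<Omega> r \<theta> ub K t u \<Longrightarrow> y \<in> frontier \<Omega> \<Longrightarrow>
    gd y \<bullet> w = 0 \<Longrightarrow> \<bar>(hess_on (closure \<Omega>) u y *v gd y) \<bullet> w\<bar> \<le> Cm * norm w"
    using mixed_uniform[OF mrc] by blast
  define C where "C = M + 2 * M * M + Cm"
  have C: "M + 2 * M * M \<le> C" "Cm \<le> C" using Cm M(1) by (simp_all add: C_def)
  \<comment> \<open>The coefficient of 1/\<sigma>; the inequality 1/\<sigma> <= 1 + cot \<sigma>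
    puts one copy into the additive constant and makes the other the factor of cot \<sigma>.\<close>
  define D where "D = (1 + M)^6 * (8 * CARD('n) * C\<^sup>2 + 2)"
  have D0: "0 \<le> D" unfolding D_def using M(1) by (intro mult_nonneg_nonneg) auto
  have "op_norm (hess_on (closure \<Omega>) u y) \<le> (3 * C + (1 + M)^6 * (2 * C) + D) + D * cot \<sigma>"
    if S: "homotopy_solution \<Omega> r \<theta> ub K t u" and y: "y \<in> frontier \<Omega>" and \<sigma>: "0 < \<sigma>" "\<sigma> < pi / 2"
      and gap: "\<theta> + \<sigma> \<le> limiting_phase \<Omega> ub y (normal_deriv \<Omega> u y)" for t u y \<sigma>
  proof -
    interpret S: homotopy_solution \<Omega> r \<theta> ub K t u by (rule S)
    have mx: "\<bar>(S.Hu y *v gd y) \<bullet> w\<bar> \<le> C * norm w" if "gd y \<bullet> w = 0" for w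
      using mixed[OF S y that] mult_right_mono[OF C(2), of "norm w"] unfolding S.Hu_def by simp
    have "op_norm (S.Hu y) \<le> 3 * C + (1 + M)^6 * ((8 * CARD('n) * C\<^sup>2 + 2) / \<sigma> + 2 * C)"
      by (rule S.boundary_estimate[OF M(1,2,3,5,7) C(1) y mx \<sigma>(1) gap])
    also have "\<dots> = 3 * C + (1 + M)^6 * (2 * C) + D * (1 / \<sigma>)" by (simp add: D_def distrib_left)
    also have "\<dots> \<le> 3 * C + (1 + M)^6 * (2 * C) + D * (1 + cot \<sigma>)"
      using D0 inverse_le_one_plus_cot[OF \<sigma>] by (intro add_left_mono mult_left_mono)
    finally show ?thesis by (simp add: S.Hu_def distrib_left)
  qed
  then show ?thesis by blast
qed

end

theorem corollary1p6:
  fixes \<Omega> K :: "(real^'n) set" and \<theta> r :: real and ub :: "real^'n \<Rightarrow> real"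
  assumes "CARD('n) \<ge> 2"
    and "bounded_C_k_domain 4 \<Omega>"
    and "0 < \<theta>" and "\<theta> < real CARD('n) * pi / 2"
    and "C_k_on 3 (closure \<Omega>) ub" and "\<forall>x\<in>\<Omega>. psd (hess_on (closure \<Omega>) ub x)"
    and "compact K" and "convex K"
    and "regular_collar \<Omega> r"
    and "\<forall>x0\<in>frontier \<Omega>. MRC_at \<Omega> \<theta> ub K r x0"
  shows "\<exists>C0 C1 :: real.
    (\<forall>t\<in>{0..1}. \<forall>u \<sigma>.
       solution \<Omega> \<theta> ub K t u \<longrightarrow> 0 < \<sigma> \<longrightarrow> \<sigma> < pi / 2 \<longrightarrow>
       (\<forall>x\<in>frontier \<Omega>. limiting_phase \<Omega> ub x (normal_deriv \<Omega> u x) \<ge> \<theta> + \<sigma>) \<longrightarrow>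
       (SUP x\<in>frontier \<Omega>. ereal (op_norm (hess_on (closure \<Omega>) u x))) \<le> ereal (C0 + C1 * cot \<sigma>)) \<and>
    (\<forall>\<sigma> W.
       0 < \<sigma> \<longrightarrow> \<sigma> < pi / 2 \<longrightarrow> is_interval W \<longrightarrow>
       (\<forall>x\<in>frontier \<Omega>. \<forall>s\<in>W. M_nonneg \<Omega> ub x s \<longrightarrow> limiting_phase \<Omega> ub x s \<ge> \<theta> + \<sigma>) \<longrightarrow>
       (\<forall>t\<in>{0..1}. \<forall>u.
          solution \<Omega> \<theta> ub K t u \<longrightarrow> (\<forall>x\<in>frontier \<Omega>. normal_deriv \<Omega> u x \<in> W) \<longrightarrow>
          (SUP x\<in>frontier \<Omega>. ereal (op_norm (hess_on (closure \<Omega>) u x))) \<le> ereal (C0 + C1 * cot \<sigma>)))"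
proof -
  interpret homotopy_problem \<Omega> r \<theta> ub K
    by unfold_locales (rule assms)+
  obtain C0 C1 where est: "\<And>t u y \<sigma>. homotopy_solution \<Omega> r \<theta> ub K t u \<Longrightarrow> y \<in> frontier \<Omega> \<Longrightarrow> 0 < \<sigma> \<Longrightarrow> \<sigma> < pi / 2 \<Longrightarrow>
    \<theta> + \<sigma> \<le> limiting_phase \<Omega> ub y (normal_deriv \<Omega> u y) \<Longrightarrow>
    op_norm (hess_on (closure \<Omega>) u y) \<le> C0 + C1 * cot \<sigma>"
    using boundary_hessian_bound[OF assms(10)] by blast
  have S: "homotopy_solution \<Omega> r \<theta> ub K t u" if "t \<in> {0..1}" "solution \<Omega> \<theta> ub K t u" for t u
    using that by unfold_locales auto
  have sup: "(SUP x\<in>frontier \<Omega>. ereal (op_norm (hess_on (closure \<Omega>) u x))) \<le> ereal (C0 + C1 * cot \<sigma>)"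
    if "t \<in> {0..1}" "solution \<Omega> \<theta> ub K t u" "0 < \<sigma>" "\<sigma> < pi / 2"
      "\<forall>x\<in>frontier \<Omega>. limiting_phase \<Omega> ub x (normal_deriv \<Omega> u x) \<ge> \<theta> + \<sigma>" for t u \<sigma>
  proof (rule SUP_least)
    fix x assume "x \<in> frontier \<Omega>"
    then show "ereal (op_norm (hess_on (closure \<Omega>) u x)) \<le> ereal (C0 + C1 * cot \<sigma>)"
      using est[OF S[OF that(1,2)] _ that(3,4)] that(5) by simp
  qed
  \<comment> \<open>Convexity up to the boundary makes the tangential block nonnegative, so a gap
    imposed for admissible s in the window applies at s = u_\<nu>.\<close>
  have nonneg: "M_nonneg \<Omega> ub x (normal_deriv \<Omega> u x)"
    if "t \<in> {0..1}" "solution \<Omega> \<theta> ub K t u" "x \<in> frontier \<Omega>" for t u x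
    by (rule homotopy_solution.M_nonneg_u[OF S[OF that(1,2)] that(3)])
  show ?thesis
  proof (intro exI conjI allI ballI impI)
    fix t u \<sigma>
    assume "t \<in> {0..1}" "solution \<Omega> \<theta> ub K t u" "0 < \<sigma>" "\<sigma> < pi / 2"
      "\<forall>x\<in>frontier \<Omega>. limiting_phase \<Omega> ub x (normal_deriv \<Omega> u x) \<ge> \<theta> + \<sigma>"
    then show "(SUP x\<in>frontier \<Omega>. ereal (op_norm (hess_on (closure \<Omega>) u x))) \<le> ereal (C0 + C1 * cot \<sigma>)"
      by (rule sup)
  next
    fix \<sigma> W t u
    assume \<sigma>: "0 < \<sigma>" "\<sigma> < pi / 2"
      and gap: "\<forall>x\<in>frontier \<Omega>. \<forall>s\<in>W. M_nonneg \<Omega> ub x s \<longrightarrow> limiting_phase \<Omega> ub x s \<ge> \<theta> + \<sigma>"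
      and t: "t \<in> {0..1}" and sol: "solution \<Omega> \<theta> ub K t u"
      and W: "\<forall>x\<in>frontier \<Omega>. normal_deriv \<Omega> u x \<in> W"
    show "(SUP x\<in>frontier \<Omega>. ereal (op_norm (hess_on (closure \<Omega>) u x))) \<le> ereal (C0 + C1 * cot \<sigma>)"
      by (rule sup[OF t sol \<sigma>]) (use gap W nonneg[OF t sol] in blast)
  qed
qed

end
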